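(* Let $A\in\mathbf{R}^{n\times n}$ and $B\in\mathbf{R}^{n\times m}$ be such that $(A,B)$ is controllable and all eigenvalues of $A$ lie in the closed left-half plane, and consider the linear system $\dot x=Ax+Bu$. Let $P(\gamma)$, $\delta_{\mathrm c}$ and the ellipsoids $\mathscr{E}(\gamma)=\{x\in\mathbf{R}^n\mid 2n\gamma\,x^{\mathrm T}P(\gamma)x\le4\}$, $\gamma>0$, be as defined in the context. Let $\mathit{\Omega}\subset\mathbf{R}^n$ be a bounded set and let $\gamma_0>0$ be such that $\mathit{\Omega}\subseteq\mathscr{E}(\gamma_0)$. Then, for any prescribed time $T$ satisfying $$T>\frac{2n+\delta_{\mathrm c}}{2n\gamma_0}$$ and any constant $\eta\ge0$, the linear time-varying state feedback $$U(t,x)=-\left(\frac12+\eta\right)B^{\mathrm T}P(\gamma(t))x,\qquad \gamma(t)=\frac{T}{T-t}\gamma_0,\qquad t\in[0,T),$$ has the property that, with the saturated input $u(t)=\sigma(U(t,x(t)))$, the closed-loop system $$\dot x=Ax+B\sigma(U(t,x)),\quad t\in[0,T),$$ is exact $T$-finite-time stable with $\mathit{\Omega}$ contained in the domain of attraction. Moreover, there exist constants $\alpha_i>0$, $i=1,\ldots,5$, such that for any $x(0)\in\mathscr{E}(\gamma_0)$ the state and control of the closed-loop system satisfy, for all $t\in[0,T)$, $$\alpha_1(T-t)^{\alpha_3}\|x(0)\|\le\|x(t)\|\le\alpha_2(T-t)^{\alpha_4}\|x(0)\|,\qquad \|u(t)\|\le\alpha_5(T-t)^{\alpha_4}\|x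(0)\|.$$
   Context: Definition of $P(\gamma)$: for each $\gamma>0$, let $X=X(\gamma)$ be the unique positive definite solution of $A^{\mathrm T}X+XA+XBB^{\mathrm T}X=\gamma X$, let $Y=Y(\gamma)$ be the unique positive definite solution of $(A+BB^{\mathrm T}X)^{\mathrm T}Y+Y(A+BB^{\mathrm T}X)-YBB^{\mathrm T}Y=-\gamma Y$, and set $P(\gamma)=Y(\gamma)-X(\gamma)$. (Under the stated hypotheses on $(A,B)$ these solutions exist, and $P(\gamma)$ is positive definite and is a rational matrix function of $\gamma$.) The constant $\delta_{\mathrm c}>0$ is a constant such that $\frac{\mathrm dP}{\mathrm d\gamma}\le\frac{\delta_{\mathrm c}}{2n\gamma}P$ (Loewner order) for all $\gamma>0$; such a constant exists, namely $\delta_{\mathrm c}=\sup_{\gamma>0}\lambda_{\max}\left(2n\gamma\frac{\mathrm dP}{\mathrm d\gamma}P^{-1}\right)<\infty$. Saturation: $\sigma:\mathbf{R}^m\to[-1,1]^m$ is the componentwise standard saturation, $\sigma(u)=[\operatorname{sign}(u_1)\min\{|u_1|,1\},\ldots,\operatorname{sign}(u_m)\min\{|u_m|,1\}]^{\mathrm T}$. Exact $T$-finite-time stability: a system $\dot x=f(t,x)$, $x\in\mathbf{R}^n$, with $f(t,0)=0$ (considered on $t\in[0,T)$) is $T$-finite-time stable with $\mathit{\Omega}$ contained in the domain of attraction if it (i.e. its zero solution) is stable in the sense of Lyapunov, and $x(0)\in\mathit{\Omega}$ implies $\lim_{t\uparrow T}\|x(t)\|=0$. If in addition $x(t)\ne0$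 for all $t\in[0,T)$ whenever $x(0)\neq0$, it is exact $T$-finite-time stable. $\|\cdot\|$ is the Euclidean norm. *)

theory Defs
  imports "HOL-Analysis.Analysis"
begin

definition psd_matrix :: "real^'n^'n \<Rightarrow> bool" where
  "psd_matrix M \<longleftrightarrow> transpose M = M \<and> (\<forall>x. 0 \<le> x \<bullet> (M *v x))"

definition pd_matrix :: "real^'n^'n \<Rightarrow> bool" where
  "pd_matrix M \<longleftrightarrow> transpose M = M \<and> (\<forall>x. x \<noteq> 0 \<longrightarrow> 0 < x \<bullet> (M *v x))"

definition loewner_le :: "real^'n^'n \<Rightarrow> real^'n^'n \<Rightarrow> bool" where
  "loewner_le M N \<longleftrightarrow> psd_matrix (N - M)"

definition complex_eigenvalue :: "real^'n^'n \<Rightarrow> complex \<Rightarrow> bool" where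
  "complex_eigenvalue A l \<longleftrightarrow>
     (\<exists>v :: complex^'n. v \<noteq> 0 \<and> map_matrix complex_of_real A *v v = l *s v)"

text \<open>Every state can be steered to every other state in finite time. Inputs are Lebesgue
  integrable, so trajectories are solutions of the integral equation.\<close>

definition controllable :: "real^'n^'n \<Rightarrow> real^'m^'n \<Rightarrow> bool" where
  "controllable A B \<longleftrightarrow>
     (\<forall>x0 x1. \<exists>tf>0. \<exists>u :: real \<Rightarrow> real^'m. \<exists>x :: real \<Rightarrow> real^'n.
        u absolutely_integrable_on {0..tf} \<and> x 0 = x0 \<and> x tf = x1 \<and>
        (\<forall>t\<in>{0..tf}. ((\<lambda>s. A *v x s + B *v u s) has_integral (x t - x0)) {0..t}))"

definition riccati_X :: "real^'n^'n \<Rightarrow> real^'m^'n \<Rightarrow> real \<Rightarrow> real^'n^'n" where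
  "riccati_X A B \<gamma> = (THE X. pd_matrix X \<and>
     transpose A ** X + X ** A + X ** B ** transpose B ** X = \<gamma> *\<^sub>R X)"

definition riccati_Y :: "real^'n^'n \<Rightarrow> real^'m^'n \<Rightarrow> real \<Rightarrow> real^'n^'n" where
  "riccati_Y A B \<gamma> =
     (let F = A + B ** transpose B ** riccati_X A B \<gamma>
      in THE Y. pd_matrix Y \<and>
           transpose F ** Y + Y ** F - Y ** B ** transpose B ** Y = - (\<gamma> *\<^sub>R Y))"

definition P_mat :: "real^'n^'n \<Rightarrow> real^'m^'n \<Rightarrow> real \<Rightarrow> real^'n^'n" where
  "P_mat A B \<gamma> = riccati_Y A B \<gamma> - riccati_X A B \<gamma>"

definition is_delta_c :: "real^'n^'n \<Rightarrow> real^'m^'n \<Rightarrow> real \<Rightarrow> bool" where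
  "is_delta_c A B \<delta> \<longleftrightarrow> \<delta> > 0 \<and>
     (\<forall>\<gamma>>0. loewner_le (vector_derivative (P_mat A B) (at \<gamma>))
                      ((\<delta> / (2 * real CARD('n) * \<gamma>)) *\<^sub>R P_mat A B \<gamma>))"

definition ellipsoid :: "real^'n^'n \<Rightarrow> real^'m^'n \<Rightarrow> real \<Rightarrow> (real^'n) set" where
  "ellipsoid A B \<gamma> = {x. 2 * real CARD('n) * \<gamma> * (x \<bullet> (P_mat A B \<gamma> *v x)) \<le> 4}"

definition saturation :: "real^'m \<Rightarrow> real^'m" where
  "saturation u = (\<chi> i. sgn (u $ i) * min \<bar>u $ i\<bar> 1)"

definition gain_param :: "real \<Rightarrow> real \<Rightarrow> real \<Rightarrow> real" where
  "gain_param T \<gamma>0 t = T / (T - t) * \<gamma>0"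

definition feedback ::
  "real^'n^'n \<Rightarrow> real^'m^'n \<Rightarrow> real \<Rightarrow> real \<Rightarrow> real \<Rightarrow> real \<Rightarrow> real^'n \<Rightarrow> real^'m" where
  "feedback A B T \<gamma>0 \<eta> t x =
     (- (1/2 + \<eta>)) *\<^sub>R (transpose B *v (P_mat A B (gain_param T \<gamma>0 t) *v x))"

definition closed_loop ::
  "real^'n^'n \<Rightarrow> real^'m^'n \<Rightarrow> real \<Rightarrow> real \<Rightarrow> real \<Rightarrow> real \<Rightarrow> real^'n \<Rightarrow> real^'n" where
  "closed_loop A B T \<gamma>0 \<eta> t x = A *v x + B *v saturation (feedback A B T \<gamma>0 \<eta> t x)"

definition solution_from ::
  "(real \<Rightarrow> real^'n \<Rightarrow> real^'n) \<Rightarrow> real \<Rightarrow> real \<Rightarrow> real^'n \<Rightarrow> (real \<Rightarrow> real^'n) \<Rightarrow> bool" where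
  "solution_from f t0 T x0 x \<longleftrightarrow> x t0 = x0 \<and>
     (\<forall>t\<in>{t0..<T}. (x has_vector_derivative f t (x t)) (at t within {t0..<T}))"

text \<open>The system is time-varying, so stability is required from every initial time
  \<open>t0\<close>. Stability and attraction include that solutions exist up to time \<open>T\<close>; they
  constrain all solutions, since \<open>f\<close> is not assumed to yield unique ones.\<close>

definition lyapunov_stable :: "(real \<Rightarrow> real^'n \<Rightarrow> real^'n) \<Rightarrow> real \<Rightarrow> bool" where
  "lyapunov_stable f T \<longleftrightarrow>
     (\<forall>t0\<in>{0..<T}. \<forall>\<epsilon>>0. \<exists>\<delta>>0. \<forall>x0. norm x0 < \<delta> \<longrightarrow>
        (\<exists>x. solution_from f t0 T x0 x) \<and>
        (\<forall>x. solution_from f t0 T x0 x \<longrightarrow> (\<forall>t\<in>{t0..<T}. norm (x t) < \<epsilon>)))"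

definition finite_time_stable ::
  "(real \<Rightarrow> real^'n \<Rightarrow> real^'n) \<Rightarrow> real \<Rightarrow> (real^'n) set \<Rightarrow> bool" where
  "finite_time_stable f T \<Omega> \<longleftrightarrow>
     (\<forall>t\<in>{0..<T}. f t 0 = 0) \<and>
     lyapunov_stable f T \<and>
     (\<forall>x0\<in>\<Omega>. (\<exists>x. solution_from f 0 T x0 x) \<and>
        (\<forall>x. solution_from f 0 T x0 x \<longrightarrow> ((\<lambda>t. norm (x t)) \<longlongrightarrow> 0) (at_left T)))"

definition exact_finite_time_stable ::
  "(real \<Rightarrow> real^'n \<Rightarrow> real^'n) \<Rightarrow> real \<Rightarrow> (real^'n) set \<Rightarrow> bool" where
  "exact_finite_time_stable f T \<Omega> \<longleftrightarrow>
     finite_time_stable f T \<Omega> \<and>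
     (\<forall>x0 x. x0 \<noteq> 0 \<and> solution_from f 0 T x0 x \<longrightarrow> (\<forall>t\<in>{0..<T}. x t \<noteq> 0))"

end

theory Submission
  imports Defs "HOL-Computational_Algebra.Fundamental_Theorem_Algebra"
begin

text \<open>The inverses of \<open>X\<close> and \<open>Y\<close> solve linear Lyapunov equations, so existence, uniqueness and
  differentiability reduce to linear algebra. Positivity statements come from one comparison
  principle: if \<open>M Q0 + Q0 M\<^sup>T\<close> is negative definite for some positive definite \<open>Q0\<close>, then
  \<open>M Q + Q M\<^sup>T \<le> 0\<close> implies \<open>Q \<ge> 0\<close>. It yields that \<open>P\<close> is positive definite and nondecreasing in
  \<open>\<gamma>\<close>, and \<open>X \<le> C P\<close> for \<open>\<gamma> \<ge> \<gamma>0\<close>. Moreover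
  \<open>A\<^sup>T P + P A - P B B\<^sup>T P = - \<gamma> P - 2 \<gamma> X\<close> and \<open>tr (B\<^sup>T P B) = 2 n \<gamma>\<close>. Hence
  \<open>V = 2 n \<gamma> x\<^sup>T P x\<close> satisfies \<open>- k2 V / (T - t) \<le> V' \<le> - k1 V / (T - t)\<close> along the closed
  loop, the upper bound holding as long as \<open>V \<le> 4\<close>, with
  \<open>k1 = T \<gamma>0 - 1 - \<delta>c / (2 n) > 0\<close>; \<open>V\<close> therefore lies between two powers of \<open>T - t\<close>. On \<open>P\<close> itself,
  monotonicity gives a lower bound and the defining property of \<open>\<delta>c\<close> a polynomial upper bound.\<close>

text \<open>Eigenvalues of \<open>A\<close> on the imaginary axis are allowed, so \<open>A\<close>
  itself need not admit a strict Lyapunov matrix; the shift by \<open>\<gamma> / 2\<close> creates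
  one, and every use of the comparison principle needs its own witness \<open>Q0\<close>. For
  \<open>A - (\<gamma> / 2) 1\<close> the witness comes from a continuity argument in the shift; for
  the operator of \<open>Y\<close> it is the inverse of \<open>X\<close>; for the operator of the
  loop closed by the input \<open>- B^T P x\<close> it is \<open>P\<close> itself. Differentiability
  of \<open>P\<close> has to be proved because \<open>is_delta_c\<close> speaks of
  \<open>vector_derivative\<close>, which carries information only where a derivative exists. The
  exponent \<open>k1\<close> balances three effects, all proportional to \<open>1 / (T - t)\<close>
  because \<open>\<gamma> = T \<gamma>0 / (T - t)\<close>: the dissipation \<open>\<gamma>\<close>,
  the growth of the weight \<open>2 n \<gamma>\<close> (the 1), and the growth of \<open>P\<close>
  (the term \<open>\<delta>c / (2 n)\<close>). The lower rate needs \<open>X \<le> C P\<close>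
  because the dissipation also contains \<open>2 \<gamma> X\<close>.\<close>

declare transpose_matrix_vector [simp del] vector_transpose_matrix [simp del]

subsection \<open>Quadratic forms\<close>

lemma inner_transpose_mult: "(transpose A *v x) \<bullet> y = x \<bullet> (A *v y)" for A :: "real^'n^'m"
  by (simp add: transpose_matrix_vector dot_lmul_matrix)

lemma inner_symmetric_mult: "transpose P = P \<Longrightarrow> (P *v x) \<bullet> y = x \<bullet> (P *v y)" for P :: "real^'n^'n"
  by (metis inner_transpose_mult)

lemma transpose_add: "transpose (A + B) = transpose A + transpose B" for A B :: "real^'n^'m"
  by (simp add: transpose_def vec_eq_iff)

lemma transpose_diff: "transpose (A - B) = transpose A - transpose B" for A B :: "real^'n^'m"
  by (simp add: transpose_def vec_eq_iff)

lemma transpose_minus: "transpose (- A) = - transpose A" for A :: "real^'n^'m"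
  by (simp add: transpose_def vec_eq_iff)

lemma transpose_zero: "transpose (0 :: real^'n^'m) = 0"
  by (simp add: transpose_def vec_eq_iff)

lemma matrix_diff_ldistrib: "A ** (B - C) = A ** B - A ** C" for A :: "real^'n^'m"
  by (simp add: matrix_matrix_mult_def vec_eq_iff right_diff_distrib sum_subtractf)

lemma matrix_diff_rdistrib: "(B - C) ** A = B ** A - C ** A" for A :: "real^'n^'m"
  by (simp add: matrix_matrix_mult_def vec_eq_iff left_diff_distrib sum_subtractf)

lemma matrix_minus_left: "(- B) ** A = - (B ** A)" for A :: "real^'n^'m"
  by (simp add: matrix_matrix_mult_def vec_eq_iff sum_negf)

lemma matrix_minus_right: "B ** (- A) = - (B ** A)" for A :: "real^'n^'m"
  by (simp add: matrix_matrix_mult_def vec_eq_iff sum_negf)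

lemma matrix_scaleR_left: "(c *\<^sub>R B) ** A = c *\<^sub>R (B ** A)" for A :: "real^'n^'m"
  by (simp add: matrix_matrix_mult_def vec_eq_iff sum_distrib_left mult_ac)

lemma matrix_scaleR_right: "B ** (c *\<^sub>R A) = c *\<^sub>R (B ** A)" for A :: "real^'n^'m"
  by (simp add: matrix_matrix_mult_def vec_eq_iff sum_distrib_left mult_ac)

lemma matrix_vector_minus_left: "(- A) *v x = - (A *v x)" for A :: "real^'n^'m"
  by (simp add: matrix_vector_mult_def vec_eq_iff sum_negf)

lemma matrix_vector_scaleR_left: "(c *\<^sub>R A) *v x = c *\<^sub>R (A *v x)" for A :: "real^'n^'m"
  by (simp add: matrix_vector_mult_def vec_eq_iff sum_distrib_left mult_ac)

lemma matrix_add_rdistrib: "(B + C) ** A = B ** A + C ** A" for A :: "'a::semiring_1^'n^'m"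
  by (simp add: matrix_matrix_mult_def vec_eq_iff distrib_right sum.distrib)

lemmas matrix_ring_simps = matrix_add_ldistrib matrix_add_rdistrib matrix_diff_ldistrib
  matrix_diff_rdistrib matrix_minus_left matrix_minus_right matrix_scaleR_left matrix_scaleR_right
  matrix_mul_assoc

lemmas transpose_simps = transpose_add transpose_diff transpose_minus transpose_scalar
  transpose_zero matrix_transpose_mul transpose_transpose transpose_mat

lemmas matrix_vector_simps = matrix_vector_mult_add_rdistrib matrix_vector_mult_diff_rdistrib
  matrix_vector_minus_left matrix_vector_scaleR_left matrix_vector_mul_assoc [symmetric]
  matrix_vector_right_distrib matrix_vector_mult_diff_distrib matrix_vector_mult_scaleR

lemma bounded_linear_transpose: "bounded_linear (transpose :: real^'n^'m \<Rightarrow> real^'m^'n)"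
  by (rule linear_conv_bounded_linear[THEN iffD1], rule linearI) (simp_all add: transpose_simps)

lemma bounded_bilinear_matrix_mult:
  "bounded_bilinear ((**) :: real^'n^'m \<Rightarrow> real^'p^'n \<Rightarrow> real^'p^'m)"
  by (rule bilinear_conv_bounded_bilinear[THEN iffD1])
    (auto simp: bilinear_def linear_iff matrix_ring_simps)

lemma bounded_bilinear_matrix_vector:
  "bounded_bilinear ((*v) :: real^'n^'m \<Rightarrow> real^'n \<Rightarrow> real^'m)"
  by (rule bilinear_conv_bounded_bilinear[THEN iffD1])
    (auto simp: bilinear_def linear_iff matrix_vector_simps)

lemma pd_imp_psd: "pd_matrix Q \<Longrightarrow> psd_matrix Q"
  unfolding pd_matrix_def psd_matrix_def by (metis inner_zero_left less_eq_real_def)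

lemma pd_symmetric: "pd_matrix Q \<Longrightarrow> transpose Q = Q"
  by (simp add: pd_matrix_def)

lemma psd_symmetric: "psd_matrix Q \<Longrightarrow> transpose Q = Q"
  by (simp add: psd_matrix_def)

lemma psd_nonneg: "psd_matrix Q \<Longrightarrow> 0 \<le> x \<bullet> (Q *v x)"
  by (simp add: psd_matrix_def)

lemma psd_add: "psd_matrix P \<Longrightarrow> psd_matrix Q \<Longrightarrow> psd_matrix (P + Q)"
  by (simp add: psd_matrix_def transpose_simps matrix_vector_simps inner_add_right)

lemma pd_add_psd: "pd_matrix P \<Longrightarrow> psd_matrix Q \<Longrightarrow> pd_matrix (P + Q)"
  by (simp add: pd_matrix_def psd_matrix_def transpose_simps matrix_vector_simps inner_add_right
      add_pos_nonneg)

lemma psd_scaleR: "psd_matrix P \<Longrightarrow> 0 \<le> c \<Longrightarrow> psd_matrix (c *\<^sub>R P)"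
  by (simp add: psd_matrix_def transpose_simps matrix_vector_simps)

lemma pd_scaleR: "pd_matrix P \<Longrightarrow> 0 < c \<Longrightarrow> pd_matrix (c *\<^sub>R P)"
  by (simp add: pd_matrix_def transpose_simps matrix_vector_simps)

lemma pd_mat_1: "pd_matrix (mat 1 :: real^'n^'n)"
  by (simp add: pd_matrix_def)

lemma psd_congruence:
  fixes Q :: "real^'n^'n" and C :: "real^'m^'n"
  assumes "psd_matrix Q" shows "psd_matrix (transpose C ** Q ** C)"
  unfolding psd_matrix_def
proof (intro conjI allI)
  show "transpose (transpose C ** Q ** C) = transpose C ** Q ** C"
    using assms by (simp add: transpose_simps psd_symmetric matrix_mul_assoc)
  fix x
  have "x \<bullet> ((transpose C ** Q ** C) *v x) = (C *v x) \<bullet> (Q *v (C *v x))"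
    by (simp add: matrix_vector_simps inner_transpose_mult[of "transpose C", simplified])
  then show "0 \<le> x \<bullet> ((transpose C ** Q ** C) *v x)"
    using assms psd_nonneg by metis
qed

lemma psd_gram: "psd_matrix (B ** transpose B)" for B :: "real^'m^'n"
  using psd_congruence[OF pd_imp_psd[OF pd_mat_1], of "transpose B"] by simp

lemma inner_gram: "x \<bullet> ((B ** transpose B) *v y) = (transpose B *v x) \<bullet> (transpose B *v y)"
  for B :: "real^'m^'n"
  by (simp add: matrix_vector_simps inner_transpose_mult)

lemma discriminant_bound:
  fixes a b c :: real
  assumes "\<And>t. 0 \<le> a + 2 * t * b + t\<^sup>2 * c" "0 \<le> c"
  shows "b\<^sup>2 \<le> a * c"
proof (cases "c = 0")
  case True
  have "b = 0"
  proof (rule ccontr)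
    assume "b \<noteq> 0"
    \<comment> \<open>With \<open>c = 0\<close> the polynomial is affine, and this \<open>t\<close>
      gives it the value -1.\<close>
    then show False using assms(1)[of "- (a + 1) / (2 * b)"] True by (simp add: field_simps)
  qed
  then show ?thesis using True by simp
next
  case False
  then show ?thesis using assms(1)[of "- b / c"] assms(2)
    by (simp add: field_simps power2_eq_square)
qed

text \<open>The form of \<open>Q\<close> at \<open>x + t y\<close> is a nonnegative quadratic
  polynomial in \<open>t\<close>, so its discriminant is not positive.\<close>

lemma psd_cauchy_schwarz:
  fixes Q :: "real^'n^'n"
  assumes "psd_matrix Q"
  shows "(x \<bullet> (Q *v y))\<^sup>2 \<le> (x \<bullet> (Q *v x)) * (y \<bullet> (Q *v y))"
proof (rule discriminant_bound)
  fix t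
  have "y \<bullet> (Q *v x) = x \<bullet> (Q *v y)"
    using inner_symmetric_mult[OF psd_symmetric[OF assms], of y x] by (simp add: inner_commute)
  then show "0 \<le> x \<bullet> (Q *v x) + 2 * t * (x \<bullet> (Q *v y)) + t\<^sup>2 * (y \<bullet> (Q *v y))"
    using psd_nonneg[OF assms, of "x + t *\<^sub>R y"]
    by (simp add: matrix_vector_simps inner_add_left inner_add_right algebra_simps power2_eq_square)
qed (rule psd_nonneg[OF assms])

text \<open>Cauchy-Schwarz against the vector \<open>Q z\<close>. This converts a vanishing
  quadratic form into a linear equation, the basic move of all later positivity proofs.\<close>

lemma psd_kernel:
  fixes Q :: "real^'n^'n"
  assumes "psd_matrix Q" "z \<bullet> (Q *v z) = 0"
  shows "Q *v z = 0"
proof -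
  have "((Q *v z) \<bullet> (Q *v z))\<^sup>2 \<le> 0"
    using psd_cauchy_schwarz[OF assms(1), of "Q *v z" z] assms(2) by simp
  then show ?thesis by simp
qed

lemma pd_inverse:
  fixes Q :: "real^'n^'n"
  assumes "pd_matrix Q"
  obtains V where "Q ** V = mat 1" "V ** Q = mat 1" "pd_matrix V"
proof -
  have "\<forall>x. Q *v x = 0 \<longrightarrow> x = 0"
    using assms unfolding pd_matrix_def by (metis inner_zero_right less_irrefl)
  then obtain V where VQ: "V ** Q = mat 1"
    using matrix_left_invertible_ker by blast
  then have QV: "Q ** V = mat 1" by (simp add: matrix_left_right_inverse)
  have "transpose V ** Q = mat 1"
    using arg_cong[OF QV, of transpose] assms by (simp add: transpose_simps pd_symmetric)
  then have tV: "transpose V = V"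
    by (metis QV VQ matrix_mul_assoc matrix_mul_lid matrix_mul_rid)
  have "pd_matrix V"
    unfolding pd_matrix_def
  proof (intro conjI allI impI)
    fix x :: "real^'n" assume "x \<noteq> 0"
    have x: "x = Q *v (V *v x)" by (simp add: matrix_vector_mul_assoc QV)
    with \<open>x \<noteq> 0\<close> have "V *v x \<noteq> 0" by (metis matrix_vector_mult_0_right)
    then have "0 < (V *v x) \<bullet> (Q *v (V *v x))" using assms by (simp add: pd_matrix_def)
    then show "0 < x \<bullet> (V *v x)" using x by (simp add: inner_commute)
  qed (rule tV)
  with QV VQ that show thesis by blast
qed

lemma quadratic_upper_bound: "x \<bullet> (Q *v x) \<le> onorm ((*v) Q) * (x \<bullet> x)" for Q :: "real^'n^'n"
proof -
  have "x \<bullet> (Q *v x) \<le> norm x * norm (Q *v x)" by (rule norm_cauchy_schwarz)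
  also have "\<dots> \<le> norm x * (onorm ((*v) Q) * norm x)"
    by (intro mult_left_mono onorm) auto
  finally show ?thesis by (simp add: dot_square_norm power2_eq_square mult_ac)
qed

lemma pd_lower_bound:
  fixes Q :: "real^'n^'n"
  assumes "pd_matrix Q"
  obtains c where "c > 0" "\<And>x. c * (x \<bullet> x) \<le> x \<bullet> (Q *v x)"
proof -
  obtain V where V: "Q ** V = mat 1" "V ** Q = mat 1" "pd_matrix V"
    using pd_inverse[OF assms] by blast
  \<comment> \<open>The summand 1 only makes \<open>k\<close> visibly positive.\<close>
  define k where "k = onorm ((*v) V) + 1"
  have "k > 0" using onorm_pos_le[of "(*v) V"] by (simp add: k_def)
  \<comment> \<open>Cauchy-Schwarz in the inner product of \<open>Q\<close>, applied to \<open>V x\<close> and \<open>x\<close>\<close>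
  have "x \<bullet> x \<le> k * (x \<bullet> (Q *v x))" for x
  proof (cases "x = 0")
    case False
    have Q0: "0 \<le> x \<bullet> (Q *v x)" by (rule psd_nonneg[OF pd_imp_psd[OF assms]])
    have "((V *v x) \<bullet> (Q *v x))\<^sup>2 \<le> ((V *v x) \<bullet> (Q *v (V *v x))) * (x \<bullet> (Q *v x))"
      by (rule psd_cauchy_schwarz[OF pd_imp_psd[OF assms]])
    moreover have "(V *v x) \<bullet> (Q *v x) = x \<bullet> x"
      by (simp add: inner_symmetric_mult pd_symmetric V matrix_vector_mul_assoc)
    moreover have "(V *v x) \<bullet> (Q *v (V *v x)) = x \<bullet> (V *v x)"
      by (simp add: V matrix_vector_mul_assoc inner_commute)
    ultimately have "(x \<bullet> x)\<^sup>2 \<le> (x \<bullet> (V *v x)) * (x \<bullet> (Q *v x))" by simp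
    also have "\<dots> \<le> (k * (x \<bullet> x)) * (x \<bullet> (Q *v x))"
    proof (rule mult_right_mono[OF _ Q0])
      show "x \<bullet> (V *v x) \<le> k * (x \<bullet> x)"
        using quadratic_upper_bound[of x V] inner_ge_zero[of x] unfolding k_def distrib_right
        by linarith
    qed
    finally show ?thesis using False by (simp add: power2_eq_square)
  qed simp
  then show thesis using \<open>k > 0\<close> by (intro that[of "1 / k"]) (simp_all add: field_simps)
qed

subsection \<open>The Lyapunov operator\<close>

text \<open>The transpose stands on the right because the operator is mostly applied to inverses of
  Riccati solutions; the convention \<open>M^T Q + Q M\<close> is recovered by passing a transposed
  matrix, as \<open>closed_matrix\<close> does.\<close>

definition lyap :: "real^'n^'n \<Rightarrow> real^'n^'n \<Rightarrow> real^'n^'n" where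
  "lyap M Q = M ** Q + Q ** transpose M"

lemma bounded_bilinear_lyap: "bounded_bilinear (lyap :: real^'n^'n \<Rightarrow> _)"
  unfolding lyap_def
  by (rule bilinear_conv_bounded_bilinear[THEN iffD1])
    (auto simp: bilinear_def linear_iff matrix_ring_simps transpose_simps algebra_simps)

lemmas lyap_add_right = bounded_bilinear.add_right[OF bounded_bilinear_lyap]
  and lyap_diff_right = bounded_bilinear.diff_right[OF bounded_bilinear_lyap]
  and lyap_minus_right = bounded_bilinear.minus_right[OF bounded_bilinear_lyap]
  and lyap_scaleR_right = bounded_bilinear.scaleR_right[OF bounded_bilinear_lyap]

lemma lyap_transpose: "transpose (lyap M Q) = lyap M (transpose Q)"
  by (simp add: lyap_def transpose_simps add.commute)

lemma lyap_shift: "lyap (M - s *\<^sub>R mat 1) Q = lyap M Q - (2 * s) *\<^sub>R Q"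
  by (simp add: lyap_def matrix_ring_simps transpose_simps algebra_simps flip: scaleR_left.add)

lemma inner_lyap:
  fixes M :: "real^'n^'n"
  assumes "transpose Q = Q"
  shows "x \<bullet> (lyap M Q *v x) = 2 * ((transpose M *v x) \<bullet> (Q *v x))"
proof -
  have "x \<bullet> (M *v (Q *v x)) = (transpose M *v x) \<bullet> (Q *v x)"
    by (simp add: inner_transpose_mult)
  moreover have "x \<bullet> (Q *v (transpose M *v x)) = (transpose M *v x) \<bullet> (Q *v x)"
    using inner_symmetric_mult[OF assms, of x "transpose M *v x"] by (simp add: inner_commute)
  ultimately show ?thesis by (simp add: lyap_def matrix_vector_simps inner_add_right)
qed

text \<open>At a minimiser \<open>z\<close> of the quotient of the two quadratic forms, with minimum
  \<open>m < 0\<close>, the vector \<open>z\<close> lies in the kernel of the semidefinite matrix \<open>Q - m Q0\<close>, so the form of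
  \<open>lyap M (Q - m Q0)\<close> vanishes at \<open>z\<close>; but it is negative there.\<close>

lemma lyap_comparison:
  fixes M Q0 Q :: "real^'n^'n"
  assumes Q0: "pd_matrix Q0" and neg: "pd_matrix (- lyap M Q0)"
    and Q: "transpose Q = Q" and psd: "psd_matrix (- lyap M Q)"
  shows "psd_matrix Q"
proof -
  let ?S = "sphere (0 :: real^'n) 1"
  define r where "r x = (x \<bullet> (Q *v x)) / (x \<bullet> (Q0 *v x))" for x
  have pos: "0 < x \<bullet> (Q0 *v x)" if "x \<noteq> 0" for x
    using Q0 that by (simp add: pd_matrix_def)
  have ne: "x \<bullet> (Q0 *v x) \<noteq> 0" if "x \<in> ?S" for x
    using pos[of x] that by fastforce
  have cont: "continuous_on ?S r"
    unfolding r_def by (intro continuous_intros ballI ne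
        bounded_linear.continuous_on[OF matrix_vector_mul_bounded_linear]) auto
  have "axis undefined 1 \<in> ?S" by (simp add: norm_axis_1)
  then obtain z where z: "z \<in> ?S" and zmin: "\<And>x. x \<in> ?S \<Longrightarrow> r z \<le> r x"
    using continuous_attains_inf[OF compact_sphere _ cont] by blast
  have z0: "z \<noteq> 0" using z by auto
  have all: "r z * (x \<bullet> (Q0 *v x)) \<le> x \<bullet> (Q *v x)" for x
  proof (cases "x = 0")
    case False
    have "r z \<le> r ((1 / norm x) *\<^sub>R x)" using False by (intro zmin) simp
    also have "\<dots> = r x" using False by (simp add: r_def matrix_vector_simps)
    finally show ?thesis using pos[OF False] by (simp add: r_def pos_le_divide_eq)
  qed simp
  show ?thesis
  proof (cases "r z \<ge> 0")
    case True
    have "0 \<le> x \<bullet> (Q *v x)" for x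
      using all[of x] True psd_nonneg[OF pd_imp_psd[OF Q0], of x]
      by (meson mult_nonneg_nonneg order_trans)
    then show ?thesis using Q by (simp add: psd_matrix_def)
  next
    case False
    define R where "R = Q - r z *\<^sub>R Q0"
    have R: "psd_matrix R"
      using all Q pd_symmetric[OF Q0]
      by (simp add: psd_matrix_def R_def transpose_simps matrix_vector_simps inner_diff_right)
    have "z \<bullet> (R *v z) = 0"
      using pos[OF z0] by (simp add: R_def matrix_vector_simps inner_diff_right r_def)
    then have "R *v z = 0" by (rule psd_kernel[OF R])
    then have "z \<bullet> (lyap M R *v z) = 0"
      by (simp add: inner_lyap[OF psd_symmetric[OF R]])
    then have "z \<bullet> (lyap M Q *v z) = r z * (z \<bullet> (lyap M Q0 *v z))"
      by (simp add: R_def lyap_diff_right lyap_scaleR_right matrix_vector_simps inner_diff_right)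
    moreover have "z \<bullet> (lyap M Q *v z) \<le> 0"
      using psd_nonneg[OF psd, of z] by (simp add: matrix_vector_simps)
    moreover have "z \<bullet> (lyap M Q0 *v z) < 0"
      using neg z0 by (simp add: pd_matrix_def matrix_vector_simps)
    ultimately show ?thesis using False by (smt (verit) mult_neg_neg)
  qed
qed

text \<open>The comparison principle applies to both \<open>Q\<close> and
  \<open>- Q\<close>.\<close>

lemma lyap_unique:
  fixes M Q0 Q :: "real^'n^'n"
  assumes "pd_matrix Q0" "pd_matrix (- lyap M Q0)" "transpose Q = Q" "lyap M Q = 0"
  shows "Q = 0"
proof -
  have "psd_matrix (0 :: real^'n^'n)" by (simp add: psd_matrix_def transpose_zero)
  then have "psd_matrix Q" "psd_matrix (- Q)"
    using assms by (simp_all add: lyap_comparison[OF assms(1,2)] transpose_simps lyap_minus_right)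
  then have "x \<bullet> (Q *v x) = 0" for x
    using psd_nonneg[of Q x] psd_nonneg[of "-Q" x] by (simp add: matrix_vector_simps)
  then have "Q *v x = 0" for x
    using \<open>psd_matrix Q\<close> psd_kernel by blast
  then show ?thesis by (simp add: matrix_eq)
qed

text \<open>Adding the antisymmetric part of \<open>Q\<close> to the operator makes it injective on all matrices, hence
  invertible, without changing it on symmetric ones.\<close>

lemma lyap_symmetric_inverse:
  fixes M :: "real^'n^'n"
  assumes inj: "\<And>Q. transpose Q = Q \<Longrightarrow> lyap M Q = 0 \<Longrightarrow> Q = 0"
  obtains R where "bounded_linear R" "\<And>Q. transpose Q = Q \<Longrightarrow> R (lyap M Q) = Q"
    "\<And>C. transpose C = C \<Longrightarrow> transpose (R C) = R C \<and> lyap M (R C) = C"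
proof -
  define L where "L Q = lyap M (Q + transpose Q) + (Q - transpose Q)" for Q :: "real^'n^'n"
  have tL: "transpose (L Q) = lyap M (Q + transpose Q) - (Q - transpose Q)" for Q
    by (simp add: L_def transpose_simps lyap_transpose add.commute)
  have lin: "linear L"
    by (rule linearI) (simp_all add: L_def transpose_simps lyap_add_right lyap_diff_right
        lyap_scaleR_right algebra_simps)
  have "inj L"
    unfolding linear_injective_0[OF lin]
  proof (intro allI impI)
    fix Q assume "L Q = 0"
    \<comment> \<open>Transposition changes the sign of the antisymmetric part of \<open>L Q\<close>
      only, so the symmetric and the antisymmetric part vanish separately.\<close>
    then have *: "lyap M (Q + transpose Q) + (Q - transpose Q) = 0"
        "lyap M (Q + transpose Q) - (Q - transpose Q) = 0"
      using tL[of Q] by (simp_all add: L_def transpose_zero)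
    then have "2 *\<^sub>R lyap M (Q + transpose Q) = 0" by (metis (no_types) add_diff_cancel_right' add.right_neutral
          diff_zero scaleR_2 add_diff_eq diff_add_eq)
    then have "lyap M (Q + transpose Q) = 0" by simp
    then have "Q + transpose Q = 0" by (rule inj[rotated]) (simp add: transpose_simps add.commute)
    moreover have "Q - transpose Q = 0" using * \<open>lyap M (Q + transpose Q) = 0\<close> by simp
    ultimately have "2 *\<^sub>R Q = 0" by (simp add: scaleR_2)
    then show "Q = 0" by simp
  qed
  then obtain R where R: "linear R" "\<And>Q. R (L Q) = Q" "\<And>C. L (R C) = C"
    using linear_injective_isomorphism[OF lin] by metis
  have Lsym: "L Q = lyap M (2 *\<^sub>R Q)" if "transpose Q = Q" for Q
    using that by (simp add: L_def scaleR_2)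
  show thesis
  \<comment> \<open>On symmetric matrices \<open>L\<close> is twice the Lyapunov operator, whence
    the factor 2.\<close>
  proof (rule that[of "\<lambda>C. 2 *\<^sub>R R C"])
    show "bounded_linear (\<lambda>C. 2 *\<^sub>R R C)"
      using R(1) by (simp add: linear_conv_bounded_linear bounded_linear_scaleR_right
          bounded_linear_compose[OF bounded_linear_scaleR_right])
    show "2 *\<^sub>R R (lyap M Q) = Q" if "transpose Q = Q" for Q
    proof -
      have "R (lyap M Q) = R (L ((1/2) *\<^sub>R Q))"
        using Lsym[of "(1/2) *\<^sub>R Q"] that by (simp add: transpose_simps)
      then show ?thesis by (simp add: R)
    qed
    fix C :: "real^'n^'n" assume C: "transpose C = C"
    have "transpose (L (R C)) = L (R C)" using C by (simp add: R)
    then have "2 *\<^sub>R (R C - transpose (R C)) = 0"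
      unfolding tL by (simp add: L_def scaleR_2 algebra_simps)
    then have s: "transpose (R C) = R C" by simp
    then show "transpose (2 *\<^sub>R R C) = 2 *\<^sub>R R C \<and> lyap M (2 *\<^sub>R R C) = C"
      using Lsym[OF s] R(3)[of C] by (simp add: transpose_simps)
  qed
qed

subsection \<open>Complex eigenvectors\<close>

text \<open>The complex scalar multiplication \<open>cs\<close> is a parameter because the result is
  used for complex matrices under left multiplication and for complex vectors. The real Euclidean
  structure supplies the finite dimension.\<close>

context
  fixes cs :: "complex \<Rightarrow> 'a::euclidean_space \<Rightarrow> 'a" and f :: "'a \<Rightarrow> 'a" and K :: "'a set"
  assumes vs: "vector_space cs"
    and cs_real: "\<And>r x. cs (of_real r) x = r *\<^sub>R x"
    and f: "Vector_Spaces.linear cs cs f"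
    and K: "module.subspace cs K" "\<And>x. x \<in> K \<Longrightarrow> f x \<in> K"
begin

interpretation vector_space cs by (rule vs)

interpretation f: Vector_Spaces.linear cs cs f by (rule f)

text \<open>Split off a root \<open>z\<close> of \<open>p\<close>: either \<open>f x - z x\<close>
  vanishes and \<open>x\<close> is an eigenvector, or it is a nonzero vector of \<open>K\<close>
  annihilated by the quotient. The sum runs to a bound \<open>n\<close> on the degree, padded by
  zero coefficients, so that the induction can run on \<open>n\<close>.\<close>

lemma annihilated_imp_eigenvector:
  assumes "degree p \<le> n" "p \<noteq> 0" "x \<in> K" "x \<noteq> 0"
    and "(\<Sum>i\<le>n. cs (coeff p i) ((f ^^ i) x)) = 0"
  shows "\<exists>l v. v \<in> K \<and> v \<noteq> 0 \<and> f v = cs l v"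
  using assms
proof (induction n arbitrary: p x)
  case 0
  then show ?case by (metis (no_types, lifting) atMost_0 empty_iff finite.emptyI funpow_0 leading_coeff_0_iff
        le_zero_eq scale_eq_0_iff sum.empty sum.insert add.right_neutral)
next
  case (Suc n)
  show ?case
  proof (cases "degree p = 0")
    case True
    then have "coeff p i = 0" if "i \<noteq> 0" for i using that by (simp add: coeff_eq_0)
    then have "(\<Sum>i\<le>Suc n. cs (coeff p i) ((f ^^ i) x)) = cs (coeff p 0) x"
      by (simp add: sum.atMost_Suc_shift del: sum.atMost_Suc)
    then have "coeff p 0 = 0" using Suc.prems by simp
    then show ?thesis using True \<open>p \<noteq> 0\<close> by (metis leading_coeff_0_iff)
  next
    case False
    then obtain z where "poly p z = 0"
      using fundamental_theorem_of_algebra constant_degree by metis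
    then obtain q where q: "p = [:-z, 1:] * q" by (metis poly_eq_0_iff_dvd dvdE)
    have q0: "q \<noteq> 0" using q \<open>p \<noteq> 0\<close> by auto
    have dq: "degree q \<le> n"
      using \<open>degree p \<le> Suc n\<close> q0 by (simp add: q degree_mult_eq del: mult_pCons_left)
    define y where "y = f x - cs z x"
    have yK: "y \<in> K" unfolding y_def by (intro subspace_diff subspace_scale K \<open>x \<in> K\<close>)
    have fy: "(f ^^ i) y = (f ^^ Suc i) x - cs z ((f ^^ i) x)" for i
      by (induction i) (simp_all add: y_def f.diff f.scale)
    have "p = pCons 0 q - smult z q" by (simp add: q)
    then have cp: "coeff p i = coeff (pCons 0 q) i - z * coeff q i" for i by simp
    have "(\<Sum>i\<le>Suc n. cs (coeff p i) ((f ^^ i) x)) =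
      (\<Sum>i\<le>Suc n. cs (coeff (pCons 0 q) i) ((f ^^ i) x)) - (\<Sum>i\<le>Suc n. cs (z * coeff q i) ((f ^^ i) x))"
      unfolding cp by (simp only: scale_left_diff_distrib sum_subtractf)
    also have "(\<Sum>i\<le>Suc n. cs (coeff (pCons 0 q) i) ((f ^^ i) x)) = (\<Sum>i\<le>n. cs (coeff q i) ((f ^^ Suc i) x))"
      by (subst sum.atMost_Suc_shift) simp
    also have "(\<Sum>i\<le>Suc n. cs (z * coeff q i) ((f ^^ i) x)) = (\<Sum>i\<le>n. cs (coeff q i) (cs z ((f ^^ i) x)))"
      using dq by (simp add: coeff_eq_0 mult.commute)
    also have "(\<Sum>i\<le>n. cs (coeff q i) ((f ^^ Suc i) x)) - \<dots> = (\<Sum>i\<le>n. cs (coeff q i) ((f ^^ i) y))"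
      unfolding fy scale_right_diff_distrib sum_subtractf by simp
    finally have qy: "(\<Sum>i\<le>n. cs (coeff q i) ((f ^^ i) y)) = 0" using Suc.prems by simp
    show ?thesis
    proof (cases "y = 0")
      case True
      then show ?thesis using \<open>x \<in> K\<close> \<open>x \<noteq> 0\<close> y_def by auto
    next
      case False
      then show ?thesis using Suc.IH[OF dq q0 yK _ qy] by blast
    qed
  qed
qed

text \<open>The \<open>N + 1\<close> iterates of \<open>x\<close> under \<open>f\<close> are
  linearly dependent in real dimension \<open>N\<close>; the dependence is a nonzero polynomial
  annihilating \<open>x\<close>.\<close>

lemma invariant_subspace_eigenvector:
  assumes "x \<in> K" "x \<noteq> 0"
  obtains l v where "v \<in> K" "v \<noteq> 0" "f v = cs l v"
proof -
  define N where "N = DIM('a)"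
  let ?g = "\<lambda>i. (f ^^ i) x"
  have "\<exists>c :: nat \<Rightarrow> real. (\<exists>i\<le>N. c i \<noteq> 0) \<and> (\<Sum>i\<le>N. c i *\<^sub>R ?g i) = 0"
  proof (cases "inj_on ?g {..N}")
    case True
    then have "card (?g ` {..N}) > DIM('a)" by (simp add: card_image N_def)
    then have "real_vector.dependent (?g ` {..N})" by (intro dependent_biggerset) auto
    then obtain u where u: "\<exists>v\<in>?g ` {..N}. u v \<noteq> 0" "(\<Sum>v\<in>?g ` {..N}. u v *\<^sub>R v) = 0"
      using real_vector.dependent_finite[of "?g ` {..N}"] by auto
    show ?thesis
      by (rule exI[of _ "u \<circ> ?g"]) (use u sum.reindex[OF True, of "\<lambda>v. u v *\<^sub>R v"] in auto)
  next
    case False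
    then obtain i j where ij: "i \<le> N" "j \<le> N" "i \<noteq> j" "?g i = ?g j"
      by (auto simp: inj_on_def)
    \<comment> \<open>A repeated iterate makes the set of iterates too small for the dimension
      count, but the difference of the two monomials annihilates \<open>x\<close>.\<close>
    define c :: "nat \<Rightarrow> real" where "c k = (if k = i then 1 else 0) - (if k = j then 1 else 0)" for k
    have "(\<Sum>k\<le>N. c k *\<^sub>R ?g k) = (\<Sum>k\<le>N. (if k = i then ?g k else 0)) - (\<Sum>k\<le>N. (if k = j then ?g k else 0))"
      by (subst sum_subtractf[symmetric], rule sum.cong) (auto simp: c_def algebra_simps)
    then have "(\<Sum>k\<le>N. c k *\<^sub>R ?g k) = 0" using ij by simp
    moreover have "c i \<noteq> 0" using ij by (simp add: c_def)
    ultimately show ?thesis using ij by blast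
  qed
  then obtain c :: "nat \<Rightarrow> real" and k where c: "k \<le> N" "c k \<noteq> 0" "(\<Sum>i\<le>N. c i *\<^sub>R ?g i) = 0" by blast
  define p where "p = (\<Sum>i\<le>N. monom (complex_of_real (c i)) i)"
  have cp: "coeff p i = (if i \<le> N then of_real (c i) else 0)" for i
    by (simp add: p_def coeff_sum)
  have "degree p \<le> N" by (rule degree_le) (simp add: cp)
  moreover have "p \<noteq> 0" using cp[of k] c by auto
  moreover have "(\<Sum>i\<le>N. cs (coeff p i) (?g i)) = 0" using c(3) by (simp add: cp cs_real)
  ultimately show thesis
    using annihilated_imp_eigenvector[of p N x] assms that by blast
qed

end

subsection \<open>Lyapunov equations for shifted matrices\<close>

text \<open>The complex solutions of \<open>A Z + Z A^T = 2 s Z\<close> are invariant under left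
  multiplication by \<open>A\<close>. An eigenvector \<open>Z\<close> with eigenvalue
  \<open>l\<close> has eigenvectors of \<open>A\<close> for \<open>l\<close> as nonzero columns and,
  by the equation, eigenvectors for \<open>2 s - l\<close> as nonzero rows. The two eigenvalues have
  sum \<open>2 s > 0\<close>, so they cannot both have real part at most 0.\<close>

lemma lyap_shift_injective:
  fixes A Q :: "real^'n^'n"
  assumes spec: "\<forall>l. complex_eigenvalue A l \<longrightarrow> Re l \<le> 0" and "s > 0"
    and Q: "lyap (A - s *\<^sub>R mat 1) Q = 0"
  shows "Q = 0"
proof (rule ccontr)
  assume "Q \<noteq> 0"
  define Ac where "Ac = map_matrix complex_of_real A"
  define cs where "cs c Z = (\<chi> i j. c * Z $ i $ j)" for c and Z :: "complex^'n^'n"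
  define K where "K = {Z. Ac ** Z + Z ** transpose Ac = cs (of_real (2 * s)) Z}"
  define Z0 where "Z0 = map_matrix complex_of_real Q"
  have vs: "vector_space cs"
    by unfold_locales (simp_all add: cs_def vec_eq_iff algebra_simps)
  interpret vector_space cs by (rule vs)
  have cs_left: "cs c Z ** W = cs c (Z ** W)" and cs_right: "W ** cs c Z = cs c (W ** Z)" for c Z W
    by (simp_all add: cs_def vec_eq_iff matrix_matrix_mult_def sum_distrib_left mult_ac)
  have real: "cs (of_real r) Z = r *\<^sub>R Z" for r Z
    unfolding vec_eq_iff cs_def by (simp add: scaleR_conv_of_real[where 'a = complex])
  have lin: "Vector_Spaces.linear cs cs ((**) Ac)"
    by (intro Vector_Spaces.linear.intro vs module_hom.intro module_axioms)
      (simp add: module_hom_axioms_def matrix_add_ldistrib cs_right)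
  have sub: "subspace K"
  proof (rule subspaceI)
    fix Z W assume ZW: "Z \<in> K" "W \<in> K"
    have "Ac ** (Z + W) + (Z + W) ** transpose Ac =
        (Ac ** Z + Z ** transpose Ac) + (Ac ** W + W ** transpose Ac)"
      by (simp add: matrix_add_ldistrib matrix_add_rdistrib)
    then show "Z + W \<in> K" using ZW by (simp add: K_def scale_right_distrib)
  next
    fix c Z assume "Z \<in> K"
    moreover have "Ac ** cs c Z + cs c Z ** transpose Ac = cs c (Ac ** Z + Z ** transpose Ac)"
      by (simp only: cs_left cs_right scale_right_distrib)
    ultimately show "cs c Z \<in> K" by (simp add: K_def scale_left_commute mult.commute)
  qed (simp add: K_def)
  have inv: "Ac ** Z \<in> K" if "Z \<in> K" for Z
  proof -
    have "Ac ** (Ac ** Z) + Ac ** Z ** transpose Ac = Ac ** (Ac ** Z + Z ** transpose Ac)"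
      by (simp add: matrix_add_ldistrib matrix_mul_assoc)
    then show ?thesis using that by (simp add: K_def cs_right)
  qed
  have "map_matrix complex_of_real (A ** Q + Q ** transpose A) = map_matrix complex_of_real ((2 * s) *\<^sub>R Q)"
    using Q by (simp add: lyap_shift) (simp add: lyap_def)
  then have Z0: "Z0 \<in> K"
    by (simp add: K_def Z0_def Ac_def cs_def vec_eq_iff matrix_matrix_mult_def transpose_def)
  have "Z0 \<noteq> 0" using \<open>Q \<noteq> 0\<close> by (simp add: Z0_def vec_eq_iff)
  then obtain l Z where Z: "Z \<in> K" "Z \<noteq> 0" "Ac ** Z = cs l Z"
    using invariant_subspace_eigenvector[OF vs real lin sub inv Z0] by blast
  have right: "Z ** transpose Ac = cs (of_real (2 * s) - l) Z"
    using Z(1,3) by (simp add: K_def scale_left_diff_distrib algebra_simps)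
  obtain i j where ij: "Z $ i $ j \<noteq> 0" using \<open>Z \<noteq> 0\<close> by (auto simp: vec_eq_iff)
  have "Ac *v column j Z = l *s column j Z"
    using Z(3) by (simp add: vec_eq_iff matrix_vector_mult_def matrix_matrix_mult_def cs_def column_def)
  moreover have "column j Z \<noteq> 0" using ij by (auto simp: column_def vec_eq_iff)
  ultimately have "Re l \<le> 0" using spec by (auto simp: complex_eigenvalue_def Ac_def)
  define l' where "l' = of_real (2 * s) - l"
  have "Ac *v (Z $ i) = l' *s (Z $ i)"
    using right[folded l'_def]
    by (simp add: vec_eq_iff matrix_vector_mult_def matrix_matrix_mult_def cs_def transpose_def mult.commute)
  moreover have "Z $ i \<noteq> 0" using ij by auto
  ultimately have "Re l' \<le> 0"
    using spec unfolding complex_eigenvalue_def Ac_def by blast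
  then show False using \<open>Re l \<le> 0\<close> \<open>s > 0\<close> by (simp add: l'_def)
qed

text \<open>On a kernel vector of \<open>Q\<close> the form of \<open>lyap M Q\<close> vanishes,
  which strict negativity forbids.\<close>

lemma psd_lyap_imp_pd:
  fixes M Q :: "real^'n^'n"
  assumes Q: "psd_matrix Q" and neg: "pd_matrix (- lyap M Q)"
  shows "pd_matrix Q"
  unfolding pd_matrix_def
proof (intro conjI allI impI psd_symmetric[OF Q])
  fix x :: "real^'n" assume "x \<noteq> 0"
  then have "x \<bullet> (lyap M Q *v x) \<noteq> 0"
    using neg by (force simp: pd_matrix_def matrix_vector_simps)
  then have "Q *v x \<noteq> 0" by (auto simp: inner_lyap[OF psd_symmetric[OF Q]])
  then have "x \<bullet> (Q *v x) \<noteq> 0" using psd_kernel[OF Q] by blast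
  then show "0 < x \<bullet> (Q *v x)" using psd_nonneg[OF Q, of x] by linarith
qed

text \<open>Positive definite matrices are open along a line: the radius is a lower bound of the
  form of \<open>N\<close> divided by an upper bound of the form of \<open>Q\<close>.\<close>

lemma pd_perturb:
  fixes N Q :: "real^'n^'n"
  assumes N: "pd_matrix N" and Q: "transpose Q = Q"
  obtains e where "e > 0" "\<And>t. \<bar>t\<bar> < e \<Longrightarrow> pd_matrix (N + t *\<^sub>R Q)"
proof -
  obtain c where c: "c > 0" "\<And>x. c * (x \<bullet> x) \<le> x \<bullet> (N *v x)" using pd_lower_bound[OF N] by blast
  define k where "k = onorm ((*v) Q) + 1"
  have k: "k > 0" using onorm_pos_le[of "(*v) Q"] by (simp add: k_def)
  have bound: "\<bar>x \<bullet> (Q *v x)\<bar> \<le> k * (x \<bullet> x)" for x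
  proof -
    have "\<bar>x \<bullet> (Q *v x)\<bar> \<le> norm x * norm (Q *v x)" by (rule Cauchy_Schwarz_ineq2)
    also have "\<dots> \<le> norm x * (onorm ((*v) Q) * norm x)" by (intro mult_left_mono onorm) auto
    also have "\<dots> \<le> norm x * (k * norm x)" by (intro mult_left_mono mult_right_mono) (auto simp: k_def)
    finally show ?thesis by (simp add: dot_square_norm power2_eq_square mult_ac)
  qed
  show thesis
  proof (rule that[of "c / k"])
    show "c / k > 0" using c k by simp
    fix t assume t: "\<bar>t\<bar> < c / k"
    have "0 < x \<bullet> ((N + t *\<^sub>R Q) *v x)" if "x \<noteq> 0" for x
    proof -
      have xx: "0 < x \<bullet> x" using that by simp
      have "\<bar>t * (x \<bullet> (Q *v x))\<bar> \<le> \<bar>t\<bar> * (k * (x \<bullet> x))"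
        using bound[of x] by (simp add: abs_mult mult_left_mono)
      also have "\<dots> < c * (x \<bullet> x)"
        using t k xx by (simp add: pos_less_divide_eq)
      also have "\<dots> \<le> x \<bullet> (N *v x)" by (rule c)
      finally show ?thesis by (simp add: matrix_vector_simps inner_add_right)
    qed
    then show "pd_matrix (N + t *\<^sub>R Q)"
      using Q N by (simp add: pd_matrix_def transpose_simps)
  qed
qed

text \<open>Decrease \<open>s\<close> from a large value, where \<open>Q = 1\<close> works. The set of good \<open>s\<close> is open, and at its
  infimum the solution of the equation with right-hand side \<open>- 1\<close> is semidefinite by comparison with
  a slightly larger \<open>s\<close>.\<close>

lemma lyap_shift_pd_exists:
  fixes A :: "real^'n^'n"
  assumes spec: "\<forall>l. complex_eigenvalue A l \<longrightarrow> Re l \<le> 0" and "s > 0"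
  shows "\<exists>Q. pd_matrix Q \<and> pd_matrix (- lyap (A - s *\<^sub>R mat 1) Q)"
proof -
  define G where "G = {r. \<exists>Q. pd_matrix Q \<and> pd_matrix (- lyap (A - r *\<^sub>R mat 1) Q)}"
  have shift: "- lyap (A - r' *\<^sub>R mat 1) Q = - lyap (A - r *\<^sub>R mat 1) Q + (2 * (r' - r)) *\<^sub>R Q" for r r' Q
    by (simp add: lyap_shift algebra_simps)
  have up: "r' \<in> G" if r: "r \<in> G" "r \<le> r'" for r r'
  proof -
    obtain Q where "pd_matrix Q" "pd_matrix (- lyap (A - r *\<^sub>R mat 1) Q)" using r by (auto simp: G_def)
    moreover from this have "pd_matrix (- lyap (A - r' *\<^sub>R mat 1) Q)"
      unfolding shift[of r' Q r] using r by (intro pd_add_psd psd_scaleR pd_imp_psd) auto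
    ultimately show ?thesis by (auto simp: G_def)
  qed
  have down: "\<exists>e>0. r - e \<in> G" if r: "r \<in> G" for r
  proof -
    obtain Q where Q: "pd_matrix Q" "pd_matrix (- lyap (A - r *\<^sub>R mat 1) Q)" using r by (auto simp: G_def)
    obtain e where e: "e > 0" "\<And>t. \<bar>t\<bar> < e \<Longrightarrow> pd_matrix (- lyap (A - r *\<^sub>R mat 1) Q + t *\<^sub>R Q)"
      using pd_perturb[OF Q(2) pd_symmetric[OF Q(1)]] by blast
    \<comment> \<open>The shift enters the operator twice, so this adds \<open>- (e / 2) Q\<close>,
      within the radius \<open>e\<close>.\<close>
    have "pd_matrix (- lyap (A - (r - e / 4) *\<^sub>R mat 1) Q)"
      unfolding shift[of "r - e / 4" Q r] by (rule e) (use e(1) in simp)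
    then show ?thesis using Q(1) e(1) by (intro exI[of _ "e / 4"]) (auto simp: G_def)
  qed
  have big: "onorm ((*v) A) + 1 \<in> G"
  proof -
    have "0 < x \<bullet> (- lyap (A - (onorm ((*v) A) + 1) *\<^sub>R mat 1) (mat 1) *v x)" if "x \<noteq> 0" for x
    proof -
      have "x \<bullet> (- lyap (A - (onorm ((*v) A) + 1) *\<^sub>R mat 1) (mat 1) *v x) =
          2 * (onorm ((*v) A) * (x \<bullet> x) + x \<bullet> x) - 2 * ((transpose A *v x) \<bullet> x)"
        unfolding lyap_shift
        by (simp add: matrix_vector_simps inner_diff_right inner_lyap algebra_simps)
      moreover have "(transpose A *v x) \<bullet> x \<le> onorm ((*v) A) * (x \<bullet> x)"
        using quadratic_upper_bound[of x A] by (simp add: inner_transpose_mult)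
      moreover have "0 < x \<bullet> x" using that by simp
      ultimately show ?thesis unfolding distrib_left distrib_right by linarith
    qed
    then have "pd_matrix (- lyap (A - (onorm ((*v) A) + 1) *\<^sub>R mat 1) (mat 1))"
      by (simp add: pd_matrix_def transpose_simps lyap_transpose)
    then show ?thesis using pd_mat_1 by (auto simp: G_def)
  qed
  show ?thesis
  proof (rule ccontr)
    assume "\<not> ?thesis"
    then have low: "s \<le> r" if "r \<in> G" for r using up[OF that, of s] by (force simp: G_def)
    then have bdd: "bdd_below G" by (auto simp: bdd_below_def)
    define s0 where "s0 = Inf G"
    \<comment> \<open>Positivity of the infimum makes the Lyapunov equation at \<open>s0\<close>
      solvable by \<open>lyap_shift_injective\<close>.\<close>
    have "s \<le> s0" unfolding s0_def using big low by (intro cInf_greatest) auto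
    then have "s0 > 0" using \<open>s > 0\<close> by simp
    obtain R where R: "\<And>C. transpose C = C \<Longrightarrow> transpose (R C) = R C \<and> lyap (A - s0 *\<^sub>R mat 1) (R C) = C"
      using lyap_symmetric_inverse[OF lyap_shift_injective[OF spec \<open>s0 > 0\<close>]] by metis
    define Q where "Q = R (- mat 1)"
    have Q: "transpose Q = Q" "- lyap (A - s0 *\<^sub>R mat 1) Q = mat 1"
      using R[of "- mat 1"] by (simp_all add: Q_def transpose_simps)
    obtain e where e: "e > 0" "\<And>t. \<bar>t\<bar> < e \<Longrightarrow> pd_matrix (mat 1 + t *\<^sub>R Q)"
      using pd_perturb[OF pd_mat_1 Q(1)] by blast
    obtain r where r: "r \<in> G" "r < s0 + e / 2"
      using cInf_lessD[of G "s0 + e / 2"] big e(1) by (auto simp: s0_def)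
    have "s0 \<le> r" unfolding s0_def by (rule cInf_lower[OF r(1) bdd])
    obtain Q0 where Q0: "pd_matrix Q0" "pd_matrix (- lyap (A - r *\<^sub>R mat 1) Q0)" using r by (auto simp: G_def)
    \<comment> \<open>Passing from \<open>s0\<close> to \<open>r\<close> adds
      \<open>2 (r - s0) Q\<close>, and \<open>2 (r - s0) < e\<close> by the choice of
      \<open>r\<close>.\<close>
    have "pd_matrix (- lyap (A - r *\<^sub>R mat 1) Q)"
      unfolding shift[of r Q s0] Q(2) by (rule e) (use r \<open>s0 \<le> r\<close> in simp)
    then have "psd_matrix Q" by (intro lyap_comparison[OF Q0 Q(1)] pd_imp_psd)
    then have "pd_matrix Q" by (rule psd_lyap_imp_pd[where M = "A - s0 *\<^sub>R mat 1"]) (simp add: Q(2) pd_mat_1)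
    then have "s0 \<in> G" using Q(2) pd_mat_1 unfolding G_def by (metis (mono_tags, lifting) mem_Collect_eq)
    then obtain d where "d > 0" "s0 - d \<in> G" using down by blast
    then have "s0 \<le> s0 - d" unfolding s0_def by (intro cInf_lower bdd)
    then show False using \<open>d > 0\<close> by simp
  qed
qed

subsection \<open>Controllability\<close>

text \<open>This is observability of the pair \<open>(A^T, B^T)\<close>, the dual of
  controllability, stated through invariant subspaces so that it can be applied directly to kernels
  of Lyapunov solutions.\<close>

definition no_hidden_modes :: "real^'n^'n \<Rightarrow> real^'m^'n \<Rightarrow> bool" where
  "no_hidden_modes A B \<longleftrightarrow>
     (\<forall>N. subspace N \<longrightarrow> (\<forall>z\<in>N. transpose A *v z \<in> N \<and> transpose B *v z = 0) \<longrightarrow> N = {0})"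

text \<open>The complexification of an unobservable subspace \<open>N\<close> contains an eigenvector \<open>a + i b\<close>. The
  coordinate \<open>(a + i b) \<bullet> x(t)\<close> of a trajectory starting at 0 solves a homogeneous linear
  equation, so it vanishes whatever the input.\<close>

lemma controllable_imp_no_hidden_modes:
  fixes A :: "real^'n^'n" and B :: "real^'m^'n"
  assumes ctr: "controllable A B"
  shows "no_hidden_modes A B"
  unfolding no_hidden_modes_def
proof (intro allI impI, rule ccontr)
  fix N :: "(real^'n) set"
  assume N: "subspace N" and inv: "\<forall>z\<in>N. transpose A *v z \<in> N \<and> transpose B *v z = 0" and "N \<noteq> {0}"
  then obtain z0 where z0: "z0 \<in> N" "z0 \<noteq> 0" using subspace_0 by blast
  define re where "re w = (\<chi> i. Re (w $ i))" for w :: "complex^'n"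
  define im where "im w = (\<chi> i. Im (w $ i))" for w :: "complex^'n"
  define K where "K = {w. re w \<in> N \<and> im w \<in> N}"
  define f where "f = (*v) (map_matrix complex_of_real (transpose A))"
  have re_scale: "re (c *s w) = Re c *\<^sub>R re w - Im c *\<^sub>R im w"
    and im_scale: "im (c *s w) = Im c *\<^sub>R re w + Re c *\<^sub>R im w" for c w
    by (simp_all add: re_def im_def vec_eq_iff)
  have re_add: "re (v + w) = re v + re w" and im_add: "im (v + w) = im v + im w" for v w
    by (simp_all add: re_def im_def vec_eq_iff)
  have re_f: "re (f w) = transpose A *v re w" and im_f: "im (f w) = transpose A *v im w" for w
    by (simp_all add: re_def im_def f_def vec_eq_iff matrix_vector_mult_def)
  have vs: "vector_space ((*s) :: complex \<Rightarrow> complex^'n \<Rightarrow> _)" by (rule vec.vector_space_axioms)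
  have lin: "Vector_Spaces.linear (*s) (*s) f"
    unfolding f_def by (rule matrix_vector_mul_linear_gen)
  have real: "(of_real r :: complex) *s w = r *\<^sub>R w" for r and w :: "complex^'n"
    unfolding vec_eq_iff by (simp add: scaleR_conv_of_real[where 'a = complex])
  have sub: "module.subspace ((*s) :: complex \<Rightarrow> complex^'n \<Rightarrow> _) K"
  proof (rule vec.subspaceI)
    have "re 0 = 0" "im 0 = 0" by (simp_all add: re_def im_def vec_eq_iff)
    then show "0 \<in> K" by (simp add: K_def subspace_0 N)
  qed (auto simp: K_def re_add im_add re_scale im_scale N subspace_add subspace_diff subspace_scale)
  have Kinv: "f w \<in> K" if "w \<in> K" for w using that inv by (simp add: K_def re_f im_f)
  define w0 where "w0 = (\<chi> i. complex_of_real (z0 $ i))"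
  have "re w0 = z0" "im w0 = 0" by (simp_all add: w0_def re_def im_def vec_eq_iff)
  then have w0: "w0 \<in> K" "w0 \<noteq> 0"
    using z0 N by (auto simp: K_def subspace_0 re_def im_def)
  obtain l w where w: "w \<in> K" "w \<noteq> 0" "f w = l *s w"
    using invariant_subspace_eigenvector[OF vs real lin sub Kinv w0] by blast
  define a b where "a = re w" and "b = im w"
  have abN: "a \<in> N" "b \<in> N" using w(1) by (simp_all add: K_def a_def b_def)
  have ab0: "a \<noteq> 0 \<or> b \<noteq> 0"
    using w(2) by (auto simp: a_def b_def re_def im_def vec_eq_iff complex_eq_iff)
  have Aa: "transpose A *v a = Re l *\<^sub>R a - Im l *\<^sub>R b"
    using arg_cong[OF w(3), of re] by (simp add: re_f re_scale a_def b_def)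
  have Ab: "transpose A *v b = Im l *\<^sub>R a + Re l *\<^sub>R b"
    using arg_cong[OF w(3), of im] by (simp add: im_f im_scale a_def b_def)
  \<comment> \<open>The target is a nonzero one of \<open>a\<close> and \<open>b\<close>; if both
    coordinates vanish at the end of the trajectory, so does the inner product of the target with
    itself.\<close>
  define u where "u = (if a \<noteq> 0 then a else b)"
  obtain tf x and inp :: "real \<Rightarrow> real^'m" where tf: "tf > 0" and x: "x 0 = 0" "x tf = u"
    and int: "\<forall>t\<in>{0..tf}. ((\<lambda>s. A *v x s + B *v inp s) has_integral (x t - 0)) {0..t}"
    using ctr[unfolded controllable_def, rule_format, of 0 u] by blast
  have coord: "((\<lambda>s. (transpose A *v z) \<bullet> x s) has_integral (z \<bullet> x t)) {0..t}"
    if "t \<in> {0..tf}" "z \<in> N" for t z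
  proof -
    have "((\<lambda>s. z \<bullet> (A *v x s + B *v inp s)) has_integral (z \<bullet> x t)) {0..t}"
      using has_integral_linear[OF bspec[OF int that(1)] bounded_linear_inner_right[of z]] by (simp add: o_def)
    moreover have "z \<bullet> (B *v y) = 0" for y
      using inv that(2) by (metis inner_transpose_mult inner_zero_left)
    ultimately show ?thesis by (simp add: inner_add_right inner_transpose_mult)
  qed
  \<comment> \<open>The input is merely integrable, but it has dropped out of these coordinates;
    they are continuous as indefinite integrals, hence differentiable because their integrands are
    such coordinates too.\<close>
  have cont: "continuous_on {0..tf} (\<lambda>t. z \<bullet> x t)" if "z \<in> N" for z
  proof -
    have "(\<lambda>s. (transpose A *v z) \<bullet> x s) integrable_on {0..tf}"
      using coord[OF _ that, of tf] tf by auto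
    then have "continuous_on {0..tf} (\<lambda>t. integral {0..t} (\<lambda>s. (transpose A *v z) \<bullet> x s))"
      by (rule indefinite_integral_continuous_1)
    then show ?thesis
      by (rule continuous_on_eq) (rule integral_unique[OF coord[OF _ that]])
  qed
  have deriv: "((\<lambda>t. z \<bullet> x t) has_real_derivative (transpose A *v z) \<bullet> x t) (at t within {0..tf})"
    if "t \<in> {0..tf}" "z \<in> N" for t z
  proof -
    have "((\<lambda>t. integral {0..t} (\<lambda>s. (transpose A *v z) \<bullet> x s)) has_real_derivative
        (transpose A *v z) \<bullet> x t) (at t within {0..tf})"
      using integral_has_vector_derivative[OF cont[of "transpose A *v z"] that(1)] inv that(2)
      by (simp add: has_real_derivative_iff_has_vector_derivative)
    then show ?thesis
      by (rule has_field_derivative_transform_within[OF _ zero_less_one that(1)])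
        (rule integral_unique[OF coord[OF _ that(2)]])
  qed
  \<comment> \<open>The squared modulus of the complex coordinate with its growth factor removed;
    the rotation by \<open>Im l\<close> cancels in the sum of squares.\<close>
  define E where "E t = ((a \<bullet> x t)\<^sup>2 + (b \<bullet> x t)\<^sup>2) * exp (- (2 * Re l * t))" for t
  have "(E has_real_derivative 0) (at t within {0..tf})" if "t \<in> {0..tf}" for t
    unfolding E_def
    by (rule derivative_eq_intros deriv[OF that] abN refl)+
      (simp add: Aa Ab inner_add_left inner_diff_left algebra_simps power2_eq_square)
  then have "E tf = E 0"
    using has_field_derivative_zero_constant[of "{0..tf}" E] tf by fastforce
  then have "(a \<bullet> u)\<^sup>2 + (b \<bullet> u)\<^sup>2 = 0" by (simp add: E_def x)
  then have "a \<bullet> u = 0" "b \<bullet> u = 0" by (simp_all add: sum_power2_eq_zero_iff)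
  then show False using ab0 by (auto simp: u_def split: if_splits)
qed

subsection \<open>Riccati equations\<close>

text \<open>Multiplication by \<open>V\<close>, the inverse of \<open>Z\<close>, on both sides turns
  the quadratic term into the constant \<open>G\<close> and leaves an equation linear in
  \<open>V\<close>. The sign \<open>e\<close> covers the equation of \<open>X\<close>
  (\<open>e = 1\<close>) and that of \<open>Y\<close> (\<open>e = -1\<close>).\<close>

lemma riccati_iff_lyap:
  fixes F G V Z :: "real^'n^'n"
  assumes ZV: "Z ** V = mat 1" and VZ: "V ** Z = mat 1"
  shows "transpose F ** Z + Z ** F + e *\<^sub>R (Z ** G ** Z) = g *\<^sub>R Z \<longleftrightarrow>
    lyap (F - (g / 2) *\<^sub>R mat 1) V = - (e *\<^sub>R G)"
proof -
  have ZV': "H ** Z ** V = H" and VZ': "H ** V ** Z = H" for H :: "real^'n^'n"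
    by (simp_all add: ZV VZ flip: matrix_mul_assoc)
  define L where "L = lyap (F - (g / 2) *\<^sub>R mat 1) V + e *\<^sub>R G"
  define E where "E = transpose F ** Z + Z ** F + e *\<^sub>R (Z ** G ** Z) - g *\<^sub>R Z"
  have "V ** E ** V = L"
    unfolding E_def L_def lyap_shift
    by (simp add: lyap_def matrix_ring_simps ZV ZV' VZ VZ')
  moreover have "Z ** L ** Z = E"
    unfolding E_def L_def lyap_shift
    by (simp add: lyap_def matrix_ring_simps ZV ZV' VZ VZ')
  ultimately have "E = 0 \<longleftrightarrow> L = 0" by (metis matrix_mul_assoc matrix_minus_left matrix_minus_right
      add.inverse_neutral diff_self matrix_diff_ldistrib matrix_diff_rdistrib)
  then show ?thesis by (simp add: E_def L_def eq_neg_iff_add_eq_0)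
qed

text \<open>The kernel of \<open>V\<close> lies in the kernel of \<open>B^T\<close>; there the
  feedback term of \<open>M^T\<close> disappears, so the kernel is invariant under
  \<open>A^T\<close> and hence trivial.\<close>

lemma lyap_gram_imp_pd:
  fixes A M V Q0 :: "real^'n^'n" and B :: "real^'m^'n"
  assumes nhm: "no_hidden_modes A B"
    and M: "M = a *\<^sub>R (A + B ** K) + b *\<^sub>R mat 1" and "a \<noteq> 0"
    and Q0: "pd_matrix Q0" "pd_matrix (- lyap M Q0)"
    and V: "transpose V = V" "lyap M V = - (B ** transpose B)"
  shows "pd_matrix V"
proof -
  have psd: "psd_matrix V"
    by (rule lyap_comparison[OF Q0 V(1)]) (simp add: V psd_gram)
  define N where "N = {z. V *v z = 0}"
  have "subspace N"
    by (rule subspaceI) (simp_all add: N_def matrix_vector_simps)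
  moreover have "transpose A *v z \<in> N \<and> transpose B *v z = 0" if "z \<in> N" for z
  proof -
    have Vz: "V *v z = 0" using that by (simp add: N_def)
    have "z \<bullet> (lyap M V *v z) = 0" by (simp add: inner_lyap[OF V(1)] Vz)
    then have Bz: "transpose B *v z = 0"
      by (simp add: V(2) matrix_vector_minus_left inner_gram)
    have "lyap M V *v z = 0" by (simp add: V(2) matrix_vector_simps Bz)
    then have "V *v (transpose M *v z) = 0" by (simp add: lyap_def matrix_vector_simps Vz)
    moreover have "transpose M *v z = a *\<^sub>R (transpose A *v z) + b *\<^sub>R z"
      by (simp add: M transpose_simps matrix_vector_simps Bz)
    ultimately show ?thesis using \<open>a \<noteq> 0\<close> Bz by (simp add: N_def matrix_vector_simps Vz)
  qed
  ultimately have N: "N = {0}" using nhm by (simp add: no_hidden_modes_def)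
  show ?thesis
    unfolding pd_matrix_def
  proof (intro conjI allI impI V(1))
    fix x :: "real^'n" assume "x \<noteq> 0"
    then have "V *v x \<noteq> 0" using N by (auto simp: N_def)
    then have "x \<bullet> (V *v x) \<noteq> 0" using psd_kernel[OF psd] by blast
    then show "0 < x \<bullet> (V *v x)" using psd_nonneg[OF psd, of x] by linarith
  qed
qed

text \<open>Multiplying by \<open>e\<close> normalises the right-hand side of the Lyapunov equation
  to \<open>- B B^T\<close>. Its unique symmetric solution is positive definite, and inversion is a
  bijection between its positive definite solutions and those of the Riccati equation.\<close>

lemma riccati_unique_pd:
  fixes A Q0 :: "real^'n^'n" and B :: "real^'m^'n"
  assumes nhm: "no_hidden_modes A B" and e: "e * e = 1"
    and F: "F = A + B ** K" and M: "M = e *\<^sub>R (F - (g / 2) *\<^sub>R mat 1)"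
    and Q0: "pd_matrix Q0" "pd_matrix (- lyap M Q0)"
  shows "\<exists>!Z. pd_matrix Z \<and>
    transpose F ** Z + Z ** F + e *\<^sub>R (Z ** (B ** transpose B) ** Z) = g *\<^sub>R Z"
proof -
  let ?G = "B ** transpose B"
  have e0: "e \<noteq> 0" using e by auto
  have scale: "lyap M V = - ?G \<longleftrightarrow> lyap (F - (g / 2) *\<^sub>R mat 1) V = - (e *\<^sub>R ?G)" for V
  proof -
    have "lyap M V = e *\<^sub>R lyap (F - (g / 2) *\<^sub>R mat 1) V"
      by (simp add: M bounded_bilinear.scaleR_left[OF bounded_bilinear_lyap])
    moreover have "- ?G = e *\<^sub>R (- (e *\<^sub>R ?G))" using e by simp
    ultimately show ?thesis using e0 by (metis scaleR_left_imp_eq)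
  qed
  have riccati: "transpose F ** Z + Z ** F + e *\<^sub>R (Z ** ?G ** Z) = g *\<^sub>R Z \<longleftrightarrow> lyap M V = - ?G"
    if "Z ** V = mat 1" "V ** Z = mat 1" for Z V
    unfolding scale using that by (rule riccati_iff_lyap)
  have M': "M = e *\<^sub>R (A + B ** K) + (- e * (g / 2)) *\<^sub>R mat 1"
    by (simp add: M F algebra_simps)
  obtain R where R: "\<And>C. transpose C = C \<Longrightarrow> transpose (R C) = R C \<and> lyap M (R C) = C"
    using lyap_symmetric_inverse[OF lyap_unique[OF Q0]] by metis
  have tG: "transpose (- ?G) = - ?G" by (simp add: transpose_simps)
  define V where "V = R (- ?G)"
  have V: "transpose V = V" "lyap M V = - ?G" using R[OF tG] by (simp_all add: V_def)
  have "pd_matrix V" by (rule lyap_gram_imp_pd[OF nhm M' e0 Q0 V])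
  then obtain Z where Z: "V ** Z = mat 1" "Z ** V = mat 1" "pd_matrix Z" by (rule pd_inverse)
  show ?thesis
  proof (rule ex1I)
    show "pd_matrix Z \<and> transpose F ** Z + Z ** F + e *\<^sub>R (Z ** ?G ** Z) = g *\<^sub>R Z"
      using Z riccati V(2) by blast
    fix Z' assume Z': "pd_matrix Z' \<and> transpose F ** Z' + Z' ** F + e *\<^sub>R (Z' ** ?G ** Z') = g *\<^sub>R Z'"
    then obtain V' where V': "Z' ** V' = mat 1" "V' ** Z' = mat 1" "pd_matrix V'"
      using pd_inverse by blast
    then have "lyap M V' = - ?G" using Z' riccati by blast
    then have "V' - V = 0"
      using V pd_symmetric[OF V'(3)]
      by (intro lyap_unique[OF Q0, of "V' - V"]) (simp_all add: lyap_diff_right transpose_simps)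
    then have "V' = V" by simp
    then show "Z' = Z" using V' Z by (metis matrix_mul_assoc matrix_mul_lid matrix_mul_rid)
  qed
qed

text \<open>With \<open>D = W - V\<close> the difference is
  \<open>Y - X = X D X + (D X)^T Y (D X)\<close>; the first term is already positive
  definite.\<close>

lemma pd_inverse_antitone:
  fixes X Y V W :: "real^'n^'n"
  assumes X: "pd_matrix X" "X ** W = mat 1" and Y: "pd_matrix Y" "V ** Y = mat 1" "Y ** V = mat 1"
    and D: "pd_matrix (W - V)"
  shows "pd_matrix (Y - X)"
proof -
  define D where "D = W - V"
  have WX: "W ** X = mat 1" using X(2) by (simp add: matrix_left_right_inverse)
  have YV': "H ** Y ** V = H" and WX': "H ** W ** X = H" and XW': "H ** X ** W = H"
    and VY': "H ** V ** Y = H" for H :: "real^'n^'n"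
    by (simp_all add: Y X WX flip: matrix_mul_assoc)
  have "Y - X = transpose X ** D ** X + transpose (D ** X) ** Y ** (D ** X)"
    using pd_symmetric[OF X(1)] pd_symmetric[OF D]
    by (simp add: D_def transpose_simps) (simp add: matrix_ring_simps YV' WX' XW' VY' X Y WX)
  moreover have "pd_matrix (transpose X ** D ** X)"
    unfolding pd_matrix_def
  proof (intro conjI allI impI)
    show "transpose (transpose X ** D ** X) = transpose X ** D ** X"
      using pd_imp_psd[OF D] psd_congruence psd_symmetric unfolding D_def by blast
    fix x :: "real^'n" assume "x \<noteq> 0"
    then have "X *v x \<noteq> 0" by (metis WX matrix_vector_mul_assoc matrix_vector_mul_lid matrix_vector_mult_0_right)
    then have "0 < (X *v x) \<bullet> (D *v (X *v x))" using D by (simp add: pd_matrix_def D_def)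
    then show "0 < x \<bullet> ((transpose X ** D ** X) *v x)"
      by (simp add: matrix_vector_simps inner_transpose_mult[of "transpose X", simplified])
  qed
  ultimately show ?thesis
    using pd_add_psd psd_congruence[OF pd_imp_psd[OF Y(1)]] by metis
qed

lemma trace_scaleR: "trace (c *\<^sub>R A) = c * trace A" for A :: "real^'n^'n"
  by (simp add: trace_def sum_distrib_left)

lemma trace_transpose: "trace (transpose A) = trace A" for A :: "real^'n^'n"
  by (simp add: trace_def transpose_def)

text \<open>Trace of the equation after right multiplication by the inverse of \<open>Z\<close>: the
  unknown survives only in \<open>trace (Z ** G)\<close>.\<close>

lemma trace_riccati:
  fixes F G V Z :: "real^'n^'n"
  assumes ZV: "Z ** V = mat 1"
    and eq: "transpose F ** Z + Z ** F + e *\<^sub>R (Z ** G ** Z) = g *\<^sub>R Z"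
  shows "2 * trace F + e * trace (Z ** G) = g * real CARD('n)"
proof -
  have VZ: "V ** Z = mat 1" using ZV by (simp add: matrix_left_right_inverse)
  have ZV': "H ** Z ** V = H" for H :: "real^'n^'n" by (simp add: ZV flip: matrix_mul_assoc)
  have "trace (Z ** F ** V) = trace F"
    by (subst trace_mul_sym) (simp add: matrix_mul_assoc VZ)
  moreover have "trace ((transpose F ** Z + Z ** F + e *\<^sub>R (Z ** G ** Z)) ** V) = trace ((g *\<^sub>R Z) ** V)"
    by (simp only: eq)
  ultimately show ?thesis
    by (simp add: matrix_ring_simps ZV ZV' trace_add trace_scaleR trace_transpose trace_I)
qed

text \<open>Cauchy-Schwarz for the form of \<open>P\<close>, one column of \<open>B\<close> at a
  time; the diagonal terms add up to the trace of \<open>B^T P B\<close>.\<close>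

lemma psd_norm_bound:
  fixes P :: "real^'n^'n" and B :: "real^'m^'n"
  assumes "psd_matrix P"
  shows "(norm (transpose B *v (P *v x)))\<^sup>2 \<le> trace (P ** (B ** transpose B)) * (x \<bullet> (P *v x))"
proof -
  have "(norm (transpose B *v (P *v x)))\<^sup>2 = (\<Sum>i\<in>UNIV. (column i B \<bullet> (P *v x))\<^sup>2)"
    unfolding power2_norm_eq_inner inner_vec_def[of "transpose B *v _"]
    by (simp add: inner_vec_def matrix_vector_mult_def transpose_def column_def power2_eq_square)
  also have "\<dots> \<le> (\<Sum>i\<in>UNIV. (column i B \<bullet> (P *v column i B)) * (x \<bullet> (P *v x)))"
    by (intro sum_mono psd_cauchy_schwarz assms)
  also have "\<dots> = (\<Sum>i\<in>UNIV. column i B \<bullet> (P *v column i B)) * (x \<bullet> (P *v x))"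
    by (simp add: sum_distrib_right)
  also have "(\<Sum>i\<in>UNIV. column i B \<bullet> (P *v column i B)) = trace (transpose B ** (P ** B))"
    by (simp add: trace_def matrix_matrix_mult_def inner_vec_def matrix_vector_mult_def transpose_def column_def)
  also have "\<dots> = trace (P ** (B ** transpose B))"
    by (subst trace_mul_sym) (simp add: matrix_mul_assoc)
  finally show ?thesis .
qed

lemma scaleR_double: "(2 * c) *\<^sub>R v = c *\<^sub>R v + c *\<^sub>R v" for v :: "'a::real_vector"
  by (metis mult_2 scaleR_left_distrib)

lemma lyap_scaled_identity: "lyap (s *\<^sub>R mat 1) Q = (2 * s) *\<^sub>R Q"
  unfolding scaleR_double by (simp add: lyap_def matrix_ring_simps transpose_simps)

section \<open>The solutions \<open>X\<close> and \<open>Y\<close> of the Riccati equations and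
  their difference \<open>P\<close>\<close>

locale marginal_pair =
  fixes A :: "real^'n^'n" and B :: "real^'m^'n"
  assumes nhm: "no_hidden_modes A B"
    and spec: "\<forall>l. complex_eigenvalue A l \<longrightarrow> Re l \<le> 0"
begin

abbreviation "G \<equiv> B ** transpose B"
abbreviation "X \<equiv> riccati_X A B"
abbreviation "Y \<equiv> riccati_Y A B"
abbreviation "P \<equiv> P_mat A B"

text \<open>\<open>riccati_X\<close> is a definite description, so its properties become available
  only through unique existence.\<close>

lemma riccati_X:
  fixes \<gamma> :: real
  assumes "\<gamma> > 0"
  shows "pd_matrix (X \<gamma>)" "transpose A ** X \<gamma> + X \<gamma> ** A + X \<gamma> ** G ** X \<gamma> = \<gamma> *\<^sub>R X \<gamma>"
proof -
  obtain Q where "pd_matrix Q" "pd_matrix (- lyap (A - (\<gamma> / 2) *\<^sub>R mat 1) Q)"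
    using lyap_shift_pd_exists[OF spec, of "\<gamma> / 2"] assms by auto
  then have "\<exists>!Z. pd_matrix Z \<and> transpose A ** Z + Z ** A + Z ** G ** Z = \<gamma> *\<^sub>R Z"
    using riccati_unique_pd[OF nhm, of 1 A 0 "A - (\<gamma> / 2) *\<^sub>R mat 1" \<gamma> Q] by simp
  from theI'[OF this] show "pd_matrix (X \<gamma>)" 
    "transpose A ** X \<gamma> + X \<gamma> ** A + X \<gamma> ** G ** X \<gamma> = \<gamma> *\<^sub>R X \<gamma>"
    unfolding riccati_X_def by (simp_all add: matrix_mul_assoc)
qed

text \<open>The last identity says that the inverse \<open>W\<close> of \<open>X\<close> is a strict
  Lyapunov witness for \<open>- (A + G X + (\<gamma> / 2) 1)\<close>, the matrix that governs
  \<open>Y\<close>: the shift and \<open>A\<close> contribute \<open>2 \<gamma> W - G\<close>, the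
  feedback contributes \<open>2 G\<close>.\<close>

lemma inverse_X:
  fixes \<gamma> :: real
  assumes "\<gamma> > 0"
  obtains W where "X \<gamma> ** W = mat 1" "W ** X \<gamma> = mat 1" "pd_matrix W"
    "lyap (A - (\<gamma> / 2) *\<^sub>R mat 1) W = - G"
    "lyap (A + G ** X \<gamma> + (\<gamma> / 2) *\<^sub>R mat 1) W = (2 * \<gamma>) *\<^sub>R W + G"
proof -
  obtain W where W: "X \<gamma> ** W = mat 1" "W ** X \<gamma> = mat 1" "pd_matrix W"
    using pd_inverse[OF riccati_X(1)[OF assms]] by blast
  have L: "lyap (A - (\<gamma> / 2) *\<^sub>R mat 1) W = - G"
    using riccati_iff_lyap[OF W(1,2), of A 1 G \<gamma>] riccati_X(2)[OF assms] by simp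
  have XW': "H ** X \<gamma> ** W = H" for H :: "real^'n^'n"
    by (simp add: W flip: matrix_mul_assoc)
  have "lyap A W = \<gamma> *\<^sub>R W - G" using L unfolding lyap_shift by (simp add: algebra_simps)
  moreover have "lyap (G ** X \<gamma>) W = G + G"
    using pd_symmetric[OF riccati_X(1)[OF assms]] W
    by (simp add: lyap_def transpose_simps matrix_mul_assoc XW')
  moreover have "lyap ((\<gamma> / 2) *\<^sub>R mat 1) W = \<gamma> *\<^sub>R W" by (simp add: lyap_scaled_identity)
  ultimately have "lyap (A + G ** X \<gamma> + (\<gamma> / 2) *\<^sub>R mat 1) W = \<gamma> *\<^sub>R W - G + (G + G) + \<gamma> *\<^sub>R W"
    by (simp only: bounded_bilinear.add_left[OF bounded_bilinear_lyap])
  also have "\<dots> = (2 * \<gamma>) *\<^sub>R W + G" unfolding scaleR_double by simp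
  finally have "lyap (A + G ** X \<gamma> + (\<gamma> / 2) *\<^sub>R mat 1) W = (2 * \<gamma>) *\<^sub>R W + G" .
  then show thesis using that[OF W L] by simp
qed

lemma riccati_Y:
  fixes \<gamma> :: real
  assumes "\<gamma> > 0"
  defines "F \<equiv> A + G ** X \<gamma>"
  shows "pd_matrix (Y \<gamma>)" "transpose F ** Y \<gamma> + Y \<gamma> ** F - Y \<gamma> ** G ** Y \<gamma> = - (\<gamma> *\<^sub>R Y \<gamma>)"
proof -
  obtain W where W: "pd_matrix W" "lyap (F + (\<gamma> / 2) *\<^sub>R mat 1) W = (2 * \<gamma>) *\<^sub>R W + G"
    using inverse_X[OF assms(1)] unfolding F_def by metis
  have "- lyap (- (F + (\<gamma> / 2) *\<^sub>R mat 1)) W = (2 * \<gamma>) *\<^sub>R W + G"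
    unfolding bounded_bilinear.minus_left[OF bounded_bilinear_lyap] W(2) by simp
  then have neg: "pd_matrix (- lyap (- (F + (\<gamma> / 2) *\<^sub>R mat 1)) W)"
    using W(1) assms(1) by (simp only: minus_minus) (intro pd_add_psd pd_scaleR psd_gram, simp_all)
  have F: "F = A + B ** (transpose B ** X \<gamma>)" by (simp add: F_def matrix_mul_assoc)
  have "\<exists>!Z. pd_matrix Z \<and> transpose F ** Z + Z ** F - Z ** G ** Z = - (\<gamma> *\<^sub>R Z)"
    using riccati_unique_pd[OF nhm, of "-1" F _ "- (F + (\<gamma> / 2) *\<^sub>R mat 1)" "-\<gamma>", OF _ F _ W(1) neg] by simp
  from theI'[OF this] show "pd_matrix (Y \<gamma>)" 
    "transpose F ** Y \<gamma> + Y \<gamma> ** F - Y \<gamma> ** G ** Y \<gamma> = - (\<gamma> *\<^sub>R Y \<gamma>)"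
    unfolding riccati_Y_def F_def Let_def by (simp_all add: matrix_mul_assoc)
qed

lemma inverse_Y:
  fixes \<gamma> :: real
  assumes "\<gamma> > 0"
  obtains V where "Y \<gamma> ** V = mat 1" "V ** Y \<gamma> = mat 1" "pd_matrix V"
    "lyap (- (A + G ** X \<gamma> + (\<gamma> / 2) *\<^sub>R mat 1)) V = - G"
proof -
  obtain V where V: "Y \<gamma> ** V = mat 1" "V ** Y \<gamma> = mat 1" "pd_matrix V"
    using pd_inverse[OF riccati_Y(1)[OF assms]] by blast
  have "lyap (A + G ** X \<gamma> + (\<gamma> / 2) *\<^sub>R mat 1) V = G"
    using riccati_iff_lyap[OF V(1,2), of "A + G ** X \<gamma>" "-1" G "-\<gamma>"] riccati_Y(2)[OF assms]
    by simp
  then show thesis using that[OF V]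
    by (simp only: bounded_bilinear.minus_left[OF bounded_bilinear_lyap])
qed

text \<open>The inverses \<open>W\<close> of \<open>X\<close> and \<open>V\<close> of
  \<open>Y\<close> are compared under one operator; the Gram terms cancel in the difference and
  leave \<open>2 \<gamma> W\<close>. Thus \<open>W - V\<close> is positive definite, and inversion
  reverses the order.\<close>

lemma P_pd:
  fixes \<gamma> :: real
  assumes "\<gamma> > 0"
  shows "pd_matrix (P \<gamma>)"
proof -
  let ?M = "- (A + G ** X \<gamma> + (\<gamma> / 2) *\<^sub>R mat 1)"
  obtain W where W: "X \<gamma> ** W = mat 1" "W ** X \<gamma> = mat 1" "pd_matrix W"
    "lyap (A + G ** X \<gamma> + (\<gamma> / 2) *\<^sub>R mat 1) W = (2 * \<gamma>) *\<^sub>R W + G"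
    using inverse_X[OF assms] by metis
  obtain V where V: "Y \<gamma> ** V = mat 1" "V ** Y \<gamma> = mat 1" "pd_matrix V" "lyap ?M V = - G"
    using inverse_Y[OF assms] by metis
  have LW: "lyap ?M W = - ((2 * \<gamma>) *\<^sub>R W + G)"
    using W(4) by (simp only: bounded_bilinear.minus_left[OF bounded_bilinear_lyap])
  have pdW: "pd_matrix ((2 * \<gamma>) *\<^sub>R W)" using assms W(3) by (simp add: pd_scaleR)
  have neg: "pd_matrix (- lyap ?M W)"
    unfolding LW minus_minus by (intro pd_add_psd pdW psd_gram)
  have "- lyap ?M (W - V) = (2 * \<gamma>) *\<^sub>R W"
    unfolding lyap_diff_right LW V(4) by simp
  then have D: "pd_matrix (- lyap ?M (W - V))" using pdW by simp
  have "psd_matrix (W - V)"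
    by (rule lyap_comparison[OF W(3) neg _ pd_imp_psd[OF D]])
      (simp add: transpose_simps pd_symmetric W V)
  then have "pd_matrix (W - V)" using D by (rule psd_lyap_imp_pd)
  then show ?thesis
    unfolding P_mat_def
    by (rule pd_inverse_antitone[OF riccati_X(1)[OF assms] W(1) riccati_Y(1)[OF assms] V(2,1)])
qed

text \<open>The equation of \<open>Y\<close> minus that of \<open>X\<close>; after substituting
  \<open>Y = P + X\<close> all products mixing \<open>P\<close> and \<open>X\<close> cancel.\<close>

lemma P_equation:
  fixes \<gamma> :: real
  assumes "\<gamma> > 0"
  shows "transpose A ** P \<gamma> + P \<gamma> ** A = P \<gamma> ** G ** P \<gamma> - \<gamma> *\<^sub>R P \<gamma> - (2 * \<gamma>) *\<^sub>R X \<gamma>"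
proof -
  let ?F = "A + G ** X \<gamma>"
  have "transpose A ** P \<gamma> + P \<gamma> ** A - (P \<gamma> ** G ** P \<gamma> - \<gamma> *\<^sub>R P \<gamma> - (2 * \<gamma>) *\<^sub>R X \<gamma>) =
     (transpose ?F ** Y \<gamma> + Y \<gamma> ** ?F - Y \<gamma> ** G ** Y \<gamma> - - (\<gamma> *\<^sub>R Y \<gamma>)) -
     (transpose A ** X \<gamma> + X \<gamma> ** A + X \<gamma> ** G ** X \<gamma> - \<gamma> *\<^sub>R X \<gamma>)"
    using pd_symmetric[OF riccati_X(1)[OF assms]]
    by (simp add: P_mat_def transpose_simps matrix_ring_simps algebra_simps) (simp add: vec_eq_iff)
  also have "\<dots> = 0" using riccati_X(2)[OF assms] riccati_Y(2)[OF assms] by simp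
  finally show ?thesis by simp
qed

lemma trace_X:
  fixes \<gamma> :: real
  assumes "\<gamma> > 0"
  shows "trace (X \<gamma> ** G) = \<gamma> * real CARD('n) - 2 * trace A"
proof -
  obtain W where "X \<gamma> ** W = mat 1" using inverse_X[OF assms] by metis
  then show ?thesis using trace_riccati[of "X \<gamma>" W A 1 G \<gamma>] riccati_X(2)[OF assms] by simp
qed

text \<open>In the difference of the two trace identities the trace of \<open>A\<close> cancels, so
  the value depends on the dimension and \<open>\<gamma>\<close> only.\<close>

lemma trace_P:
  fixes \<gamma> :: real
  assumes "\<gamma> > 0"
  shows "trace (P \<gamma> ** G) = 2 * real CARD('n) * \<gamma>"
proof -
  obtain V where V: "Y \<gamma> ** V = mat 1" using inverse_Y[OF assms] by metis
  have "2 * trace (A + G ** X \<gamma>) - trace (Y \<gamma> ** G) = - \<gamma> * real CARD('n)"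
    using trace_riccati[OF V, of "A + G ** X \<gamma>" "-1" G "-\<gamma>"] riccati_Y(2)[OF assms] by simp
  moreover have "trace (G ** X \<gamma>) = trace (X \<gamma> ** G)" by (rule trace_mul_sym)
  ultimately show ?thesis
    by (simp add: P_mat_def matrix_diff_rdistrib trace_sub trace_add trace_X[OF assms])
qed

text \<open>This bound explains the weight \<open>2 n \<gamma>\<close> in \<open>ellipsoid\<close>:
  the weighted form dominates the squared norm of \<open>B^T P x\<close>.\<close>

lemma norm_BP_bound:
  fixes \<gamma> :: real
  assumes "\<gamma> > 0"
  shows "(norm (transpose B *v (P \<gamma> *v x)))\<^sup>2 \<le> 2 * real CARD('n) * \<gamma> * (x \<bullet> (P \<gamma> *v x))"
  using psd_norm_bound[OF pd_imp_psd[OF P_pd[OF assms]], of B x] by (simp add: trace_P[OF assms])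

text \<open>The shifted matrix of the loop closed by the input \<open>- B^T P x\<close>, transposed
  so that \<open>lyap\<close> acts on forms in the state. For this operator the equation of
  \<open>P\<close> makes \<open>P\<close> its own comparison witness.\<close>

definition "closed_matrix \<gamma> = transpose (A - G ** P \<gamma> + (\<gamma> / 2) *\<^sub>R mat 1)"

lemma lyap_closed_matrix:
  fixes \<gamma> :: real
  assumes "\<gamma> > 0"
  shows "lyap (closed_matrix \<gamma>) Q = transpose A ** Q + Q ** A - P \<gamma> ** G ** Q - Q ** G ** P \<gamma> + \<gamma> *\<^sub>R Q"
  using pd_symmetric[OF P_pd[OF assms]]
  by (simp add: closed_matrix_def lyap_def transpose_simps matrix_ring_simps algebra_simps
        flip: scaleR_left.add)

lemma lyap_closed_matrix_P:
  fixes \<gamma> :: real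
  assumes "\<gamma> > 0"
  shows "- lyap (closed_matrix \<gamma>) (P \<gamma>) = (2 * \<gamma>) *\<^sub>R X \<gamma> + P \<gamma> ** G ** P \<gamma>"
  unfolding lyap_closed_matrix[OF assms] P_equation[OF assms] by simp

lemma psd_PGP:
  fixes \<gamma> :: real
  assumes "\<gamma> > 0"
  shows "psd_matrix (P \<gamma> ** G ** P \<gamma>)"
  using psd_congruence[OF psd_gram[of B], of "P \<gamma>"] pd_symmetric[OF P_pd[OF assms]] by simp

lemma pd_lyap_closed_matrix_P:
  fixes \<gamma> :: real
  assumes "\<gamma> > 0"
  shows "pd_matrix (- lyap (closed_matrix \<gamma>) (P \<gamma>))"
  unfolding lyap_closed_matrix_P[OF assms]
  using assms by (simp add: pd_add_psd pd_scaleR riccati_X psd_PGP)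

text \<open>Comparison for \<open>P - c X\<close> with witness \<open>P\<close>. The cross term of
  \<open>p = B^T P y\<close> and \<open>q = B^T X y\<close> is split by
  \<open>2 (p \<bullet> q) \<le> p \<bullet> p + q \<bullet> q\<close>, and the squared norm of
  \<open>q\<close> is at most \<open>k \<gamma>\<close> times the form of \<open>X\<close>.\<close>

lemma X_le_P:
  assumes "\<gamma>0 > 0"
  obtains c where "c > 0" "\<And>\<gamma> x. \<gamma> \<ge> \<gamma>0 \<Longrightarrow> c * (x \<bullet> (X \<gamma> *v x)) \<le> x \<bullet> (P \<gamma> *v x)"
proof -
  \<comment> \<open>For \<open>\<gamma> \<ge> \<gamma>0\<close> this bounds
    \<open>trace (X \<gamma> ** G) / \<gamma>\<close> uniformly; \<open>c\<close> is then chosen to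
    satisfy both \<open>c \<le> 1\<close> and \<open>c k \<le> 1\<close>.\<close>
  define k where "k = real CARD('n) + 2 * \<bar>trace A\<bar> / \<gamma>0"
  define c where "c = 1 / (1 + k)"
  have k: "k \<ge> 0" using assms by (simp add: k_def)
  then have c: "c > 0" "c \<le> 1" "c * k \<le> 1" by (simp_all add: c_def)
  have "c * (x \<bullet> (X \<gamma> *v x)) \<le> x \<bullet> (P \<gamma> *v x)" if "\<gamma> \<ge> \<gamma>0" for \<gamma> x
  proof -
    have g: "\<gamma> > 0" using assms that by simp
    have "\<gamma> * real CARD('n) - 2 * trace A \<le> k * \<gamma>"
    proof -
      have "- 2 * trace A \<le> 2 * \<bar>trace A\<bar> / \<gamma>0 * \<gamma>0" using assms by simp
      also have "\<dots> \<le> 2 * \<bar>trace A\<bar> / \<gamma>0 * \<gamma>" using that assms by (intro mult_left_mono) auto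
      finally show ?thesis by (simp add: k_def algebra_simps)
    qed
    then have q: "(norm (transpose B *v (X \<gamma> *v y)))\<^sup>2 \<le> k * \<gamma> * (y \<bullet> (X \<gamma> *v y))" for y
      using psd_norm_bound[OF pd_imp_psd[OF riccati_X(1)[OF g]], of B y]
        psd_nonneg[OF pd_imp_psd[OF riccati_X(1)[OF g]], of y]
      by (simp add: trace_X[OF g]) (meson mult_right_mono order_trans)
    have tX: "transpose (X \<gamma>) = X \<gamma>" and tP: "transpose (P \<gamma>) = P \<gamma>"
      using riccati_X(1)[OF g] P_pd[OF g] by (simp_all add: pd_symmetric)
    have "transpose A ** X \<gamma> + X \<gamma> ** A = \<gamma> *\<^sub>R X \<gamma> - X \<gamma> ** G ** X \<gamma>"
      using riccati_X(2)[OF g] by (simp add: algebra_simps)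
    then have LX: "lyap (closed_matrix \<gamma>) (X \<gamma>) =
        (2 * \<gamma>) *\<^sub>R X \<gamma> - X \<gamma> ** G ** X \<gamma> - P \<gamma> ** G ** X \<gamma> - X \<gamma> ** G ** P \<gamma>"
      unfolding lyap_closed_matrix[OF g] scaleR_double by simp
    have "psd_matrix (- lyap (closed_matrix \<gamma>) (P \<gamma> - c *\<^sub>R X \<gamma>))"
      unfolding psd_matrix_def
    proof (intro conjI allI)
      show "transpose (- lyap (closed_matrix \<gamma>) (P \<gamma> - c *\<^sub>R X \<gamma>)) = - lyap (closed_matrix \<gamma>) (P \<gamma> - c *\<^sub>R X \<gamma>)"
        by (simp add: transpose_simps lyap_transpose tX tP)
      fix y
      define p q where "p = transpose B *v (P \<gamma> *v y)" and "q = transpose B *v (X \<gamma> *v y)"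
      have forms: "y \<bullet> (S *v (B *v v)) = (transpose B *v (S *v y)) \<bullet> v"
        if "transpose S = S" for S :: "real^'n^'n" and v
        using inner_symmetric_mult[OF that, of y] by (simp add: inner_transpose_mult)
      have "y \<bullet> (- lyap (closed_matrix \<gamma>) (P \<gamma> - c *\<^sub>R X \<gamma>) *v y) =
          y \<bullet> ((- lyap (closed_matrix \<gamma>) (P \<gamma>) + c *\<^sub>R lyap (closed_matrix \<gamma>) (X \<gamma>)) *v y)"
        by (simp add: lyap_diff_right lyap_scaleR_right)
      also have "\<dots> = 2 * \<gamma> * (y \<bullet> (X \<gamma> *v y)) + p \<bullet> p
          + c * (2 * \<gamma> * (y \<bullet> (X \<gamma> *v y)) - q \<bullet> q - 2 * (p \<bullet> q))"
        unfolding lyap_closed_matrix_P[OF g] LX p_def q_def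
        by (simp add: matrix_vector_simps inner_add_right inner_diff_right forms tX tP inner_commute)
      finally have eq: "y \<bullet> (- lyap (closed_matrix \<gamma>) (P \<gamma> - c *\<^sub>R X \<gamma>) *v y) =
          2 * \<gamma> * (y \<bullet> (X \<gamma> *v y)) + p \<bullet> p + c * (2 * \<gamma> * (y \<bullet> (X \<gamma> *v y)) - q \<bullet> q - 2 * (p \<bullet> q))" .
      have xx: "0 \<le> \<gamma> * (y \<bullet> (X \<gamma> *v y))"
        using psd_nonneg[OF pd_imp_psd[OF riccati_X(1)[OF g]], of y] g by simp
      have "0 \<le> (p - q) \<bullet> (p - q)" by simp
      then have "2 * (p \<bullet> q) \<le> p \<bullet> p + q \<bullet> q" by (simp add: inner_diff_left inner_diff_right inner_commute)
      moreover have "q \<bullet> q \<le> k * (\<gamma> * (y \<bullet> (X \<gamma> *v y)))"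
        using q[of y] by (simp add: q_def power2_norm_eq_inner mult.assoc)
      ultimately have "c * (q \<bullet> q + 2 * (p \<bullet> q)) \<le> c * (2 * (k * (\<gamma> * (y \<bullet> (X \<gamma> *v y)))) + p \<bullet> p)"
        using c by (intro mult_left_mono) auto
      also have "\<dots> = 2 * ((c * k) * (\<gamma> * (y \<bullet> (X \<gamma> *v y)))) + c * (p \<bullet> p)" by (simp add: algebra_simps)
      also have "\<dots> \<le> 2 * (\<gamma> * (y \<bullet> (X \<gamma> *v y))) + p \<bullet> p"
        using mult_right_mono[OF c(3) xx] mult_right_mono[OF c(2), of "p \<bullet> p"] by simp
      finally show "0 \<le> y \<bullet> (- lyap (closed_matrix \<gamma>) (P \<gamma> - c *\<^sub>R X \<gamma>) *v y)"
        unfolding eq using mult_nonneg_nonneg[OF less_imp_le[OF c(1)] xx] by (simp add: algebra_simps)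
    qed
    from lyap_comparison[OF P_pd[OF g] pd_lyap_closed_matrix_P[OF g] _ this]
    have "psd_matrix (P \<gamma> - c *\<^sub>R X \<gamma>)" by (simp add: transpose_simps tX tP)
    then show ?thesis
      using psd_nonneg[of "P \<gamma> - c *\<^sub>R X \<gamma>" x] by (simp add: matrix_vector_simps inner_diff_right)
  qed
  then show thesis using that c(1) by blast
qed

end

subsection \<open>Dependence on the parameter\<close>

lemma has_vector_derivative_iff_quotient:
  fixes f :: "real \<Rightarrow> 'a::real_normed_vector"
  shows "(f has_vector_derivative D) (at a) \<longleftrightarrow> ((\<lambda>y. (1 / (y - a)) *\<^sub>R (f y - f a)) \<longlongrightarrow> D) (at a)"
proof -
  have eq: "norm ((1 / norm (y - a)) *\<^sub>R (f y - (f a + (y - a) *\<^sub>R D))) =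
      norm ((1 / (y - a)) *\<^sub>R (f y - f a) - D)" if "y \<noteq> a" for y
  proof -
    have "(1 / (y - a)) *\<^sub>R (f y - (f a + (y - a) *\<^sub>R D)) = (1 / (y - a)) *\<^sub>R (f y - f a) - D"
      using that by (simp add: scaleR_diff_right scaleR_add_right)
    then show ?thesis by (metis (no_types, opaque_lifting) abs_divide abs_norm_cancel norm_scaleR real_norm_def abs_one)
  qed
  have "(f has_vector_derivative D) (at a) \<longleftrightarrow>
      ((\<lambda>y. norm ((1 / norm (y - a)) *\<^sub>R (f y - (f a + (y - a) *\<^sub>R D)))) \<longlongrightarrow> 0) (at a)"
    unfolding has_vector_derivative_def has_derivative_within tendsto_norm_zero_iff
    by (simp add: bounded_linear_scaleR_left)
  also have "\<dots> \<longleftrightarrow> ((\<lambda>y. norm ((1 / (y - a)) *\<^sub>R (f y - f a) - D)) \<longlongrightarrow> 0) (at a)"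
    by (rule filterlim_cong[OF refl refl], unfold eventually_at_filter, rule always_eventually)
      (blast intro: eq)
  also have "\<dots> \<longleftrightarrow> ((\<lambda>y. (1 / (y - a)) *\<^sub>R (f y - f a)) \<longlongrightarrow> D) (at a)"
    by (simp only: tendsto_norm_zero_iff LIM_zero_iff)
  finally show ?thesis .
qed

text \<open>Subtracting the equations at \<open>x\<close> and \<open>a\<close> and applying the left
  inverse \<open>R\<close> gives an exact formula for \<open>Q x - Q a\<close> in terms of the
  increments of \<open>D\<close> and \<open>M\<close>; divide by \<open>x - a\<close>. The subspace
  \<open>S\<close> is there because \<open>R\<close> inverts the Lyapunov operator on symmetric
  matrices only.\<close>

lemma implicit_has_vector_derivative:
  fixes h :: "'m::real_normed_vector \<Rightarrow> 'q::real_normed_vector \<Rightarrow> 'd::real_normed_vector"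
    and M :: "real \<Rightarrow> 'm"
  assumes h: "bounded_bilinear h" and R: "bounded_linear R"
    and inv: "\<And>q. q \<in> S \<Longrightarrow> R (h (M a) q) = q" and S: "subspace S"
    and U: "open U" "a \<in> U"
    and QS: "\<And>x. x \<in> U \<Longrightarrow> Q x \<in> S" and eq: "\<And>x. x \<in> U \<Longrightarrow> h (M x) (Q x) = D x"
    and M: "(M has_vector_derivative M') (at a)" and D: "(D has_vector_derivative D') (at a)"
  shows "(Q has_vector_derivative R (D' - h M' (Q a))) (at a)"
proof -
  interpret h: bounded_bilinear h by (rule h)
  interpret R: bounded_linear R by (rule R)
  obtain Kh where Kh: "Kh \<ge> 0" "\<And>m q. norm (h m q) \<le> norm m * norm q * Kh"
    using h.nonneg_bounded by blast
  obtain KR where KR: "KR \<ge> 0" "\<And>z. norm (R z) \<le> norm z * KR"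
    using R.nonneg_bounded by blast
  have diff: "Q x - Q a = R ((D x - D a) - h (M x - M a) (Q x))" if "x \<in> U" for x
  proof -
    have "R (h (M a) (Q x - Q a)) = Q x - Q a"
      using QS that U(2) S by (intro inv subspace_diff)
    moreover have "h (M a) (Q x - Q a) = (D x - D a) - h (M x - M a) (Q x)"
      using eq[OF that] eq[OF U(2)] by (simp add: h.diff_left h.diff_right)
    ultimately show ?thesis by simp
  qed
  define e where "e x = norm (M x - M a) * (Kh * KR)" for x
  define d where "d x = norm (D x - D a) * KR" for x
  have Ma: "(M \<longlongrightarrow> M a) (at a)"
    using has_vector_derivative_continuous[OF M] by (simp add: continuous_at)
  have Da: "(D \<longlongrightarrow> D a) (at a)"
    using has_vector_derivative_continuous[OF D] by (simp add: continuous_at)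
  have e0: "(e \<longlongrightarrow> 0) (at a)" and d0: "(d \<longlongrightarrow> 0) (at a)"
    unfolding e_def d_def using Ma Da
    by (auto intro!: tendsto_mult_left_zero tendsto_norm_zero simp: LIM_zero_iff)
  have bound: "norm (Q x - Q a) \<le> d x + e x * norm (Q x)" if "x \<in> U" for x
  proof -
    have "norm (Q x - Q a) \<le> (norm (D x - D a) + norm (h (M x - M a) (Q x))) * KR"
      unfolding diff[OF that] using KR
      by (meson norm_triangle_ineq4 mult_right_mono order_trans)
    also have "\<dots> \<le> (norm (D x - D a) + norm (M x - M a) * norm (Q x) * Kh) * KR"
      using Kh KR by (intro mult_right_mono add_left_mono) auto
    finally show ?thesis by (simp add: d_def e_def algebra_simps)
  qed
  have inU: "eventually (\<lambda>x. x \<in> U) (at a)" using U by (simp add: eventually_at_in_open')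
  have small: "eventually (\<lambda>x. e x < 1 / 2) (at a)" using e0 by (rule order_tendstoD) simp
  \<comment> \<open>Continuity of \<open>Q\<close> at \<open>a\<close> is not given: once
    \<open>e x < 1 / 2\<close>, the term with \<open>norm (Q x)\<close> is absorbed on the left,
    which bounds \<open>Q\<close> near \<open>a\<close>.\<close>
  have "eventually (\<lambda>x. norm (Q x - Q a) \<le> d x + e x * (2 * (norm (Q a) + d x))) (at a)"
    using inU small
  proof eventually_elim
    case (elim x)
    have e: "e x \<ge> 0" using Kh KR by (simp add: e_def)
    have "norm (Q x) \<le> norm (Q a) + norm (Q x - Q a)" by (metis add.commute diff_add_cancel norm_triangle_ineq)
    also have "\<dots> \<le> norm (Q a) + d x + 1 / 2 * norm (Q x)"
      using bound[OF elim(1)] mult_right_mono[OF less_imp_le[OF elim(2)], of "norm (Q x)"] by simp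
    finally have "norm (Q x) \<le> 2 * (norm (Q a) + d x)" by simp
    then show ?case using bound[OF elim(1)] e by (meson add_left_mono mult_left_mono order_trans)
  qed
  moreover have "((\<lambda>x. d x + e x * (2 * (norm (Q a) + d x))) \<longlongrightarrow> 0 + 0 * (2 * (norm (Q a) + 0))) (at a)"
    by (intro tendsto_intros e0 d0)
  ultimately have "((\<lambda>x. Q x - Q a) \<longlongrightarrow> 0) (at a)"
    using Lim_null_comparison[of "\<lambda>x. Q x - Q a" "\<lambda>x. d x + e x * (2 * (norm (Q a) + d x))" "at a"] by simp
  then have Qa: "(Q \<longlongrightarrow> Q a) (at a)" by (simp add: LIM_zero_iff)
  have "((\<lambda>x. R ((1 / (x - a)) *\<^sub>R (D x - D a) - h ((1 / (x - a)) *\<^sub>R (M x - M a)) (Q x)))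
      \<longlongrightarrow> R (D' - h M' (Q a))) (at a)"
    using M D unfolding has_vector_derivative_iff_quotient
    by (intro R.tendsto tendsto_diff h.tendsto Qa)
  then show ?thesis
    unfolding has_vector_derivative_iff_quotient
  proof (rule Lim_transform_eventually)
    show "eventually (\<lambda>x. R ((1 / (x - a)) *\<^sub>R (D x - D a) - h ((1 / (x - a)) *\<^sub>R (M x - M a)) (Q x)) =
        (1 / (x - a)) *\<^sub>R (Q x - Q a)) (at a)"
      using inU by eventually_elim (simp add: diff R.scaleR h.scaleR_left flip: scaleR_diff_right)
  qed
qed

lemma inverse_has_vector_derivative:
  fixes M Q :: "real \<Rightarrow> real^'n^'n"
  assumes U: "open U" "a \<in> U" and MQ: "\<And>x. x \<in> U \<Longrightarrow> M x ** Q x = mat 1"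
    and M: "(M has_vector_derivative M') (at a)"
  shows "(Q has_vector_derivative - (Q a ** M' ** Q a)) (at a)"
proof -
  have QM: "Q a ** M a = mat 1" using MQ[OF U(2)] by (simp add: matrix_left_right_inverse)
  have "(Q has_vector_derivative Q a ** (0 - M' ** Q a)) (at a)"
    by (rule implicit_has_vector_derivative[where h = "(**)" and S = UNIV and U = U and D = "\<lambda>_. mat 1" and M = M])
      (use U MQ M QM in \<open>auto simp: bounded_bilinear_matrix_mult matrix_mul_assoc
        bounded_bilinear.bounded_linear_right[OF bounded_bilinear_matrix_mult]\<close>)
  then show ?thesis by (simp add: matrix_ring_simps)
qed

lemma subspace_symmetric: "subspace {Q :: real^'n^'n. transpose Q = Q}"
  by (rule subspaceI) (simp_all add: transpose_simps)

lemma matrix_inv_eq: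
  fixes M V :: "real^'n^'n"
  assumes "M ** V = mat 1"
  shows "matrix_inv M = V"
proof -
  have VM: "V ** M = mat 1" using assms by (simp add: matrix_left_right_inverse)
  then have "M ** matrix_inv M = mat 1"
    unfolding matrix_inv_def using someI[of "\<lambda>N. M ** N = mat 1 \<and> N ** M = mat 1" V] assms by blast
  then show ?thesis using VM by (metis matrix_mul_assoc matrix_mul_lid matrix_mul_rid)
qed

lemmas has_vector_derivative_matrix_mult =
  bounded_bilinear.has_vector_derivative[OF bounded_bilinear_matrix_mult]

section \<open>Derivatives of \<open>X\<close> and \<open>P\<close> with respect to the
  parameter\<close>

context marginal_pair
begin

text \<open>Differentiating the Lyapunov equation of the inverse \<open>W\<close> gives
  \<open>lyap M W' = W\<close>, so \<open>W'\<close> is negative semidefinite by comparison and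
  \<open>X' = - X W' X\<close> is positive semidefinite.\<close>

lemma X_has_vector_derivative:
  fixes \<gamma> :: real
  assumes g: "\<gamma> > 0"
  obtains X' where "(X has_vector_derivative X') (at \<gamma>)" "psd_matrix X'"
proof -
  let ?M = "\<lambda>s. A - (s / 2) *\<^sub>R mat 1"
  \<comment> \<open>Differentiation needs one function of \<open>s\<close>, whereas
    \<open>inverse_X\<close> supplies inverses for one parameter at a time.\<close>
  define W where "W s = matrix_inv (X s)" for s
  have W: "X s ** W s = mat 1" "W s ** X s = mat 1" "pd_matrix (W s)" "lyap (?M s) (W s) = - G"
    if "s > 0" for s
    using inverse_X[OF that] matrix_inv_eq unfolding W_def by metis+
  have tW: "transpose (W s) = W s" if "s > 0" for s using W(3)[OF that] by (rule pd_symmetric)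
  have inj: "Q = 0" if "lyap (?M \<gamma>) Q = 0" for Q
    using lyap_shift_injective[OF spec, of "\<gamma> / 2" Q] that g by simp
  obtain R where R: "bounded_linear R" "\<And>Q. transpose Q = Q \<Longrightarrow> R (lyap (?M \<gamma>) Q) = Q"
    "\<And>C. transpose C = C \<Longrightarrow> transpose (R C) = R C \<and> lyap (?M \<gamma>) (R C) = C"
    using lyap_symmetric_inverse[OF inj] by blast
  have dM: "(?M has_vector_derivative - ((1 / 2) *\<^sub>R mat 1)) (at \<gamma>)"
    by (auto intro!: derivative_eq_intros simp: has_vector_derivative_def algebra_simps)
  define W' where "W' = R (W \<gamma>)"
  have "(W has_vector_derivative R (0 - lyap (- ((1 / 2) *\<^sub>R mat 1)) (W \<gamma>))) (at \<gamma>)"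
    by (rule implicit_has_vector_derivative[OF bounded_bilinear_lyap R(1) _ subspace_symmetric
          open_greaterThan[of 0] _ _ _ dM has_vector_derivative_const[of "- G"]])
      (use g W R(2) tW in auto)
  then have dW: "(W has_vector_derivative W') (at \<gamma>)"
    by (simp add: W'_def bounded_bilinear.minus_left[OF bounded_bilinear_lyap] lyap_scaled_identity
        del: scaleR_half_double)
  have W': "transpose W' = W'" "lyap (?M \<gamma>) W' = W \<gamma>"
    using R(3)[OF pd_symmetric[OF W(3)[OF g]]] by (simp_all add: W'_def)
  obtain Q where Q: "pd_matrix Q" "pd_matrix (- lyap (?M \<gamma>) Q)"
    using lyap_shift_pd_exists[OF spec, of "\<gamma> / 2"] g by auto
  have "psd_matrix (- W')"
    by (rule lyap_comparison[OF Q])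
      (simp_all add: transpose_simps W' lyap_minus_right pd_imp_psd W(3)[OF g])
  then have "psd_matrix (X \<gamma> ** (- W') ** X \<gamma>)"
    using psd_congruence[of "- W'" "X \<gamma>"] pd_symmetric[OF riccati_X(1)[OF g]] by simp
  moreover have "(X has_vector_derivative - (X \<gamma> ** W' ** X \<gamma>)) (at \<gamma>)"
    by (rule inverse_has_vector_derivative[OF open_greaterThan[of 0] _ _ dW]) (use g W in auto)
  ultimately show thesis using that by (simp add: matrix_ring_simps)
qed

text \<open>The operator for the inverse of \<open>Y\<close> depends on the parameter through
  \<open>X\<close> as well, so the derivative of \<open>X\<close> must be known first.\<close>

lemma P_differentiable:
  fixes \<gamma> :: real
  assumes g: "\<gamma> > 0"
  obtains P' where "(P has_vector_derivative P') (at \<gamma>)"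
proof -
  let ?M = "\<lambda>s. - (A + G ** X s + (s / 2) *\<^sub>R mat 1)"
  obtain X' where X': "(X has_vector_derivative X') (at \<gamma>)" using X_has_vector_derivative[OF g] by blast
  define V where "V s = matrix_inv (Y s)" for s
  have V: "Y s ** V s = mat 1" "V s ** Y s = mat 1" "pd_matrix (V s)" "lyap (?M s) (V s) = - G"
    if "s > 0" for s
    using inverse_Y[OF that] matrix_inv_eq unfolding V_def by metis+
  have tV: "transpose (V s) = V s" if "s > 0" for s using V(3)[OF that] by (rule pd_symmetric)
  obtain W where W: "pd_matrix W" "lyap (A + G ** X \<gamma> + (\<gamma> / 2) *\<^sub>R mat 1) W = (2 * \<gamma>) *\<^sub>R W + G"
    using inverse_X[OF g] by metis
  have neg: "pd_matrix (- lyap (?M \<gamma>) W)"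
    unfolding bounded_bilinear.minus_left[OF bounded_bilinear_lyap] W(2) minus_minus
    using W(1) g by (intro pd_add_psd pd_scaleR psd_gram) auto
  have inj: "Q = 0" if "transpose Q = Q" "lyap (?M \<gamma>) Q = 0" for Q
    by (rule lyap_unique[OF W(1) neg that])
  obtain R where R: "bounded_linear R" "\<And>Q. transpose Q = Q \<Longrightarrow> R (lyap (?M \<gamma>) Q) = Q"
    "\<And>C. transpose C = C \<Longrightarrow> transpose (R C) = R C \<and> lyap (?M \<gamma>) (R C) = C"
    using lyap_symmetric_inverse[of "?M \<gamma>", OF inj] by blast
  have dM: "(?M has_vector_derivative - (0 + (G ** X' + 0 ** X \<gamma>) + (1 / 2) *\<^sub>R mat 1)) (at \<gamma>)"
    by (intro has_vector_derivative_minus has_vector_derivative_add has_vector_derivative_const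
        has_vector_derivative_matrix_mult X')
      (auto intro!: derivative_eq_intros simp: has_vector_derivative_def algebra_simps)
  obtain V' where V': "(V has_vector_derivative V') (at \<gamma>)"
    using implicit_has_vector_derivative[OF bounded_bilinear_lyap R(1) _ subspace_symmetric
          open_greaterThan[of 0] _ _ _ dM has_vector_derivative_const[of "- G"], of V] g V R(2) tV
    by auto
  have "(Y has_vector_derivative - (Y \<gamma> ** V' ** Y \<gamma>)) (at \<gamma>)"
    by (rule inverse_has_vector_derivative[OF open_greaterThan[of 0] _ _ V']) (use g V in auto)
  from has_vector_derivative_diff[OF this X'] show thesis
    using that unfolding P_mat_def by blast
qed

definition "P' \<gamma> = vector_derivative P (at \<gamma>)"

lemma P_has_vector_derivative:
  fixes \<gamma> :: real
  assumes "\<gamma> > 0"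
  shows "(P has_vector_derivative P' \<gamma>) (at \<gamma>)"
proof -
  obtain D where "(P has_vector_derivative D) (at \<gamma>)" by (rule P_differentiable[OF assms])
  then show ?thesis by (simp add: P'_def vector_derivative_at)
qed

text \<open>Differentiating the equation of \<open>P\<close> gives a Lyapunov equation for its derivative.\<close>

lemma psd_P':
  fixes \<gamma> :: real
  assumes g: "\<gamma> > 0"
  shows "psd_matrix (P' \<gamma>)"
proof -
  obtain X' where X': "(X has_vector_derivative X') (at \<gamma>)" "psd_matrix X'"
    using X_has_vector_derivative[OF g] by blast
  note dP = P_has_vector_derivative[OF g]
  have "((\<lambda>s. transpose (P s)) has_vector_derivative transpose (P' \<gamma>)) (at \<gamma>)"
    by (rule bounded_linear.has_vector_derivative[OF bounded_linear_transpose dP])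
  then have "(P has_vector_derivative transpose (P' \<gamma>)) (at \<gamma>)"
    by (rule has_vector_derivative_transform_within_open[OF _ open_greaterThan[of 0]])
      (use g pd_symmetric[OF P_pd] in auto)
  then have sym: "transpose (P' \<gamma>) = P' \<gamma>" using dP vector_derivative_unique_at by blast
  \<comment> \<open>\<open>E\<close> vanishes for all positive \<open>s\<close> by
    \<open>P_equation\<close>; its derivative isolates \<open>lyap\<close> of \<open>P'\<close>
    against three semidefinite terms, one of them containing \<open>X'\<close>.\<close>
  define E where "E s = transpose A ** P s + P s ** A - P s ** G ** P s + s *\<^sub>R P s + (2 * s) *\<^sub>R X s" for s
  let ?E' = "lyap (closed_matrix \<gamma>) (P' \<gamma>) + P \<gamma> + 2 *\<^sub>R X \<gamma> + (2 * \<gamma>) *\<^sub>R X'"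
  have dE: "(E has_vector_derivative
      ((transpose A ** P' \<gamma> + 0 ** P \<gamma>) + (P \<gamma> ** 0 + P' \<gamma> ** A)
        - ((P \<gamma> ** G) ** P' \<gamma> + (P \<gamma> ** 0 + P' \<gamma> ** G) ** P \<gamma>)
        + (\<gamma> *\<^sub>R P' \<gamma> + 1 *\<^sub>R P \<gamma>) + ((2 * \<gamma>) *\<^sub>R X' + 2 *\<^sub>R X \<gamma>))) (at \<gamma>)"
    unfolding E_def
    by (intro has_vector_derivative_add has_vector_derivative_diff has_vector_derivative_matrix_mult
        has_vector_derivative_const has_vector_derivative_scaleR dP X'(1))
      (auto intro!: derivative_eq_intros)
  have eq: "(transpose A ** P' \<gamma> + 0 ** P \<gamma>) + (P \<gamma> ** 0 + P' \<gamma> ** A)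
        - ((P \<gamma> ** G) ** P' \<gamma> + (P \<gamma> ** 0 + P' \<gamma> ** G) ** P \<gamma>)
        + (\<gamma> *\<^sub>R P' \<gamma> + 1 *\<^sub>R P \<gamma>) + ((2 * \<gamma>) *\<^sub>R X' + 2 *\<^sub>R X \<gamma>) = ?E'"
    by (simp add: lyap_closed_matrix[OF g] bounded_bilinear.zero_left[OF bounded_bilinear_matrix_mult]
        bounded_bilinear.zero_right[OF bounded_bilinear_matrix_mult])
  from dE have "(E has_vector_derivative ?E') (at \<gamma>)" unfolding eq .
  moreover have "(E has_vector_derivative 0) (at \<gamma>)"
    by (rule has_vector_derivative_transform_within_open[OF has_vector_derivative_const[of 0] open_greaterThan[of 0]])
      (use g in \<open>auto simp: E_def P_equation\<close>)
  ultimately have "?E' = 0" by (rule vector_derivative_unique_at)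
  then have "- lyap (closed_matrix \<gamma>) (P' \<gamma>) = P \<gamma> + 2 *\<^sub>R X \<gamma> + (2 * \<gamma>) *\<^sub>R X'"
    by (metis (no_types, lifting) add.assoc minus_unique)
  moreover have "psd_matrix (P \<gamma> + 2 *\<^sub>R X \<gamma> + (2 * \<gamma>) *\<^sub>R X')"
    using g by (intro psd_add psd_scaleR X'(2) pd_imp_psd[OF P_pd] pd_imp_psd[OF riccati_X(1)]) auto
  ultimately have "psd_matrix (- lyap (closed_matrix \<gamma>) (P' \<gamma>))" by simp
  then show ?thesis
    by (rule lyap_comparison[OF P_pd[OF g] pd_lyap_closed_matrix_P[OF g] sym])
qed

lemma quadratic_P_has_real_derivative:
  fixes \<gamma> :: real
  assumes "\<gamma> > 0"
  shows "((\<lambda>s. x \<bullet> (P s *v x)) has_real_derivative x \<bullet> (P' \<gamma> *v x)) (at \<gamma>)"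
proof -
  have "bounded_linear (\<lambda>M. x \<bullet> (M *v x))"
    by (rule bounded_linear_compose[OF bounded_linear_inner_right
        bounded_bilinear.bounded_linear_left[OF bounded_bilinear_matrix_vector]])
  from bounded_linear.has_vector_derivative[OF this P_has_vector_derivative[OF assms]]
  show ?thesis by (simp add: has_real_derivative_iff_has_vector_derivative)
qed

lemma quadratic_P_mono:
  fixes \<gamma>1 \<gamma>2 :: real
  assumes "0 < \<gamma>1" "\<gamma>1 \<le> \<gamma>2"
  shows "x \<bullet> (P \<gamma>1 *v x) \<le> x \<bullet> (P \<gamma>2 *v x)"
proof (rule DERIV_nonneg_imp_nondecreasing[OF assms(2)])
  fix s assume "\<gamma>1 \<le> s"
  then show "\<exists>y. ((\<lambda>s. x \<bullet> (P s *v x)) has_real_derivative y) (at s) \<and> 0 \<le> y"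
    using quadratic_P_has_real_derivative[of s x] psd_nonneg[OF psd_P', of s x] assms(1) by force
qed

lemma quadratic_P'_le:
  fixes \<gamma> :: real
  assumes d: "is_delta_c A B d" and "\<gamma> > 0"
  shows "x \<bullet> (P' \<gamma> *v x) \<le> d / (2 * real CARD('n) * \<gamma>) * (x \<bullet> (P \<gamma> *v x))"
proof -
  have "psd_matrix ((d / (2 * real CARD('n) * \<gamma>)) *\<^sub>R P \<gamma> - P' \<gamma>)"
    using d assms(2) by (simp add: is_delta_c_def loewner_le_def P'_def)
  from psd_nonneg[OF this, of x] show ?thesis by (simp add: matrix_vector_simps inner_diff_right)
qed

text \<open>By the defining inequality of \<open>d\<close>, the product of
  \<open>s powr (- d / (2 n))\<close> and the form of \<open>P s\<close> is nonincreasing in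
  \<open>s\<close>.\<close>

lemma quadratic_P_growth:
  fixes \<gamma>1 \<gamma>2 :: real
  assumes d: "is_delta_c A B d" and g: "0 < \<gamma>1" "\<gamma>1 \<le> \<gamma>2"
  shows "x \<bullet> (P \<gamma>2 *v x) \<le> (\<gamma>2 / \<gamma>1) powr (d / (2 * real CARD('n))) * (x \<bullet> (P \<gamma>1 *v x))"
proof -
  define k where "k = d / (2 * real CARD('n))"
  define f where "f s = s powr (-k) * (x \<bullet> (P s *v x))" for s
  have "f \<gamma>2 \<le> f \<gamma>1"
  proof (rule DERIV_nonpos_imp_nonincreasing[OF g(2)])
    fix s assume "\<gamma>1 \<le> s"
    then have s: "s > 0" using g by simp
    have "(f has_real_derivative - k * s powr (- k - 1) * (x \<bullet> (P s *v x)) +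
        (x \<bullet> (P' s *v x)) * s powr (-k)) (at s)"
      unfolding f_def
      by (rule DERIV_mult[OF has_real_derivative_powr[OF s] quadratic_P_has_real_derivative[OF s]])
    moreover have "- k * s powr (- k - 1) * (x \<bullet> (P s *v x)) + (x \<bullet> (P' s *v x)) * s powr (-k) =
        s powr (-k) * ((x \<bullet> (P' s *v x)) - k / s * (x \<bullet> (P s *v x)))"
      using s by (simp add: powr_diff field_simps)
    moreover have "(x \<bullet> (P' s *v x)) - k / s * (x \<bullet> (P s *v x)) \<le> 0"
      using quadratic_P'_le[OF d s, of x] by (simp add: k_def)
    ultimately show "\<exists>y. (f has_real_derivative y) (at s) \<and> y \<le> 0"
      by (metis mult_nonneg_nonpos powr_ge_zero)
  qed
  then have "\<gamma>2 powr k * f \<gamma>2 \<le> \<gamma>2 powr k * f \<gamma>1" by (intro mult_left_mono) auto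
  then show ?thesis
    using g unfolding f_def k_def[symmetric]
    by (simp add: powr_minus powr_divide field_simps)
qed

end

subsection \<open>Differential equations and inequalities\<close>

lemma at_within_half_open:
  fixes t b T :: real
  assumes "t0 \<le> t" "t < b" "b < T"
  shows "at t within {t0..<T} = at t within {t0..b}"
  by (rule at_within_nhd[of _ "{..<b}"]) (use assms in auto)

lemma continuous_on_along:
  assumes "continuous_on (S \<times> UNIV) (\<lambda>(t, x). f t x)" and "continuous_on S g"
  shows "continuous_on S (\<lambda>t. f t (g t))"
  using continuous_on_compose2[OF assms(1), of S "\<lambda>t. (t, g t)"] assms(2)
  by (simp add: continuous_on_Pair continuous_on_id image_subset_iff)

section \<open>Existence of solutions by Picard iteration\<close>

fun picard :: "(real \<Rightarrow> 'a \<Rightarrow> 'a) \<Rightarrow> real \<Rightarrow> 'a \<Rightarrow> nat \<Rightarrow> real \<Rightarrow> 'a::euclidean_space" where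
  "picard f t0 x0 0 t = x0"
| "picard f t0 x0 (Suc k) t = x0 + integral {t0..t} (\<lambda>s. f s (picard f t0 x0 k s))"

text \<open>The weight \<open>exp (2 L (t - t0))\<close> makes the Picard operator a contraction with factor
  \<open>1/2\<close> on every compact interval.\<close>

lemma picard_uniform_limit:
  fixes f :: "real \<Rightarrow> 'a::euclidean_space \<Rightarrow> 'a"
  assumes cont: "continuous_on ({t0..b} \<times> UNIV) (\<lambda>(t, x). f t x)"
    and lip: "\<And>t x y. t \<in> {t0..b} \<Longrightarrow> norm (f t x - f t y) \<le> L * norm (x - y)"
  shows "continuous_on {t0..b} (picard f t0 x0 k)"
    and "uniform_limit {t0..b} (picard f t0 x0)
      (\<lambda>t. x0 + (\<Sum>k. picard f t0 x0 (Suc k) t - picard f t0 x0 k t)) sequentially"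
proof -
  let ?p = "picard f t0 x0"
  have pc: "continuous_on {t0..b} (?p k)" for k
  proof (induction k)
    case (Suc k)
    have "(\<lambda>s. f s (?p k s)) integrable_on {t0..b}"
      by (intro integrable_continuous_real continuous_on_along[OF cont Suc])
    then show ?case
      by (simp add: continuous_on_add indefinite_integral_continuous_1)
  qed simp
  then show "continuous_on {t0..b} (?p k)" .
  define K where "K = max L 1"
  have K: "K > 0" and lipK: "norm (f t x - f t y) \<le> K * norm (x - y)" if "t \<in> {t0..b}" for t x y
    using lip[OF that, of x y] mult_right_mono[of L K "norm (x - y)"] by (auto simp: K_def)
  have "bounded ((\<lambda>t. ?p (Suc 0) t - ?p 0 t) ` {t0..b})"
    by (intro compact_imp_bounded compact_continuous_image continuous_on_diff pc compact_Icc)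
  then obtain M where "\<forall>y\<in>(\<lambda>t. ?p (Suc 0) t - ?p 0 t) ` {t0..b}. norm y \<le> M"
    unfolding bounded_iff by blast
  then have M: "norm (?p (Suc 0) t - ?p 0 t) \<le> M" if "t \<in> {t0..b}" for t using that by blast
  have step: "norm (?p (Suc k) t - ?p k t) \<le> M * (1/2) ^ k * exp (2 * K * (t - t0))"
    if "t \<in> {t0..b}" for k t
    using that
  proof (induction k arbitrary: t)
    case 0
    have "0 \<le> M" using M[OF 0] by (meson norm_ge_zero order_trans)
    moreover have "1 \<le> exp (2 * K * (t - t0))" using 0 K[OF 0] by simp
    ultimately have "M * 1 \<le> M * exp (2 * K * (t - t0))" by (rule mult_left_mono[rotated])
    then show ?case using M[OF 0] by (simp del: picard.simps)
  next
    case (Suc k)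
    have sub: "{t0..t} \<subseteq> {t0..b}" using Suc.prems by auto
    have int: "(\<lambda>s. f s (?p j s)) integrable_on {t0..t}" for j
      by (intro integrable_continuous_real continuous_on_subset[OF continuous_on_along[OF cont pc] sub])
    \<comment> \<open>An antiderivative of \<open>K\<close> times the inductive bound; the rate
      \<open>2 K\<close> in the exponential produces the next factor 1/2.\<close>
    let ?g = "\<lambda>s. M * (1/2) ^ Suc k * exp (2 * K * (s - t0))"
    have "((\<lambda>s. K * (M * (1/2) ^ k * exp (2 * K * (s - t0)))) has_integral ?g t - ?g t0) {t0..t}"
      using Suc.prems
      by (intro fundamental_theorem_of_calculus)
        (auto intro!: derivative_eq_intros simp flip: has_real_derivative_iff_has_vector_derivative)
    note g = has_integral_integrable[OF this] integral_unique[OF this]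
    have "?p (Suc (Suc k)) t - ?p (Suc k) t = integral {t0..t} (\<lambda>s. f s (?p (Suc k) s) - f s (?p k s))"
      unfolding picard.simps(2)[of f t0 x0 "Suc k"] picard.simps(2)[of f t0 x0 k t]
        Henstock_Kurzweil_Integration.integral_diff[OF int int] by simp
    also have "norm \<dots> \<le> ?g t - ?g t0"
      unfolding g(2)[symmetric]
    proof (rule integral_norm_bound_integral[OF integrable_diff[OF int int] g(1)])
      fix s assume "s \<in> {t0..t}"
      then have s: "s \<in> {t0..b}" using sub by blast
      have "norm (f s (?p (Suc k) s) - f s (?p k s)) \<le> K * norm (?p (Suc k) s - ?p k s)" by (rule lipK[OF s])
      also have "\<dots> \<le> K * (M * (1/2) ^ k * exp (2 * K * (s - t0)))"
        using K[OF s] Suc.IH[OF s] by (intro mult_left_mono) auto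
      finally show "norm (f s (?p (Suc k) s) - f s (?p k s)) \<le> K * (M * (1/2) ^ k * exp (2 * K * (s - t0)))" .
    qed
    also have "\<dots> \<le> ?g t"
    proof -
      have "0 \<le> M" using M[OF Suc.prems] by (meson norm_ge_zero order_trans)
      then show ?thesis by simp
    qed
    finally show ?case .
  qed
  have "norm (?p (Suc k) t - ?p k t) \<le> M * exp (2 * K * (b - t0)) * (1/2) ^ k" if t: "t \<in> {t0..b}" for k t
  proof -
    have "0 \<le> M" using M[OF t] by (meson norm_ge_zero order_trans)
    moreover have "exp (2 * K * (t - t0)) \<le> exp (2 * K * (b - t0))" using K[OF t] t by simp
    ultimately have "M * (1/2) ^ k * exp (2 * K * (t - t0)) \<le> M * (1/2) ^ k * exp (2 * K * (b - t0))"
      by (intro mult_left_mono) auto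
    then show ?thesis using step[OF t, of k] by (simp add: mult_ac)
  qed
  moreover have "summable (\<lambda>k. M * exp (2 * K * (b - t0)) * (1/2) ^ k)"
    by (intro summable_mult summable_geometric) simp
  ultimately have "uniform_limit {t0..b} (\<lambda>n t. \<Sum>k<n. ?p (Suc k) t - ?p k t)
      (\<lambda>t. \<Sum>k. ?p (Suc k) t - ?p k t) sequentially"
    by (rule Weierstrass_m_test)
  then have "uniform_limit {t0..b} (\<lambda>n t. x0 + (\<Sum>k<n. ?p (Suc k) t - ?p k t))
      (\<lambda>t. x0 + (\<Sum>k. ?p (Suc k) t - ?p k t)) sequentially"
    by (intro uniform_limit_add uniform_limit_const)
  moreover have "x0 + (\<Sum>k<n. ?p (Suc k) t - ?p k t) = ?p n t" for n t
    using sum_lessThan_telescope[of "\<lambda>k. ?p k t" n] by (simp only: picard.simps(1)) simp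
  ultimately show "uniform_limit {t0..b} ?p (\<lambda>t. x0 + (\<Sum>k. ?p (Suc k) t - ?p k t)) sequentially" by simp
qed

text \<open>The Lipschitz constant may blow up as \<open>b\<close> approaches \<open>T\<close>. The
  limit is therefore defined once, pointwise on the whole interval, and uniform convergence is used
  only on compact subintervals; no gluing of local solutions arises.\<close>

lemma lipschitz_solution_exists:
  fixes f :: "real \<Rightarrow> real^'n \<Rightarrow> real^'n"
  assumes "t0 < T"
    and cont: "\<And>b. t0 \<le> b \<Longrightarrow> b < T \<Longrightarrow> continuous_on ({t0..b} \<times> UNIV) (\<lambda>(t, x). f t x)"
    and lip: "\<And>b. t0 \<le> b \<Longrightarrow> b < T \<Longrightarrow>
      \<exists>L. \<forall>t\<in>{t0..b}. \<forall>x y. norm (f t x - f t y) \<le> L * norm (x - y)"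
  shows "\<exists>x. solution_from f t0 T x0 x"
proof -
  let ?p = "picard f t0 x0"
  define x where "x t = x0 + (\<Sum>k. ?p (Suc k) t - ?p k t)" for t
  have lim: "uniform_limit {t0..b} ?p x sequentially" and pc: "continuous_on {t0..b} (?p k)"
    if b: "t0 \<le> b" "b < T" for b k
  proof -
    obtain L where L: "\<And>t x y. t \<in> {t0..b} \<Longrightarrow> norm (f t x - f t y) \<le> L * norm (x - y)"
      using lip[OF b] by blast
    show "uniform_limit {t0..b} ?p x sequentially"
      using picard_uniform_limit(2)[OF cont[OF b] L] unfolding x_def by blast
    show "continuous_on {t0..b} (?p k)"
      using picard_uniform_limit(1)[OF cont[OF b] L] by blast
  qed
  have xc: "continuous_on {t0..b} x" if b: "t0 \<le> b" "b < T" for b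
    by (rule uniform_limit_theorem[OF _ lim[OF b]]) (simp_all add: pc[OF b])
  have eq: "x t = x0 + integral {t0..t} (\<lambda>s. f s (x s))" if t: "t0 \<le> t" "t < T" for t
  proof -
    obtain L where L: "\<And>s x y. s \<in> {t0..t} \<Longrightarrow> norm (f s x - f s y) \<le> L * norm (x - y)"
      using lip[OF t] by blast
    have "uniform_limit {t0..t} (\<lambda>n s. f s (?p n s)) (\<lambda>s. f s (x s)) sequentially"
    proof (rule uniform_limitI)
      fix e :: real assume "e > 0"
      define d where "d = e / (\<bar>L\<bar> + 1)"
      have "d > 0" using \<open>e > 0\<close> by (simp add: d_def)
      from uniform_limitD[OF lim[OF t] this]
      show "\<forall>\<^sub>F n in sequentially. \<forall>s\<in>{t0..t}. dist (f s (?p n s)) (f s (x s)) < e"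
      proof eventually_elim
        case (elim n)
        show ?case
        proof
          fix s assume s: "s \<in> {t0..t}"
          have "norm (f s (?p n s) - f s (x s)) \<le> L * norm (?p n s - x s)" by (rule L[OF s])
          also have "\<dots> \<le> (\<bar>L\<bar> + 1) * norm (?p n s - x s)" by (intro mult_right_mono) auto
          also have "\<dots> < (\<bar>L\<bar> + 1) * d"
            using elim s by (intro mult_strict_left_mono) (auto simp: dist_norm)
          also have "\<dots> = e" by (simp add: d_def)
          finally show "dist (f s (?p n s)) (f s (x s)) < e" by (simp add: dist_norm)
        qed
      qed
    qed
    from uniform_limit_integral[OF this continuous_on_along[OF cont[OF t] pc[OF t]] sequentially_bot]
    obtain I J where IJ: "\<And>n. ((\<lambda>s. f s (?p n s)) has_integral I n) {t0..t}"
      "((\<lambda>s. f s (x s)) has_integral J) {t0..t}" "I \<longlonglongrightarrow> J"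
      by blast
    have "(\<lambda>n. ?p (Suc n) t) \<longlonglongrightarrow> x t"
      using LIMSEQ_Suc[OF tendsto_uniform_limitI[OF lim[OF t]]] t by auto
    moreover have "?p (Suc n) t = x0 + I n" for n using integral_unique[OF IJ(1)] by simp
    ultimately have "(\<lambda>n. x0 + I n) \<longlonglongrightarrow> x t" by simp
    moreover have "(\<lambda>n. x0 + I n) \<longlonglongrightarrow> x0 + J" by (intro tendsto_intros IJ)
    ultimately have "x t = x0 + J" using LIMSEQ_unique by blast
    then show ?thesis using integral_unique[OF IJ(2)] by simp
  qed
  have "(x has_vector_derivative f t (x t)) (at t within {t0..<T})" if t: "t \<in> {t0..<T}" for t
  proof -
    define b where "b = (t + T) / 2"
    have b: "t < b" "b < T" "t0 \<le> b" using t by (auto simp: b_def)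
    have "((\<lambda>t. x0 + integral {t0..t} (\<lambda>s. f s (x s))) has_vector_derivative 0 + f t (x t))
        (at t within {t0..b})"
      using t b by (intro has_vector_derivative_add has_vector_derivative_const
          integral_has_vector_derivative continuous_on_along[OF cont[OF b(3,2)] xc[OF b(3,2)]]) auto
    then have "(x has_vector_derivative f t (x t)) (at t within {t0..b})"
      unfolding add_0
      by (rule has_vector_derivative_transform_within[OF _ zero_less_one])
        (use t b in \<open>auto simp: eq[symmetric]\<close>)
    then show ?thesis using t b by (subst at_within_half_open[of t0 t b T]) auto
  qed
  moreover have "x t0 = x0" using eq[of t0] \<open>t0 < T\<close> by simp
  ultimately show ?thesis by (auto simp: solution_from_def)
qed

section \<open>Growth and decay estimates from differential inequalities\<close>

lemma derivative_nonneg_imp_le: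
  fixes g :: "real \<Rightarrow> real"
  assumes d: "\<And>s. s \<in> {t0..<T} \<Longrightarrow> (g has_real_derivative g' s) (at s within {t0..<T})"
    and nonneg: "\<And>s. s \<in> {t0..<T} \<Longrightarrow> 0 \<le> g' s"
    and t: "t0 \<le> t" "t < T"
  shows "g t0 \<le> g t"
proof (rule DERIV_nonneg_imp_increasing_open[OF t(1)])
  fix s assume s: "t0 < s" "s < t"
  then have "at s within {t0..<T} = at s" using t by (intro at_within_interior) auto
  then show "\<exists>y. (g has_real_derivative y) (at s) \<and> 0 \<le> y"
    using d[of s] nonneg[of s] s t by auto
next
  have "continuous_on {t0..<T} g" using d DERIV_continuous continuous_on_eq_continuous_within by blast
  then show "continuous_on {t0..t} g" by (rule continuous_on_subset) (use t in auto)
qed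

text \<open>The squared norm decays at most like \<open>exp (- 2 L s)\<close> on a compact interval,
  so it cannot reach 0 before \<open>T\<close>.\<close>

lemma solution_nonzero:
  fixes f :: "real \<Rightarrow> real^'n \<Rightarrow> real^'n"
  assumes sol: "solution_from f t0 T x0 x" and "x0 \<noteq> 0" and t: "t \<in> {t0..<T}"
    and lin: "\<And>b. t0 \<le> b \<Longrightarrow> b < T \<Longrightarrow> \<exists>L. \<forall>s\<in>{t0..b}. \<forall>y. norm (f s y) \<le> L * norm y"
  shows "x t \<noteq> 0"
proof -
  define b where "b = (t + T) / 2"
  have b: "t0 \<le> b" "b < T" "t < b" using t by (auto simp: b_def)
  obtain L where L: "\<And>s y. s \<in> {t0..b} \<Longrightarrow> norm (f s y) \<le> L * norm y" using lin[OF b(1,2)] by blast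
  define g where "g s = exp (2 * L * s) * (x s \<bullet> x s)" for s
  define g' where "g' s = exp (2 * L * s) * (2 * (x s \<bullet> f s (x s)) + 2 * L * (x s \<bullet> x s))" for s
  have "g t0 \<le> g t"
  proof (rule derivative_nonneg_imp_le[of t0 b g g' t])
    fix s assume s: "s \<in> {t0..<b}"
    have dx: "(x has_vector_derivative f s (x s)) (at s within {t0..<b})"
      using sol s b has_vector_derivative_within_subset[of x _ s "{t0..<T}" "{t0..<b}"]
      by (auto simp: solution_from_def)
    have "((\<lambda>s. x s \<bullet> x s) has_real_derivative x s \<bullet> f s (x s) + f s (x s) \<bullet> x s) (at s within {t0..<b})"
      using bounded_bilinear.has_vector_derivative[OF bounded_bilinear_inner dx dx]
      by (simp add: has_real_derivative_iff_has_vector_derivative)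
    then show "(g has_real_derivative g' s) (at s within {t0..<b})"
      unfolding g_def g'_def
      by (auto intro!: derivative_eq_intros simp: algebra_simps inner_commute)
    have "- (x s \<bullet> f s (x s)) \<le> norm (x s) * norm (f s (x s))"
      using Cauchy_Schwarz_ineq2[of "x s" "f s (x s)"] by linarith
    also have "\<dots> \<le> norm (x s) * (L * norm (x s))" using L[of s "x s"] s by (intro mult_left_mono) auto
    also have "\<dots> = L * (x s \<bullet> x s)" by (simp add: dot_square_norm power2_eq_square)
    finally show "0 \<le> g' s" by (simp add: g'_def)
  qed (use t b in auto)
  moreover have "g t0 > 0" using sol \<open>x0 \<noteq> 0\<close> by (simp add: g_def solution_from_def)
  ultimately show ?thesis by (auto simp: g_def)
qed

text \<open>The integrating factor \<open>(T - s) powr (- k)\<close> makes the product with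
  \<open>V\<close> nondecreasing. The sign of \<open>V\<close> is left free so that the upper bound
  follows by passing to \<open>- V\<close>.\<close>

lemma powr_rate_lower_bound:
  fixes V :: "real \<Rightarrow> real"
  assumes d: "\<And>s. s \<in> {t0..<T} \<Longrightarrow> (V has_real_derivative V' s) (at s within {t0..<T})"
    and rate: "\<And>s. s \<in> {t0..<T} \<Longrightarrow> - (k / (T - s)) * V s \<le> V' s"
    and t: "t0 \<le> t" "t < T"
  shows "((T - t) / (T - t0)) powr k * V t0 \<le> V t"
proof -
  define g where "g s = (T - s) powr (-k) * V s" for s
  define g' where "g' s = (T - s) powr (-k) * (k / (T - s) * V s + V' s)" for s
  have "g t0 \<le> g t"
  proof (rule derivative_nonneg_imp_le[OF _ _ t, where g' = g'])
    fix s assume s: "s \<in> {t0..<T}"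
    have "((\<lambda>s. (T - s) powr (-k)) has_real_derivative k * (T - s) powr (- k - 1)) (at s within {t0..<T})"
      using s by (auto intro!: derivative_eq_intros simp: powr_diff field_simps)
    from DERIV_mult[OF this d[OF s]]
    show "(g has_real_derivative g' s) (at s within {t0..<T})"
      unfolding g_def g'_def using s by (simp add: powr_diff algebra_simps)
    show "0 \<le> g' s" using rate[OF s] by (simp add: g'_def)
  qed
  then have "(T - t) powr k * g t0 \<le> (T - t) powr k * g t" by (intro mult_left_mono) auto
  moreover have "(T - t) powr k * g t = V t" using t by (simp add: g_def powr_minus)
  moreover have "(T - t) powr k * g t0 = ((T - t) / (T - t0)) powr k * V t0"
    using t powr_divide[of "T - t" "T - t0" k] by (simp add: g_def powr_minus divide_inverse)
  ultimately show ?thesis by simp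
qed

lemma powr_rate_upper_bound:
  fixes V :: "real \<Rightarrow> real"
  assumes d: "\<And>s. s \<in> {t0..<T} \<Longrightarrow> (V has_real_derivative V' s) (at s within {t0..<T})"
    and rate: "\<And>s. s \<in> {t0..<T} \<Longrightarrow> V' s \<le> - (k / (T - s)) * V s"
    and t: "t0 \<le> t" "t < T"
  shows "V t \<le> ((T - t) / (T - t0)) powr k * V t0"
proof -
  have "((T - t) / (T - t0)) powr k * - V t0 \<le> - V t"
  proof (rule powr_rate_lower_bound[OF _ _ t])
    fix s assume s: "s \<in> {t0..<T}"
    show "((\<lambda>s. - V s) has_real_derivative - V' s) (at s within {t0..<T})"
      by (rule DERIV_minus[OF d[OF s]])
    show "- (k / (T - s)) * - V s \<le> - V' s" using rate[OF s] by simp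
  qed
  then show ?thesis by simp
qed

text \<open>At the last time where \<open>V \<le> c\<close> the derivative of \<open>V\<close> would be negative.\<close>

lemma sublevel_invariant:
  fixes V :: "real \<Rightarrow> real"
  assumes d: "\<And>s. s \<in> {t0..<T} \<Longrightarrow> (V has_real_derivative V' s) (at s within {t0..<T})"
    and neg: "\<And>s. s \<in> {t0..<T} \<Longrightarrow> V s = c \<Longrightarrow> V' s < 0"
    and init: "V t0 \<le> c" and t: "t0 \<le> t" "t < T"
  shows "V t \<le> c"
proof (rule ccontr)
  assume Vt: "\<not> V t \<le> c"
  have cont: "continuous_on {t0..<T} V" using d DERIV_continuous continuous_on_eq_continuous_within by blast
  then have ct: "continuous_on {t0..t} V" by (rule continuous_on_subset) (use t in auto)
  define S where "S = {s \<in> {t0..t}. V s \<le> c}"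
  have "closed S"
    unfolding S_def by (intro continuous_on_closed_Collect_le closed_atLeastAtMost ct continuous_on_const)
  moreover have "bounded S"
    by (rule bounded_subset[OF bounded_closed_interval[of t0 t]]) (auto simp: S_def)
  ultimately have "compact S" by (simp add: compact_eq_bounded_closed)
  moreover have "t0 \<in> S" using init t by (simp add: S_def)
  ultimately obtain m where m: "m \<in> S" "\<And>s. s \<in> S \<Longrightarrow> s \<le> m"
    using compact_attains_sup[of S] by blast
  have mt: "t0 \<le> m" "m < t" "V m \<le> c" using m(1) Vt by (auto simp: S_def less_le)
  have above: "V s > c" if "m < s" "s \<le> t" for s
    using m(2)[of s] that mt by (force simp: S_def)
  have m_in: "m \<in> {t0..<T}" using mt t by simp
  have "V m = c"
  proof (rule ccontr)
    assume "V m \<noteq> c"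
    moreover have "continuous_on {m..t} V" by (rule continuous_on_subset[OF ct]) (use mt in auto)
    ultimately obtain s where "m \<le> s" "s \<le> t" "V s = c"
      using IVT'[of V m c t] mt Vt by auto
    then show False using above[of s] \<open>V m \<noteq> c\<close> by (cases "s = m") auto
  qed
  from has_real_derivative_neg_dec_right[OF d[OF m_in] neg[OF m_in this]]
  obtain e where e: "e > 0" "\<And>h. h > 0 \<Longrightarrow> m + h \<in> {t0..<T} \<Longrightarrow> h < e \<Longrightarrow> V (m + h) < V m" by blast
  define h where "h = min (e / 2) (t - m)"
  have "h > 0" "h < e" "m + h \<le> t" using e(1) mt by (auto simp: h_def)
  then show False using e(2)[of h] above[of "m + h"] mt t by auto
qed

subsection \<open>The saturated closed loop\<close>

lemma saturation_nonexpansive: "norm (saturation u - saturation v) \<le> norm (u - v)"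
  by (rule norm_le_componentwise_cart) (auto simp: saturation_def sgn_if min_def abs_if)

lemma saturation_0 [simp]: "saturation 0 = 0"
  by (simp add: saturation_def vec_eq_iff)

lemma norm_saturation_le: "norm (saturation u) \<le> norm u"
  using saturation_nonexpansive[of u 0] by simp

lemma continuous_on_saturation: "continuous_on S saturation"
  by (rule lipschitz_on_continuous_on[of 1])
    (simp add: lipschitz_on_def dist_norm saturation_nonexpansive)

text \<open>In each component, \<open>c \<ge> 1/2\<close> handles the unsaturated case and
  \<open>norm p \<le> 2\<close> the saturated one: both give at least half of the modulus of
  \<open>p $ i\<close>.\<close>

lemma inner_saturation_upper:
  fixes p :: "real^'m"
  assumes c: "c \<ge> 1/2" and "norm p \<le> 2"
  shows "2 * (p \<bullet> saturation ((- c) *\<^sub>R p)) \<le> - (p \<bullet> p)"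
proof -
  have "2 * (p $ i * saturation ((- c) *\<^sub>R p) $ i) \<le> - (p $ i * p $ i)" for i
  proof -
    have "\<bar>p $ i\<bar> / 2 \<le> 1" using component_le_norm_cart[of p i] assms(2) by linarith
    moreover have "1/2 * \<bar>p $ i\<bar> \<le> c * \<bar>p $ i\<bar>" using c by (intro mult_right_mono) auto
    ultimately have "\<bar>p $ i\<bar> / 2 \<le> min (c * \<bar>p $ i\<bar>) 1" by simp
    then have "\<bar>p $ i\<bar> * (\<bar>p $ i\<bar> / 2) \<le> \<bar>p $ i\<bar> * min (c * \<bar>p $ i\<bar>) 1"
      by (intro mult_left_mono) auto
    moreover have "saturation ((- c) *\<^sub>R p) $ i = - (sgn (p $ i) * min (c * \<bar>p $ i\<bar>) 1)"
      using c by (simp add: saturation_def sgn_mult abs_mult)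
    then have "p $ i * saturation ((- c) *\<^sub>R p) $ i = - ((p $ i * sgn (p $ i)) * min (c * \<bar>p $ i\<bar>) 1)"
      by simp
    then have "p $ i * saturation ((- c) *\<^sub>R p) $ i = - (\<bar>p $ i\<bar> * min (c * \<bar>p $ i\<bar>) 1)"
      by (simp only: abs_sgn[symmetric])
    ultimately show ?thesis by simp
  qed
  then have "(\<Sum>i\<in>UNIV. 2 * (p $ i * saturation ((- c) *\<^sub>R p) $ i)) \<le> (\<Sum>i\<in>UNIV. - (p $ i * p $ i))"
    by (rule sum_mono)
  then show ?thesis by (simp add: inner_vec_def sum_distrib_left sum_negf)
qed

lemma inner_saturation_lower:
  fixes p :: "real^'m"
  assumes "c \<ge> 0"
  shows "- (2 * c * (p \<bullet> p)) \<le> 2 * (p \<bullet> saturation ((- c) *\<^sub>R p))"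
proof -
  have "- (p \<bullet> saturation ((- c) *\<^sub>R p)) \<le> norm p * norm (saturation ((- c) *\<^sub>R p))"
    using Cauchy_Schwarz_ineq2[of p "saturation ((- c) *\<^sub>R p)"] by linarith
  also have "\<dots> \<le> norm p * norm ((- c) *\<^sub>R p)"
    by (intro mult_left_mono norm_saturation_le) auto
  also have "\<dots> = c * (p \<bullet> p)" using assms by (simp add: dot_square_norm power2_eq_square)
  finally show ?thesis by simp
qed

locale saturated_loop = marginal_pair A B for A :: "real^'n^'n" and B :: "real^'m^'n" +
  fixes T \<gamma>0 \<eta> d :: real
  assumes \<gamma>0: "\<gamma>0 > 0" and T: "T > 0" and \<eta>: "\<eta> \<ge> 0" and d: "is_delta_c A B d"
begin

abbreviation "\<gamma> \<equiv> gain_param T \<gamma>0"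
abbreviation "f \<equiv> closed_loop A B T \<gamma>0 \<eta>"

lemma \<gamma>_ge: "0 \<le> t \<Longrightarrow> t < T \<Longrightarrow> \<gamma>0 \<le> \<gamma> t"
  using \<gamma>0 T by (simp add: gain_param_def pos_le_divide_eq)

lemma \<gamma>_pos: "0 \<le> t \<Longrightarrow> t < T \<Longrightarrow> 0 < \<gamma> t"
  using \<gamma>_ge \<gamma>0 by fastforce

text \<open>The parameter grows at the relative rate \<open>1 / (T - t)\<close>, the same order as
  \<open>\<gamma>\<close> itself; hence every term of the energy balance scales alike.\<close>

lemma \<gamma>_derivative:
  assumes "t < T"
  shows "(\<gamma> has_real_derivative \<gamma> t / (T - t)) (at t within S)"
  unfolding gain_param_def using assms
  by (auto intro!: derivative_eq_intros simp: field_simps power2_eq_square)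

lemma P\<gamma>_derivative:
  assumes "0 \<le> t" "t < T"
  shows "((\<lambda>t. P (\<gamma> t)) has_vector_derivative (\<gamma> t / (T - t)) *\<^sub>R P' (\<gamma> t)) (at t within S)"
  using vector_diff_chain_within[of \<gamma> "\<gamma> t / (T - t)" t S P "P' (\<gamma> t)"]
    \<gamma>_derivative[OF assms(2), of S] P_has_vector_derivative[OF \<gamma>_pos[OF assms]]
  by (simp add: o_def has_real_derivative_iff_has_vector_derivative has_vector_derivative_at_within)

lemma P\<gamma>_continuous: "b < T \<Longrightarrow> 0 \<le> t0 \<Longrightarrow> continuous_on {t0..b} (\<lambda>t. P (\<gamma> t))"
  unfolding continuous_on_eq_continuous_within
  by (intro ballI has_vector_derivative_continuous[OF P\<gamma>_derivative]) auto

lemma closed_loop_0 [simp]: "f t 0 = 0"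
  by (simp add: closed_loop_def feedback_def)

text \<open>The gain is bounded on each compact subinterval although it may diverge at
  \<open>T\<close>, and saturation does not increase distances.\<close>

lemma closed_loop_lipschitz:
  assumes "0 \<le> t0" "b < T"
  shows "\<exists>L. \<forall>t\<in>{t0..b}. \<forall>x y. norm (f t x - f t y) \<le> L * norm (x - y)"
proof -
  have "bounded ((\<lambda>t. P (\<gamma> t)) ` {t0..b})"
    by (intro compact_imp_bounded compact_continuous_image P\<gamma>_continuous assms compact_Icc)
  then obtain M where M: "\<And>t. t \<in> {t0..b} \<Longrightarrow> norm (P (\<gamma> t)) \<le> M"
    unfolding bounded_iff by blast
  obtain K where K: "K \<ge> 0" "\<And>(M :: real^'n^'n) x. norm (M *v x) \<le> norm M * norm x * K"
    using bounded_bilinear.nonneg_bounded[OF bounded_bilinear_matrix_vector] by blast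
  define a b' c where "a = onorm ((*v) A)" and "b' = onorm ((*v) B)" and "c = onorm ((*v) (transpose B))"
  have pos: "a \<ge> 0" "b' \<ge> 0" "c \<ge> 0" by (simp_all add: a_def b'_def c_def onorm_pos_le)
  have "norm (f t x - f t y) \<le> (a + b' * ((1/2 + \<eta>) * (c * (M * K)))) * norm (x - y)"
    if t: "t \<in> {t0..b}" for t x y
  proof -
    let ?u = "feedback A B T \<gamma>0 \<eta> t"
    have "f t x - f t y = A *v (x - y) + B *v (saturation (?u x) - saturation (?u y))"
      by (simp add: closed_loop_def matrix_vector_mult_diff_distrib)
    then have "norm (f t x - f t y) \<le> a * norm (x - y) + b' * norm (saturation (?u x) - saturation (?u y))"
      unfolding a_def b'_def by (metis add_mono norm_triangle_le onorm matrix_vector_mul_bounded_linear)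
    moreover have "norm (?u x - ?u y) \<le> (1/2 + \<eta>) * (c * (M * K)) * norm (x - y)"
    proof -
      have "?u x - ?u y = (- (1/2 + \<eta>)) *\<^sub>R (transpose B *v (P (\<gamma> t) *v (x - y)))"
        by (simp only: feedback_def matrix_vector_mult_diff_distrib scaleR_diff_right)
      then have "norm (?u x - ?u y) = (1/2 + \<eta>) * norm (transpose B *v (P (\<gamma> t) *v (x - y)))"
        using \<eta> by simp
      moreover have "norm (P (\<gamma> t) *v (x - y)) \<le> M * norm (x - y) * K"
        using K(2)[of "P (\<gamma> t)" "x - y"] M[OF t] K(1)
        by (meson mult_right_mono norm_ge_zero order_trans)
      then have "c * norm (P (\<gamma> t) *v (x - y)) \<le> c * (M * norm (x - y) * K)"
        using pos by (intro mult_left_mono)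
      then have "norm (transpose B *v (P (\<gamma> t) *v (x - y))) \<le> c * (M * norm (x - y) * K)"
        unfolding c_def using onorm[OF matrix_vector_mul_bounded_linear] order_trans by blast
      then have "(1/2 + \<eta>) * norm (transpose B *v (P (\<gamma> t) *v (x - y))) \<le> (1/2 + \<eta>) * (c * (M * norm (x - y) * K))"
        using \<eta> by (intro mult_left_mono) auto
      ultimately show ?thesis by (simp add: mult_ac)
    qed
    then have "b' * norm (saturation (?u x) - saturation (?u y)) \<le> b' * ((1/2 + \<eta>) * (c * (M * K)) * norm (x - y))"
      using saturation_nonexpansive[of "?u x" "?u y"] pos by (intro mult_left_mono) auto
    ultimately show ?thesis by (simp add: distrib_right mult.assoc)
  qed
  then show ?thesis by blast
qed

lemma closed_loop_continuous:
  assumes "0 \<le> t0" "b < T"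
  shows "continuous_on ({t0..b} \<times> UNIV) (\<lambda>(t, x). f t x)"
proof -
  have "continuous_on ({t0..b} \<times> UNIV) (\<lambda>z. P (\<gamma> (fst z)))"
    by (rule continuous_on_compose2[OF P\<gamma>_continuous[OF assms(2,1)] continuous_on_fst]) auto
  then have "continuous_on ({t0..b} \<times> UNIV) (\<lambda>z. P (\<gamma> (fst z)) *v snd z)"
    by (intro bounded_bilinear.continuous_on[OF bounded_bilinear_matrix_vector] continuous_on_snd) auto
  then have "continuous_on ({t0..b} \<times> UNIV) (\<lambda>z. feedback A B T \<gamma>0 \<eta> (fst z) (snd z))"
    unfolding feedback_def
    by (intro continuous_on_scaleR continuous_on_const
        bounded_linear.continuous_on[OF matrix_vector_mul_bounded_linear])
  then have "continuous_on ({t0..b} \<times> UNIV) (\<lambda>z. saturation (feedback A B T \<gamma>0 \<eta> (fst z) (snd z)))"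
    by (rule continuous_on_compose2[OF continuous_on_saturation[of UNIV]]) auto
  then show ?thesis
    unfolding closed_loop_def case_prod_beta
    by (intro continuous_on_add bounded_linear.continuous_on[OF matrix_vector_mul_bounded_linear]
        continuous_on_snd continuous_on_id)
qed

lemma solution_exists:
  assumes "0 \<le> t0" "t0 < T"
  shows "\<exists>x. solution_from f t0 T x0 x"
  using assms by (intro lipschitz_solution_exists closed_loop_continuous closed_loop_lipschitz)

lemma closed_loop_solution_nonzero:
  assumes "solution_from f 0 T x0 x" "x0 \<noteq> 0" "t \<in> {0..<T}"
  shows "x t \<noteq> 0"
proof (rule solution_nonzero[OF assms])
  fix b assume "0 \<le> b" "b < T"
  then obtain L where "\<forall>t\<in>{0..b}. \<forall>x y. norm (f t x - f t y) \<le> L * norm (x - y)"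
    using closed_loop_lipschitz[of 0 b] by auto
  then have "\<forall>s\<in>{0..b}. \<forall>y. norm (f s y) \<le> L * norm y" by (metis closed_loop_0 diff_zero)
  then show "\<exists>L. \<forall>s\<in>{0..b}. \<forall>y. norm (f s y) \<le> L * norm y" by blast
qed

section \<open>Energy estimates along the closed loop\<close>

definition energy_rate :: "real \<Rightarrow> real^'n \<Rightarrow> real" where
  "energy_rate t x = 2 * (x \<bullet> (P (\<gamma> t) *v f t x))"

text \<open>\<open>P_equation\<close> eliminates \<open>A\<close>. The only positive contribution is
  \<open>p \<bullet> p\<close>, which the saturated input has to compensate.\<close>

lemma energy_rate_eq:
  fixes x :: "real^'n"
  assumes t: "0 \<le> t" "t < T"
  defines "p \<equiv> transpose B *v (P (\<gamma> t) *v x)"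
  shows "energy_rate t x = p \<bullet> p - \<gamma> t * (x \<bullet> (P (\<gamma> t) *v x)) - 2 * \<gamma> t * (x \<bullet> (X (\<gamma> t) *v x))
    + 2 * (p \<bullet> saturation ((- (1/2 + \<eta>)) *\<^sub>R p))"
proof -
  let ?g = "\<gamma> t"
  have tP: "transpose (P ?g) = P ?g" using P_pd[OF \<gamma>_pos[OF t]] by (rule pd_symmetric)
  have Px: "x \<bullet> (P ?g *v y) = (P ?g *v x) \<bullet> y" for y using inner_symmetric_mult[OF tP] by simp
  have "x \<bullet> ((transpose A ** P ?g + P ?g ** A) *v x) = 2 * (x \<bullet> (P ?g *v (A *v x)))"
    using inner_transpose_mult[of A "P ?g *v x" x]
    by (simp add: matrix_vector_simps inner_add_right Px inner_commute)
  moreover have "x \<bullet> ((P ?g ** G ** P ?g) *v x) = p \<bullet> p"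
    using inner_transpose_mult[of B "P ?g *v x"] by (simp add: matrix_vector_simps Px p_def)
  moreover have "f t x = A *v x + B *v saturation ((- (1/2 + \<eta>)) *\<^sub>R p)"
    by (simp add: closed_loop_def feedback_def p_def)
  moreover have "x \<bullet> (P ?g *v (B *v v)) = p \<bullet> v" for v
    by (simp add: Px p_def inner_transpose_mult)
  ultimately show ?thesis
    unfolding energy_rate_def P_equation[OF \<gamma>_pos[OF t]]
    by (simp add: matrix_vector_simps inner_add_right inner_diff_right)
qed

text \<open>Its sublevel set at level 4 is \<open>ellipsoid A B (\<gamma> t)\<close>.\<close>

definition energy :: "real \<Rightarrow> real^'n \<Rightarrow> real" where
  "energy t x = 2 * real CARD('n) * \<gamma> t * (x \<bullet> (P (\<gamma> t) *v x))"

lemma norm_BP_le_energy: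
  "0 \<le> t \<Longrightarrow> t < T \<Longrightarrow> (norm (transpose B *v (P (\<gamma> t) *v x)))\<^sup>2 \<le> energy t x"
  using norm_BP_bound[OF \<gamma>_pos, of t x] by (simp add: energy_def)

text \<open>The trace identity \<open>tr (B\<^sup>T P B) = 2 n \<gamma>\<close> keeps every component of \<open>B\<^sup>T P x\<close> below 2 on the
  ellipsoid, so that there the saturated input is at least as effective as the input
  \<open>- B\<^sup>T P x / 2\<close>, which is not saturated.\<close>

lemma energy_rate_upper:
  assumes t: "0 \<le> t" "t < T" and "energy t x \<le> 4"
  shows "energy_rate t x \<le> - \<gamma> t * (x \<bullet> (P (\<gamma> t) *v x))"
proof -
  let ?p = "transpose B *v (P (\<gamma> t) *v x)"
  have "(norm ?p)\<^sup>2 \<le> 2\<^sup>2" using norm_BP_le_energy[OF t, of x] assms(3) by simp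
  then have "norm ?p \<le> 2" by (rule power2_le_imp_le) simp
  then have "2 * (?p \<bullet> saturation ((- (1/2 + \<eta>)) *\<^sub>R ?p)) \<le> - (?p \<bullet> ?p)"
    using \<eta> by (intro inner_saturation_upper) auto
  moreover have "0 \<le> 2 * \<gamma> t * (x \<bullet> (X (\<gamma> t) *v x))"
    using psd_nonneg[OF pd_imp_psd[OF riccati_X(1)[OF \<gamma>_pos[OF t]]], of x] \<gamma>_pos[OF t] by simp
  ultimately show ?thesis unfolding energy_rate_eq[OF t] by linarith
qed

lemma energy_rate_lower:
  obtains k where "k > 0"
    "\<And>t x. 0 \<le> t \<Longrightarrow> t < T \<Longrightarrow> - k * \<gamma> t * (x \<bullet> (P (\<gamma> t) *v x)) \<le> energy_rate t x"
proof -
  obtain c where c: "c > 0" "\<And>g x. g \<ge> \<gamma>0 \<Longrightarrow> c * (x \<bullet> (X g *v x)) \<le> x \<bullet> (P g *v x)"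
    using X_le_P[OF \<gamma>0] by blast
  \<comment> \<open>The three summands pay for the term \<open>\<gamma> P\<close>, for
    \<open>2 \<gamma> X\<close> through \<open>X \<le> P / c\<close>, and for the excess gain
    \<open>2 \<eta> (p \<bullet> p)\<close> through the bound \<open>2 n \<gamma>\<close> on the
    squared norm of \<open>p\<close>.\<close>
  define k where "k = 1 + 2 / c + 4 * real CARD('n) * \<eta>"
  have "- k * \<gamma> t * (x \<bullet> (P (\<gamma> t) *v x)) \<le> energy_rate t x" if t: "0 \<le> t" "t < T" for t x
  proof -
    let ?g = "\<gamma> t"
    let ?q = "x \<bullet> (P ?g *v x)"
    let ?p = "transpose B *v (P ?g *v x)"
    have g: "?g > 0" using \<gamma>_pos[OF t] .
    have "?p \<bullet> ?p \<le> 2 * real CARD('n) * ?g * ?q"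
      using norm_BP_le_energy[OF t, of x] by (simp add: energy_def power2_norm_eq_inner)
    then have "2 * \<eta> * (?p \<bullet> ?p) \<le> 2 * \<eta> * (2 * real CARD('n) * ?g * ?q)"
      using \<eta> by (intro mult_left_mono) auto
    moreover have "x \<bullet> (X ?g *v x) \<le> ?q / c"
      using c(2)[OF \<gamma>_ge[OF t], of x] c(1) by (simp add: pos_le_divide_eq mult.commute)
    then have "2 * ?g * (x \<bullet> (X ?g *v x)) \<le> 2 * ?g * (?q / c)"
      using g by (intro mult_left_mono) auto
    moreover have "k * ?g * ?q = ?g * ?q + 2 * ?g * (?q / c) + 2 * \<eta> * (2 * real CARD('n) * ?g * ?q)"
      by (simp add: k_def algebra_simps)
    ultimately show ?thesis
      unfolding energy_rate_eq[OF t] using inner_saturation_lower[of "1/2 + \<eta>" ?p] \<eta>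
      by (simp add: algebra_simps)
  qed
  moreover have "k > 0" using c(1) \<eta> by (simp add: k_def add_pos_nonneg)
  ultimately show thesis using that by blast
qed

text \<open>Product rule in three parts: the weight, the state with the matrix frozen
  (\<open>energy_rate\<close>), and the drift of \<open>P\<close> with its parameter.\<close>

definition energy' :: "real \<Rightarrow> real^'n \<Rightarrow> real" where
  "energy' t x = 2 * real CARD('n) * (\<gamma> t / (T - t)) * (x \<bullet> (P (\<gamma> t) *v x)) +
     2 * real CARD('n) * \<gamma> t * (energy_rate t x + \<gamma> t / (T - t) * (x \<bullet> (P' (\<gamma> t) *v x)))"

lemma energy_derivative:
  assumes sol: "solution_from f t0 T x0 x" and "0 \<le> t0" and t: "t \<in> {t0..<T}"
  shows "((\<lambda>s. energy s (x s)) has_real_derivative energy' t (x t)) (at t within {t0..<T})"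
proof -
  have t': "0 \<le> t" "t < T" using assms by auto
  have dx: "(x has_vector_derivative f t (x t)) (at t within {t0..<T})"
    using sol t by (simp add: solution_from_def)
  have tP: "transpose (P (\<gamma> t)) = P (\<gamma> t)" using P_pd[OF \<gamma>_pos[OF t']] by (rule pd_symmetric)
  have "((\<lambda>s. x s \<bullet> (P (\<gamma> s) *v x s)) has_vector_derivative
      x t \<bullet> (P (\<gamma> t) *v f t (x t) + ((\<gamma> t / (T - t)) *\<^sub>R P' (\<gamma> t)) *v x t) + f t (x t) \<bullet> (P (\<gamma> t) *v x t))
      (at t within {t0..<T})"
    by (intro bounded_bilinear.has_vector_derivative[OF bounded_bilinear_inner]
        bounded_bilinear.has_vector_derivative[OF bounded_bilinear_matrix_vector] dx P\<gamma>_derivative[OF t'])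
  moreover have "f t (x t) \<bullet> (P (\<gamma> t) *v x t) = x t \<bullet> (P (\<gamma> t) *v f t (x t))"
    using inner_symmetric_mult[OF tP, of "x t" "f t (x t)"] by (simp add: inner_commute)
  ultimately have "((\<lambda>s. x s \<bullet> (P (\<gamma> s) *v x s)) has_real_derivative
      energy_rate t (x t) + \<gamma> t / (T - t) * (x t \<bullet> (P' (\<gamma> t) *v x t))) (at t within {t0..<T})"
    by (simp add: has_real_derivative_iff_has_vector_derivative energy_rate_def inner_add_right
        matrix_vector_scaleR_left)
  from DERIV_mult[OF DERIV_cmult[OF \<gamma>_derivative[OF t'(2)], of "2 * real CARD('n)"] this]
  show ?thesis
    unfolding energy_def energy'_def by (simp add: algebra_simps)
qed

lemma energy'_upper:
  assumes t: "0 \<le> t" "t < T" and "energy t x \<le> 4"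
  shows "energy' t x \<le> - ((T * \<gamma>0 - 1 - d / (2 * real CARD('n))) / (T - t)) * energy t x"
proof -
  let ?g = "\<gamma> t"
  let ?q = "x \<bullet> (P ?g *v x)"
  have g: "?g > 0" using \<gamma>_pos[OF t] .
  have "?g / (T - t) * (x \<bullet> (P' ?g *v x)) \<le> ?g / (T - t) * (d / (2 * real CARD('n) * ?g) * ?q)"
    using quadratic_P'_le[OF d g, of x] g t by (intro mult_left_mono) auto
  also have "\<dots> = d / (2 * real CARD('n)) / (T - t) * ?q" using g by simp
  finally have "2 * real CARD('n) * ?g * (energy_rate t x + ?g / (T - t) * (x \<bullet> (P' ?g *v x))) \<le>
      2 * real CARD('n) * ?g * (- ?g * ?q + d / (2 * real CARD('n)) / (T - t) * ?q)"
    using energy_rate_upper[OF assms] g by (intro mult_left_mono add_mono) auto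
  then have "energy' t x \<le> 2 * real CARD('n) * (?g / (T - t)) * ?q + 2 * real CARD('n) * ?g * (- ?g * ?q + d / (2 * real CARD('n)) / (T - t) * ?q)"
    by (simp add: energy'_def)
  also have "\<dots> = - (?g - 1 / (T - t) - d / (2 * real CARD('n)) / (T - t)) * energy t x"
    by (simp add: energy_def algebra_simps)
  also have "?g = T * \<gamma>0 / (T - t)" by (simp add: gain_param_def)
  finally show ?thesis by (simp add: diff_divide_distrib)
qed

lemma energy_nonneg: "0 \<le> t \<Longrightarrow> t < T \<Longrightarrow> 0 \<le> energy t x"
  using psd_nonneg[OF pd_imp_psd[OF P_pd[OF \<gamma>_pos]], of t x] \<gamma>_pos[of t] by (simp add: energy_def)

text \<open>The drift of the weight and of \<open>P\<close> can only increase the energy, so the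
  bound on \<open>energy_rate\<close> alone suffices; it holds without restriction to the
  ellipsoid.\<close>

lemma energy'_lower:
  obtains k where "k > 0"
    "\<And>t x. 0 \<le> t \<Longrightarrow> t < T \<Longrightarrow> - (k / (T - t)) * energy t x \<le> energy' t x"
proof -
  obtain k where k: "k > 0"
    "\<And>t x. 0 \<le> t \<Longrightarrow> t < T \<Longrightarrow> - k * \<gamma> t * (x \<bullet> (P (\<gamma> t) *v x)) \<le> energy_rate t x"
    using energy_rate_lower by blast
  have "- (k * T * \<gamma>0 / (T - t)) * energy t x \<le> energy' t x" if t: "0 \<le> t" "t < T" for t x
  proof -
    let ?g = "\<gamma> t"
    let ?q = "x \<bullet> (P ?g *v x)"
    have g: "?g > 0" using \<gamma>_pos[OF t] .
    have "0 \<le> 2 * real CARD('n) * (?g / (T - t)) * ?q"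
      using g t psd_nonneg[OF pd_imp_psd[OF P_pd[OF g]], of x] by simp
    moreover have "0 \<le> ?g / (T - t) * (x \<bullet> (P' ?g *v x))"
      using g t psd_nonneg[OF psd_P'[OF g], of x] by simp
    then have "2 * real CARD('n) * ?g * (- k * ?g * ?q) \<le>
        2 * real CARD('n) * ?g * (energy_rate t x + ?g / (T - t) * (x \<bullet> (P' ?g *v x)))"
      using k(2)[OF t, of x] g by (intro mult_left_mono) auto
    ultimately have le: "2 * real CARD('n) * ?g * (- k * ?g * ?q) \<le> energy' t x"
      unfolding energy'_def by linarith
    have "2 * real CARD('n) * ?g * (- k * ?g * ?q) = - (k * ?g) * energy t x"
      by (simp add: energy_def)
    also have "k * ?g = k * T * \<gamma>0 / (T - t)" by (simp add: gain_param_def)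
    finally show ?thesis using le by (simp only:)
  qed
  moreover have "k * T * \<gamma>0 > 0" using k(1) T \<gamma>0 by simp
  ultimately show thesis using that by blast
qed

text \<open>The upper rate is valid only while the energy is at most 4. At level 4 it is strictly
  negative, so that level is never crossed; only then can the rate be integrated up to
  \<open>T\<close>.\<close>

lemma energy_decay:
  assumes sol: "solution_from f t0 T x0 x" and t0: "0 \<le> t0" and init: "energy t0 x0 \<le> 4"
    and t: "t0 \<le> t" "t < T" and k: "T * \<gamma>0 - 1 - d / (2 * real CARD('n)) > 0"
  shows "energy t (x t) \<le> ((T - t) / (T - t0)) powr (T * \<gamma>0 - 1 - d / (2 * real CARD('n))) * energy t0 x0"
proof -
  let ?V = "\<lambda>s. energy s (x s)"
  let ?k = "T * \<gamma>0 - 1 - d / (2 * real CARD('n))"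
  note dV = energy_derivative[OF sol t0]
  have x0: "x t0 = x0" using sol by (simp add: solution_from_def)
  have inv: "?V s \<le> 4" if s: "s \<in> {t0..<T}" for s
  proof (rule sublevel_invariant[of t0 T ?V "\<lambda>s. energy' s (x s)", OF dV])
    fix r assume r: "r \<in> {t0..<T}" "energy r (x r) = 4"
    have "energy' r (x r) \<le> - (?k / (T - r)) * 4"
      using energy'_upper[of r "x r"] r t0 by simp
    also have "\<dots> < 0" using k r by simp
    finally show "energy' r (x r) < 0" .
  qed (use init x0 s in auto)
  have "?V t \<le> ((T - t) / (T - t0)) powr ?k * ?V t0"
    by (rule powr_rate_upper_bound[OF dV _ t]) (use energy'_upper inv t0 in auto)
  then show ?thesis by (simp add: x0)
qed

text \<open>Both the weight and \<open>P\<close> are smallest at \<open>\<gamma>0\<close>, so one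
  constant serves all times.\<close>

lemma norm_le_energy:
  obtains m where "m > 0" "\<And>t x. 0 \<le> t \<Longrightarrow> t < T \<Longrightarrow> m * (norm x)\<^sup>2 \<le> energy t x"
proof -
  obtain c where c: "c > 0" "\<And>x. c * (x \<bullet> x) \<le> x \<bullet> (P \<gamma>0 *v x)"
    by (rule pd_lower_bound[OF P_pd[OF \<gamma>0]]) blast
  have "2 * real CARD('n) * \<gamma>0 * c * (norm x)\<^sup>2 \<le> energy t x" if t: "0 \<le> t" "t < T" for t x
  proof -
    have "c * (x \<bullet> x) \<le> x \<bullet> (P (\<gamma> t) *v x)"
      using c(2)[of x] quadratic_P_mono[OF \<gamma>0 \<gamma>_ge[OF t], of x] by simp
    moreover have "2 * real CARD('n) * \<gamma>0 \<le> 2 * real CARD('n) * \<gamma> t" using \<gamma>_ge[OF t] by simp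
    ultimately have "2 * real CARD('n) * \<gamma>0 * (c * (x \<bullet> x)) \<le> 2 * real CARD('n) * \<gamma> t * (x \<bullet> (P (\<gamma> t) *v x))"
      using \<gamma>0 c(1) \<gamma>_pos[OF t] by (intro mult_mono) auto
    then show ?thesis by (simp add: energy_def dot_square_norm mult.assoc)
  qed
  then show thesis using that[of "2 * real CARD('n) * \<gamma>0 * c"] c(1) \<gamma>0 by simp
qed

text \<open>With \<open>\<gamma> / \<gamma>0 = T / (T - t)\<close>, the weight contributes one power
  of this ratio and the growth of \<open>P\<close> contributes \<open>d / (2 n)\<close>
  more.\<close>

lemma energy_le_norm:
  obtains C where "C > 0"
    "\<And>t x. 0 \<le> t \<Longrightarrow> t < T \<Longrightarrow> energy t x \<le> C * ((T - t) / T) powr (- (1 + d / (2 * real CARD('n)))) * (norm x)\<^sup>2"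
proof -
  define c where "c = onorm ((*v) (P \<gamma>0)) + 1"
  have c: "c > 0" using onorm_pos_le[of "(*v) (P \<gamma>0)"] by (simp add: c_def)
  have inv: "inverse s powr a = s powr (- a)" if "s \<ge> 0" for s a :: real
    using that by (simp add: powr_minus inverse_powr)
  have "energy t x \<le> 2 * real CARD('n) * \<gamma>0 * c * ((T - t) / T) powr (- (1 + d / (2 * real CARD('n)))) * (norm x)\<^sup>2"
    if t: "0 \<le> t" "t < T" for t x
  proof -
    let ?r = "\<gamma> t / \<gamma>0"
    have r: "?r > 0" using \<gamma>_pos[OF t] \<gamma>0 by simp
    have "x \<bullet> (P \<gamma>0 *v x) \<le> c * (x \<bullet> x)"
      using quadratic_upper_bound[of x "P \<gamma>0"] inner_ge_zero[of x] unfolding c_def distrib_right by linarith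
    then have "?r powr (d / (2 * real CARD('n))) * (x \<bullet> (P \<gamma>0 *v x)) \<le> ?r powr (d / (2 * real CARD('n))) * (c * (norm x)\<^sup>2)"
      by (intro mult_left_mono) (auto simp: dot_square_norm)
    then have "x \<bullet> (P (\<gamma> t) *v x) \<le> ?r powr (d / (2 * real CARD('n))) * (c * (norm x)\<^sup>2)"
      using quadratic_P_growth[OF d \<gamma>0 \<gamma>_ge[OF t], of x] by simp
    then have "energy t x \<le> 2 * real CARD('n) * \<gamma> t * (?r powr (d / (2 * real CARD('n))) * (c * (norm x)\<^sup>2))"
      unfolding energy_def using \<gamma>_pos[OF t] by (intro mult_left_mono) auto
    also have "\<dots> = 2 * real CARD('n) * \<gamma>0 * c * (?r * ?r powr (d / (2 * real CARD('n)))) * (norm x)\<^sup>2"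
      using \<gamma>0 by simp
    also have "?r * ?r powr (d / (2 * real CARD('n))) = ?r powr (1 + d / (2 * real CARD('n)))"
      using \<gamma>_pos[OF t] \<gamma>0 by (simp add: powr_add)
    also have "?r = inverse ((T - t) / T)" using \<gamma>0 by (simp add: gain_param_def)
    also have "\<dots> powr (1 + d / (2 * real CARD('n))) = ((T - t) / T) powr (- (1 + d / (2 * real CARD('n))))"
      using t T by (intro inv) simp
    finally show ?thesis .
  qed
  moreover have "2 * real CARD('n) * \<gamma>0 * c > 0" using c \<gamma>0 by simp
  ultimately show thesis using that by blast
qed

end

lemma le_sqrt_powr:
  fixes a b C r :: real
  assumes "a\<^sup>2 \<le> C * r powr k * b\<^sup>2" "0 \<le> C" "0 \<le> b"
  shows "a \<le> sqrt C * r powr (k / 2) * b"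
proof (rule power2_le_imp_le)
  have "(r powr (k / 2))\<^sup>2 = r powr k"
    by (simp add: power2_eq_square flip: powr_add)
  then show "a\<^sup>2 \<le> (sqrt C * r powr (k / 2) * b)\<^sup>2"
    using assms by (simp add: power_mult_distrib)
qed (use assms in simp)

lemma sqrt_powr_le:
  fixes a b C r :: real
  assumes "C * r powr k * b\<^sup>2 \<le> a\<^sup>2" "0 \<le> C" "0 \<le> a"
  shows "sqrt C * r powr (k / 2) * b \<le> a"
proof (rule power2_le_imp_le)
  have "(r powr (k / 2))\<^sup>2 = r powr k"
    by (simp add: power2_eq_square flip: powr_add)
  then show "(sqrt C * r powr (k / 2) * b)\<^sup>2 \<le> a\<^sup>2"
    using assms by (simp add: power_mult_distrib)
qed (use assms in simp)

section \<open>Stability and two-sided power bounds\<close>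

context saturated_loop
begin

lemma ellipsoid_energy: "x0 \<in> ellipsoid A B \<gamma>0 \<longleftrightarrow> energy 0 x0 \<le> 4"
  using T by (simp add: ellipsoid_def energy_def gain_param_def)

lemma lyapunov_stable_closed_loop:
  assumes k: "T * \<gamma>0 - 1 - d / (2 * real CARD('n)) > 0"
  shows "lyapunov_stable f T"
  unfolding lyapunov_stable_def
proof (intro ballI allI impI)
  fix t0 \<epsilon> :: real
  assume "t0 \<in> {0..<T}" and \<epsilon>: "\<epsilon> > 0"
  then have t0: "0 \<le> t0" "t0 < T" by auto
  obtain m where m: "m > 0" "\<And>t x. 0 \<le> t \<Longrightarrow> t < T \<Longrightarrow> m * (norm x)\<^sup>2 \<le> energy t x"
    by (rule norm_le_energy) blast
  obtain C where C: "C > 0"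
    "\<And>t x. 0 \<le> t \<Longrightarrow> t < T \<Longrightarrow>
      energy t x \<le> C * ((T - t) / T) powr (- (1 + d / (2 * real CARD('n)))) * (norm x)\<^sup>2"
    by (rule energy_le_norm) blast
  \<comment> \<open>The bound of the energy at the initial time deteriorates as \<open>t0\<close>
    approaches \<open>T\<close>; the resulting stability radius depends on
    \<open>t0\<close>.\<close>
  define K where "K = C * ((T - t0) / T) powr (- (1 + d / (2 * real CARD('n))))"
  have K: "K > 0" using C(1) t0 T by (simp add: K_def)
  \<comment> \<open>The level 4 puts the initial state into the region of decay; the other level
    turns the energy bound into \<open>norm (x t) < \<epsilon>\<close>.\<close>
  define \<mu> where "\<mu> = min 4 (m * \<epsilon>\<^sup>2)"
  have \<mu>: "\<mu> > 0" using m(1) \<epsilon> by (simp add: \<mu>_def)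
  show "\<exists>\<delta>>0. \<forall>x0. norm x0 < \<delta> \<longrightarrow> (\<exists>x. solution_from f t0 T x0 x) \<and>
      (\<forall>x. solution_from f t0 T x0 x \<longrightarrow> (\<forall>t\<in>{t0..<T}. norm (x t) < \<epsilon>))"
  proof (intro exI[of _ "sqrt (\<mu> / K)"] conjI allI impI ballI)
    show "sqrt (\<mu> / K) > 0" using \<mu> K by simp
    fix x0 :: "real^'n" assume "norm x0 < sqrt (\<mu> / K)"
    then have "(norm x0)\<^sup>2 < (sqrt (\<mu> / K))\<^sup>2" by (intro power_strict_mono) auto
    then have "(norm x0)\<^sup>2 < \<mu> / K" using \<mu> K by simp
    then have "K * (norm x0)\<^sup>2 < \<mu>" using K by (simp add: pos_less_divide_eq mult.commute)
    then have E0: "energy t0 x0 < \<mu>" using C(2)[OF t0, of x0] by (simp add: K_def)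
    show "\<exists>x. solution_from f t0 T x0 x" by (rule solution_exists[OF t0])
    fix x t assume sol: "solution_from f t0 T x0 x" and t: "t \<in> {t0..<T}"
    have "m * (norm (x t))\<^sup>2 \<le> energy t (x t)" using m(2) t t0 by auto
    also have "\<dots> \<le> ((T - t) / (T - t0)) powr (T * \<gamma>0 - 1 - d / (2 * real CARD('n))) * energy t0 x0"
      using E0 t by (intro energy_decay[OF sol t0(1) _ _ _ k]) (auto simp: \<mu>_def)
    also have "\<dots> \<le> 1 * energy t0 x0"
      using k t t0 energy_nonneg[OF t0] by (intro mult_right_mono powr_le1) auto
    also have "\<dots> < m * \<epsilon>\<^sup>2" using E0 by (simp add: \<mu>_def)
    finally have "(norm (x t))\<^sup>2 < \<epsilon>\<^sup>2" using m(1) by simp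
    then show "norm (x t) < \<epsilon>" using \<epsilon> by (auto intro: power2_less_imp_less)
  qed
qed

text \<open>The exponents are halved because the energy is quadratic. The lower exponent is
  \<open>(k2 + D) / 2\<close>: the energy may fall like the power \<open>k2\<close>, and the
  conversion from energy to norm costs another \<open>D\<close>. The input decays as fast as the
  upper bound of the state despite the growing gain, since the energy itself dominates the squared
  norm of \<open>B^T P x\<close>.\<close>

lemma state_and_input_bounds:
  assumes k: "T * \<gamma>0 - 1 - d / (2 * real CARD('n)) > 0"
  shows "\<exists>\<alpha>1 \<alpha>2 \<alpha>3 \<alpha>4 \<alpha>5 :: real.
    \<alpha>1 > 0 \<and> \<alpha>2 > 0 \<and> \<alpha>3 > 0 \<and> \<alpha>4 > 0 \<and> \<alpha>5 > 0 \<and>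
    (\<forall>x0\<in>ellipsoid A B \<gamma>0. \<forall>x. solution_from f 0 T x0 x \<longrightarrow>
      (\<forall>t\<in>{0..<T}.
         \<alpha>1 * (T - t) powr \<alpha>3 * norm x0 \<le> norm (x t) \<and>
         norm (x t) \<le> \<alpha>2 * (T - t) powr \<alpha>4 * norm x0 \<and>
         norm (saturation (feedback A B T \<gamma>0 \<eta> t (x t))) \<le> \<alpha>5 * (T - t) powr \<alpha>4 * norm x0))"
proof -
  define k1 where "k1 = T * \<gamma>0 - 1 - d / (2 * real CARD('n))"
  define D where "D = 1 + d / (2 * real CARD('n))"
  obtain k2 where k2: "k2 > 0"
    "\<And>t x. 0 \<le> t \<Longrightarrow> t < T \<Longrightarrow> - (k2 / (T - t)) * energy t x \<le> energy' t x"
    by (rule energy'_lower) blast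
  obtain m where m: "m > 0" "\<And>t x. 0 \<le> t \<Longrightarrow> t < T \<Longrightarrow> m * (norm x)\<^sup>2 \<le> energy t x"
    by (rule norm_le_energy) blast
  obtain C where C: "C > 0"
    "\<And>t x. 0 \<le> t \<Longrightarrow> t < T \<Longrightarrow> energy t x \<le> C * ((T - t) / T) powr (- D) * (norm x)\<^sup>2"
    unfolding D_def by (rule energy_le_norm) blast
  have D: "D > 0" using d by (auto simp: D_def is_delta_c_def intro!: add_pos_nonneg)
  have bounds: "sqrt (m / C) * ((T - t) / T) powr ((k2 + D) / 2) * norm x0 \<le> norm (x t) \<and>
      norm (x t) \<le> sqrt (C / m) * ((T - t) / T) powr (k1 / 2) * norm x0 \<and>
      norm (saturation (feedback A B T \<gamma>0 \<eta> t (x t)))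
        \<le> (1/2 + \<eta>) * (sqrt C * ((T - t) / T) powr (k1 / 2) * norm x0)"
    if x0: "x0 \<in> ellipsoid A B \<gamma>0" and sol: "solution_from f 0 T x0 x" and "t \<in> {0..<T}" for x0 x t
  proof -
    define r where "r = (T - t) / T"
    have t: "0 \<le> t" "t < T" and r: "r > 0" using \<open>t \<in> {0..<T}\<close> by (auto simp: r_def)
    have x00: "x 0 = x0" using sol by (simp add: solution_from_def)
    have E0: "m * (norm x0)\<^sup>2 \<le> energy 0 x0" "energy 0 x0 \<le> C * (norm x0)\<^sup>2"
      using m(2)[of 0 x0] C(2)[of 0 x0] T by simp_all
    have "energy t (x t) \<le> r powr k1 * energy 0 x0"
      using energy_decay[OF sol _ _ t k] x0 by (simp add: ellipsoid_energy r_def k1_def)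
    also have "\<dots> \<le> r powr k1 * (C * (norm x0)\<^sup>2)" using E0 by (intro mult_left_mono) auto
    finally have Eup: "energy t (x t) \<le> C * r powr k1 * (norm x0)\<^sup>2" by (simp add: mult_ac)
    have "((T - t) / (T - 0)) powr k2 * energy 0 (x 0) \<le> energy t (x t)"
    proof (rule powr_rate_lower_bound[OF energy_derivative[OF sol order_refl] _ t])
      fix s assume "s \<in> {0..<T}"
      then show "- (k2 / (T - s)) * energy s (x s) \<le> energy' s (x s)" by (intro k2) auto
    qed
    then have Elow: "r powr k2 * energy 0 x0 \<le> energy t (x t)" by (simp add: r_def x00)
    have "m * (norm (x t))\<^sup>2 \<le> C * r powr k1 * (norm x0)\<^sup>2"
      using m(2)[OF t, of "x t"] Eup by simp
    then have "(norm (x t))\<^sup>2 \<le> C / m * r powr k1 * (norm x0)\<^sup>2"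
      using m(1) by (simp add: pos_le_divide_eq mult.commute)
    then have upper: "norm (x t) \<le> sqrt (C / m) * r powr (k1 / 2) * norm x0"
      using m(1) C(1) by (intro le_sqrt_powr) auto
    have "r powr k2 * (m * (norm x0)\<^sup>2) \<le> C * r powr (- D) * (norm (x t))\<^sup>2"
      using mult_left_mono[OF E0(1), of "r powr k2"] Elow C(2)[OF t, of "x t"] by (simp add: r_def)
    then have "r powr D * (r powr k2 * (m * (norm x0)\<^sup>2)) \<le> r powr D * (C * r powr (- D) * (norm (x t))\<^sup>2)"
      by (intro mult_left_mono) auto
    moreover have "r powr D * r powr (- D) = 1" using r by (simp flip: powr_add)
    then have "r powr D * (C * r powr (- D) * (norm (x t))\<^sup>2) = C * (norm (x t))\<^sup>2"
      by (metis (no_types, opaque_lifting) mult.assoc mult.commute mult.right_neutral)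
    moreover have "r powr D * (r powr k2 * (m * (norm x0)\<^sup>2)) = m * r powr (k2 + D) * (norm x0)\<^sup>2"
      by (simp add: powr_add)
    ultimately have "m * r powr (k2 + D) * (norm x0)\<^sup>2 \<le> C * (norm (x t))\<^sup>2"
      by (simp only:)
    then have "m / C * r powr (k2 + D) * (norm x0)\<^sup>2 \<le> (norm (x t))\<^sup>2"
      using C(1) by (simp add: pos_divide_le_eq mult.commute)
    then have lower: "sqrt (m / C) * r powr ((k2 + D) / 2) * norm x0 \<le> norm (x t)"
      using m(1) C(1) by (intro sqrt_powr_le) auto
    let ?p = "transpose B *v (P (\<gamma> t) *v x t)"
    have "(norm ?p)\<^sup>2 \<le> C * r powr k1 * (norm x0)\<^sup>2"
      using norm_BP_le_energy[OF t, of "x t"] Eup by simp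
    then have p: "norm ?p \<le> sqrt C * r powr (k1 / 2) * norm x0"
      using C(1) by (intro le_sqrt_powr) auto
    have "norm (saturation (feedback A B T \<gamma>0 \<eta> t (x t))) \<le> norm (feedback A B T \<gamma>0 \<eta> t (x t))"
      by (rule norm_saturation_le)
    also have "\<dots> = (1/2 + \<eta>) * norm ?p" using \<eta> by (simp add: feedback_def)
    also have "\<dots> \<le> (1/2 + \<eta>) * (sqrt C * r powr (k1 / 2) * norm x0)"
      using \<eta> by (intro mult_left_mono p) auto
    finally show ?thesis using lower upper by (simp add: r_def)
  qed
  have ratio: "((T - t) / T) powr a = (T - t) powr a / T powr a" for t a
    by (rule powr_divide)
  show ?thesis
  proof (intro exI conjI)
    show "sqrt (m / C) / T powr ((k2 + D) / 2) > 0" "sqrt (C / m) / T powr (k1 / 2) > 0"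
      "(k2 + D) / 2 > 0" "k1 / 2 > 0" "(1/2 + \<eta>) * sqrt C / T powr (k1 / 2) > 0"
      using m(1) C(1) k2(1) D k T \<eta> by (simp_all add: k1_def add_pos_nonneg)
    show "\<forall>x0\<in>ellipsoid A B \<gamma>0. \<forall>x. solution_from f 0 T x0 x \<longrightarrow> (\<forall>t\<in>{0..<T}.
        sqrt (m / C) / T powr ((k2 + D) / 2) * (T - t) powr ((k2 + D) / 2) * norm x0 \<le> norm (x t) \<and>
        norm (x t) \<le> sqrt (C / m) / T powr (k1 / 2) * (T - t) powr (k1 / 2) * norm x0 \<and>
        norm (saturation (feedback A B T \<gamma>0 \<eta> t (x t)))
          \<le> (1/2 + \<eta>) * sqrt C / T powr (k1 / 2) * (T - t) powr (k1 / 2) * norm x0)"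
    proof (intro ballI allI impI)
      fix x0 x t assume "x0 \<in> ellipsoid A B \<gamma>0" "solution_from f 0 T x0 x" "t \<in> {0..<T}"
      from bounds[OF this]
      show "sqrt (m / C) / T powr ((k2 + D) / 2) * (T - t) powr ((k2 + D) / 2) * norm x0 \<le> norm (x t) \<and>
        norm (x t) \<le> sqrt (C / m) / T powr (k1 / 2) * (T - t) powr (k1 / 2) * norm x0 \<and>
        norm (saturation (feedback A B T \<gamma>0 \<eta> t (x t)))
          \<le> (1/2 + \<eta>) * sqrt C / T powr (k1 / 2) * (T - t) powr (k1 / 2) * norm x0"
        unfolding ratio times_divide_eq_left times_divide_eq_right mult.assoc .
    qed
  qed
qed

end

theorem theorem2:
  fixes A :: "real^'n^'n" and B :: "real^'m^'n"
    and \<Omega> :: "(real^'n) set" and \<gamma>0 \<delta>c T \<eta> :: real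
  assumes "controllable A B"
    and "\<forall>l. complex_eigenvalue A l \<longrightarrow> Re l \<le> 0"
    and "is_delta_c A B \<delta>c"
    and "bounded \<Omega>"
    and "\<gamma>0 > 0"
    and "\<Omega> \<subseteq> ellipsoid A B \<gamma>0"
    and "T > (2 * real CARD('n) + \<delta>c) / (2 * real CARD('n) * \<gamma>0)"
    and "\<eta> \<ge> 0"
  shows "exact_finite_time_stable (closed_loop A B T \<gamma>0 \<eta>) T \<Omega> \<and>
    (\<exists>\<alpha>1 \<alpha>2 \<alpha>3 \<alpha>4 \<alpha>5 :: real.
       \<alpha>1 > 0 \<and> \<alpha>2 > 0 \<and> \<alpha>3 > 0 \<and> \<alpha>4 > 0 \<and> \<alpha>5 > 0 \<and>
       (\<forall>x0\<in>ellipsoid A B \<gamma>0. \<forall>x. solution_from (closed_loop A B T \<gamma>0 \<eta>) 0 T x0 x \<longrightarrow>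
          (\<forall>t\<in>{0..<T}.
             \<alpha>1 * (T - t) powr \<alpha>3 * norm x0 \<le> norm (x t) \<and>
             norm (x t) \<le> \<alpha>2 * (T - t) powr \<alpha>4 * norm x0 \<and>
             norm (saturation (feedback A B T \<gamma>0 \<eta> t (x t)))
               \<le> \<alpha>5 * (T - t) powr \<alpha>4 * norm x0)))"
proof -
  have \<delta>: "\<delta>c > 0" using assms(3) by (simp add: is_delta_c_def)
  then have "(2 * real CARD('n) + \<delta>c) / (2 * real CARD('n) * \<gamma>0) > 0"
    using assms(5) by (intro divide_pos_pos add_pos_pos mult_pos_pos) auto
  then have T: "T > 0" using assms(7) by linarith
  interpret saturated_loop A B T \<gamma>0 \<eta> \<delta>c
    using assms T controllable_imp_no_hidden_modes by unfold_locales auto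
  \<comment> \<open>This is the lower bound on \<open>T\<close> multiplied by
    \<open>\<gamma>0\<close>.\<close>
  have k: "T * \<gamma>0 - 1 - \<delta>c / (2 * real CARD('n)) > 0"
    using assms(5,7) by (simp add: pos_divide_less_eq field_simps)
  note bounds = state_and_input_bounds[OF k]
  have attr: "((\<lambda>t. norm (x t)) \<longlongrightarrow> 0) (at_left T)"
    if x0: "x0 \<in> \<Omega>" and sol: "solution_from f 0 T x0 x" for x0 x
  proof -
    obtain \<alpha>2 \<alpha>4 where "\<alpha>4 > 0" and
      le: "\<And>t. t \<in> {0..<T} \<Longrightarrow> norm (x t) \<le> \<alpha>2 * (T - t) powr \<alpha>4 * norm x0"
      using bounds x0 sol assms(6) by blast
    have near: "eventually (\<lambda>t. t \<in> {0<..<T}) (at_left T)"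
      using eventually_at_left_real[OF T] .
    have "((\<lambda>t. T - t) \<longlongrightarrow> T - T) (at_left T)" by (intro tendsto_intros)
    then have "((\<lambda>t. (T - t) powr \<alpha>4) \<longlongrightarrow> 0) (at_left T)"
      using \<open>\<alpha>4 > 0\<close> near
      by (intro tendsto_zero_powrI[where b = \<alpha>4]) (auto elim!: eventually_mono)
    then have "((\<lambda>t. \<alpha>2 * (T - t) powr \<alpha>4 * norm x0) \<longlongrightarrow> \<alpha>2 * 0 * norm x0) (at_left T)"
      by (intro tendsto_intros)
    then have "((\<lambda>t. \<alpha>2 * (T - t) powr \<alpha>4 * norm x0) \<longlongrightarrow> 0) (at_left T)" by simp
    then show ?thesis
    proof (rule tendsto_sandwich[OF _ _ tendsto_const, rotated 2])
      show "eventually (\<lambda>t. norm (x t) \<le> \<alpha>2 * (T - t) powr \<alpha>4 * norm x0) (at_left T)"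
        using near by eventually_elim (simp add: le)
    qed simp
  qed
  have "finite_time_stable f T \<Omega>"
    unfolding finite_time_stable_def
    using lyapunov_stable_closed_loop[OF k] solution_exists[of 0] T attr by auto
  then have "exact_finite_time_stable f T \<Omega>"
    unfolding exact_finite_time_stable_def using closed_loop_solution_nonzero by blast
  then show ?thesis using bounds by blast
qed

end
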